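(* Let $(M,\{I_1,I_2,I_3\},g)$ be an HKT manifold with an HKT potential function $\rho$. Suppose that $G$ is a compact Lie group acting smoothly on $M$ by hypercomplex isometries leaving $\rho$ invariant, with a $G$-moment map $\nu=(\nu_1,\nu_2,\nu_3):M\to\mathbf R^3\otimes\mathfrak g^*$, where $\mathfrak g$ is the Lie algebra of $G$. Suppose $\nu^{-1}(0)$ is non-empty, $G$ acts freely on it, and the tangent vectors to the orbits of $G$ in $\nu^{-1}(0)$ lie in $\ker(d_a\rho)$ for $a=1,2,3$. Then $\rho$ induces an HKT potential function on the reduced space $N=M/\!/G=\nu^{-1}(0)/G$ with its induced HKT structure; that is, the function $\rho_N$ on $N$ defined by $\rho_N(\pi(x))=\rho(x)$ for $x\in\nu^{-1}(0)$, where $\pi:\nu^{-1}(0)\to N$ is the quotient map, is an HKT potential for the induced HKT structure of $N$.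
   Context: All manifolds and maps are smooth. HKT-manifold: a manifold with a hypercomplex structure $\{I_1,I_2,I_3\}$ (integrable complex structures with $I_1I_2=-I_2I_1=I_3$), a Riemannian metric $g$ Hermitian for each $I_a$, and a connection $\nabla$ with $\nabla g=0$, $\nabla I_a=0$, such that $g(T(X,Y),Z)$ is a 3-form, where $T(X,Y)=\nabla_XY-\nabla_YX-[X,Y]$. Its Kähler forms are $\omega_a(X,Y)=g(I_aX,Y)$. A hypercomplex isometry is an isometry preserving each $I_a$. Operators: $I_a$ acts on 1-forms by $(I_a\alpha)(X)=-\alpha(I_aX)$ and on 2-forms by $(I_a\beta)(X,Y)=\beta(I_aX,I_aY)$. For a function $f$, $d_af=I_a\,df$; for a 1-form $\alpha$, $d_a\alpha=-I_a\,d(I_a\alpha)$. HKT potential: a function $\rho$ with $2\omega_1=dd_1\rho+d_2d_3\rho$, $2\omega_2=dd_2\rho+d_3d_1\rho$, $2\omega_3=dd_3\rho+d_1d_2\rho$. For $\xi\in\mathfrak g$ let $\xi_M$ be the vector field on $M$ generated by $\xi$. $G$-moment map: a smooth map $\nu=(\nu_1,\nu_2,\nu_3):M\to\mathbf R^3\otimes\mathfrak g^*$ which is $G$-equivariant (coadjoint action on $\mathfrak g^*$, trivial on $\mathbf R^3$) and satisfies the Cauchy–Riemann condition $I_1d\nu_1=I_2d\nu_2=I_3d\nu_3$ and the transversality condition: for every $m\in M$ and non-zero $\xi\in\mathfrak g$, $(I_ad\nu_a)_m(\xi_M(m))\ne0$ in $\mathfrak g^*$ (no sum over $a$). Induced HKT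 structure on $N=P/G$, $P=\nu^{-1}(0)$: for $m\in P$ put $\mathcal U_m=\{t\in T_mP:\ I_1d\nu_1(t)=I_2d\nu_2(t)=I_3d\nu_3(t)=0\}$. Then $TP=\mathcal U\oplus\ker d\pi$ is a $G$-invariant splitting with $\mathcal U$ closed under each $I_a$. For $\hat A\in T_{\pi(m)}N$ let $A^u\in\mathcal U_m$ be the unique vector with $d\pi(A^u)=\hat A$. The hypercomplex structure of $N$ is $\hat I_a\hat A=d\pi(I_aA^u)$ and its metric is $\hat g(\hat X,\hat Y)=g(X^u,Y^u)$; with these $N$ is an HKT manifold. *)

theory Defs
  imports "HOL-Analysis.Analysis" "HOL-Algebra.Group_Action"
begin

fun Ck_on :: "nat \<Rightarrow> 'a::euclidean_space set \<Rightarrow> ('a \<Rightarrow> real) \<Rightarrow> bool" where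
  "Ck_on 0 U f \<longleftrightarrow> continuous_on U f"
| "Ck_on (Suc k) U f \<longleftrightarrow>
     (\<forall>x\<in>U. f differentiable (at x)) \<and>
     (\<forall>v. Ck_on k U (\<lambda>x. frechet_derivative f (at x) v))"

definition smooth_on :: "'a::euclidean_space set \<Rightarrow> ('a \<Rightarrow> real) \<Rightarrow> bool" where
  "smooth_on U f \<longleftrightarrow> (\<forall>k. Ck_on k U f)"

text \<open>
  A smooth structure is recorded by its sheaf of smooth real functions: \<open>germs X x\<close> consists
  of the functions that are smooth on some neighbourhood of \<open>x\<close>. Such functions are total,
  but only their values near \<open>x\<close> on the carrier \<open>topspace (topo X)\<close> matter.
\<close>

record 'm smooth_space =
  topo :: "'m topology"
  germs :: "'m \<Rightarrow> ('m \<Rightarrow> real) set"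

abbreviation points :: "'m smooth_space \<Rightarrow> 'm set" where
  "points X \<equiv> topspace (topo X)"

definition nbhd :: "'m smooth_space \<Rightarrow> 'm \<Rightarrow> 'm set \<Rightarrow> bool" where
  "nbhd X x U \<longleftrightarrow> openin (topo X) U \<and> x \<in> U"

definition smooth_fun :: "'m smooth_space \<Rightarrow> ('m \<Rightarrow> real) \<Rightarrow> bool" where
  "smooth_fun X f \<longleftrightarrow> (\<forall>x\<in>points X. f \<in> germs X x)"

definition smooth_map :: "'m smooth_space \<Rightarrow> 'n smooth_space \<Rightarrow> ('m \<Rightarrow> 'n) \<Rightarrow> bool" where
  "smooth_map X Y F \<longleftrightarrow> continuous_map (topo X) (topo Y) F \<and>
     (\<forall>x\<in>points X. \<forall>h\<in>germs Y (F x). h \<circ> F \<in> germs X x)"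

text \<open>
  The model space of a manifold is a linear subspace \<open>W\<close> of a Euclidean space, so the dimension
  is \<open>dim W\<close>. This admits dimension 0 (as needed for finite groups), whereas a type of class
  \<open>euclidean_space\<close> has positive dimension. A function on a relatively open subset of \<open>W\<close> is
  smooth iff it extends locally to a smooth function on an open subset of the ambient space; for
  \<open>W = UNIV\<close> this is ordinary smoothness.
\<close>

definition chart :: "'a::euclidean_space set \<Rightarrow> 'm smooth_space \<Rightarrow> 'm set \<Rightarrow> ('m \<Rightarrow> 'a) \<Rightarrow> bool" where
  "chart W X U \<phi> \<longleftrightarrow>
     openin (topo X) U \<and> openin (top_of_set W) (\<phi> ` U) \<and>
     homeomorphic_map (subtopology (topo X) U) (top_of_set (\<phi> ` U)) \<phi> \<and>
     (\<forall>x\<in>U. \<forall>f. f \<in> germs X x \<longleftrightarrow>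
        (\<exists>V F U'. open V \<and> \<phi> x \<in> V \<and> smooth_on V F \<and> nbhd X x U' \<and> (\<forall>y\<in>U'. f y = F (\<phi> y))))"

definition manifold :: "'a::euclidean_space set \<Rightarrow> 'm smooth_space \<Rightarrow> bool" where
  "manifold W X \<longleftrightarrow> subspace W \<and> Hausdorff_space (topo X) \<and> second_countable (topo X) \<and>
     (\<forall>x\<in>points X. \<exists>U \<phi>. x \<in> U \<and> chart W X U \<phi>)"

definition smooth_product ::
  "'a::euclidean_space set \<Rightarrow> 'b::euclidean_space set \<Rightarrow> 'm smooth_space \<Rightarrow> 'n smooth_space \<Rightarrow>
   ('m \<times> 'n) smooth_space" where
  "smooth_product V W X Y =
     \<lparr>topo = prod_topology (topo X) (topo Y),
      germs = (\<lambda>(x, y). {f. \<exists>U \<phi> U' \<psi> Q F A B.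
        chart V X U \<phi> \<and> x \<in> U \<and> chart W Y U' \<psi> \<and> y \<in> U' \<and>
        open Q \<and> (\<phi> x, \<psi> y) \<in> Q \<and> smooth_on Q F \<and> nbhd X x A \<and> nbhd Y y B \<and>
        (\<forall>x'\<in>A. \<forall>y'\<in>B. f (x', y') = F (\<phi> x', \<psi> y'))})\<rparr>"

definition smooth_subspace :: "'m smooth_space \<Rightarrow> 'm set \<Rightarrow> 'm smooth_space" where
  "smooth_subspace X P =
     \<lparr>topo = subtopology (topo X) P,
      germs = (\<lambda>x. {f. \<exists>F\<in>germs X x. \<exists>U. nbhd X x U \<and> (\<forall>y\<in>U \<inter> P. f y = F y)})\<rparr>"

text \<open>
  The quotient of \<open>X\<close> along \<open>\<pi>\<close>: the quotient topology, with a function smooth iff its pull-back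
  along \<open>\<pi>\<close> is smooth. For a free smooth action of a compact Lie group on a manifold with orbit
  map \<open>\<pi>\<close> this is the quotient manifold, i.e. the smooth structure making \<open>\<pi>\<close> a submersion.
\<close>

definition quotient_topology :: "'m topology \<Rightarrow> ('m \<Rightarrow> 'n) \<Rightarrow> 'n topology" where
  "quotient_topology T \<pi> =
     topology (\<lambda>V. V \<subseteq> \<pi> ` topspace T \<and> openin T {x \<in> topspace T. \<pi> x \<in> V})"

lemma openin_quotient_topology:
  "openin (quotient_topology T \<pi>) V \<longleftrightarrow>
     V \<subseteq> \<pi> ` topspace T \<and> openin T {x \<in> topspace T. \<pi> x \<in> V}"
proof -
  let ?L = "\<lambda>V. V \<subseteq> \<pi> ` topspace T \<and> openin T {x \<in> topspace T. \<pi> x \<in> V}"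
  have "istopology ?L"
    unfolding istopology_def
  proof (intro conjI allI impI)
    fix A B assume "?L A" "?L B"
    then have "openin T ({x \<in> topspace T. \<pi> x \<in> A} \<inter> {x \<in> topspace T. \<pi> x \<in> B})"
      by blast
    moreover have "{x \<in> topspace T. \<pi> x \<in> A} \<inter> {x \<in> topspace T. \<pi> x \<in> B} =
        {x \<in> topspace T. \<pi> x \<in> A \<inter> B}" by blast
    ultimately show "openin T {x \<in> topspace T. \<pi> x \<in> A \<inter> B}" by simp
    show "A \<inter> B \<subseteq> \<pi> ` topspace T" using \<open>?L A\<close> by blast
  next
    fix K assume K: "\<forall>A\<in>K. ?L A"
    then have "openin T (\<Union>A\<in>K. {x \<in> topspace T. \<pi> x \<in> A})" by blast
    moreover have "(\<Union>A\<in>K. {x \<in> topspace T. \<pi> x \<in> A}) = {x \<in> topspace T. \<pi> x \<in> \<Union>K}"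
      by blast
    ultimately show "openin T {x \<in> topspace T. \<pi> x \<in> \<Union>K}" by simp
    show "\<Union>K \<subseteq> \<pi> ` topspace T" using K by blast
  qed
  then show ?thesis by (simp add: quotient_topology_def topology_inverse')
qed

definition smooth_quotient :: "'m smooth_space \<Rightarrow> ('m \<Rightarrow> 'n) \<Rightarrow> 'n smooth_space" where
  "smooth_quotient X \<pi> =
     \<lparr>topo = quotient_topology (topo X) \<pi>,
      germs = (\<lambda>n. {h. \<forall>x\<in>points X. \<pi> x = n \<longrightarrow> h \<circ> \<pi> \<in> germs X x})\<rparr>"

text \<open>
  Tangent vectors are derivations of the algebra of smooth germs; they are required to vanish
  on functions that are not smooth near the base point, so that equal derivations are equal
  as functions.
\<close>

type_synonym 'm tvec = "('m \<Rightarrow> real) \<Rightarrow> real"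

definition tzero :: "'m tvec" where "tzero = (\<lambda>f. 0)"

definition tadd :: "'m tvec \<Rightarrow> 'm tvec \<Rightarrow> 'm tvec" where
  "tadd v w = (\<lambda>f. v f + w f)"

definition tscale :: "real \<Rightarrow> 'm tvec \<Rightarrow> 'm tvec" where
  "tscale c v = (\<lambda>f. c * v f)"

definition tdiff :: "'m tvec \<Rightarrow> 'm tvec \<Rightarrow> 'm tvec" where
  "tdiff v w = tadd v (tscale (- 1) w)"

definition tangent :: "'m smooth_space \<Rightarrow> 'm \<Rightarrow> 'm tvec set" where
  "tangent X x = {v.
     (\<forall>f. f \<notin> germs X x \<longrightarrow> v f = 0) \<and>
     (\<forall>c. \<forall>f\<in>germs X x. v (\<lambda>y. c * f y) = c * v f) \<and>
     (\<forall>f\<in>germs X x. \<forall>h\<in>germs X x. v (\<lambda>y. f y + h y) = v f + v h) \<and>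
     (\<forall>f\<in>germs X x. \<forall>h\<in>germs X x. v (\<lambda>y. f y * h y) = f x * v h + h x * v f)}"

definition differential ::
  "'m smooth_space \<Rightarrow> 'n smooth_space \<Rightarrow> ('m \<Rightarrow> 'n) \<Rightarrow> 'm \<Rightarrow> 'm tvec \<Rightarrow> 'n tvec" where
  "differential X Y F x v = (\<lambda>h. if h \<in> germs Y (F x) then v (h \<circ> F) else 0)"

type_synonym 'm vfield = "'m \<Rightarrow> 'm tvec"

definition vfield_near :: "'m smooth_space \<Rightarrow> 'm \<Rightarrow> 'm vfield \<Rightarrow> bool" where
  "vfield_near X x A \<longleftrightarrow> (\<exists>U. nbhd X x U \<and>
     (\<forall>y\<in>U. A y \<in> tangent X y \<and> (\<forall>f\<in>germs X y. (\<lambda>z. A z f) \<in> germs X y)))"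

definition bracket :: "'m smooth_space \<Rightarrow> 'm vfield \<Rightarrow> 'm vfield \<Rightarrow> 'm vfield" where
  "bracket X A B = (\<lambda>x f. if f \<in> germs X x then A x (\<lambda>y. B y f) - B x (\<lambda>y. A y f) else 0)"

type_synonym 'm form1 = "'m \<Rightarrow> 'm tvec \<Rightarrow> real"
type_synonym 'm form2 = "'m \<Rightarrow> 'm tvec \<Rightarrow> 'm tvec \<Rightarrow> real"
type_synonym 'm endo = "'m \<Rightarrow> 'm tvec \<Rightarrow> 'm tvec"

definition d0 :: "('m \<Rightarrow> real) \<Rightarrow> 'm form1" where
  "d0 f = (\<lambda>x v. v f)"

text \<open>
  The exterior derivative of a smooth 1-form, by the formula
  \<open>d\<alpha>(A,B) = A(\<alpha>(B)) - B(\<alpha>(A)) - \<alpha>([A,B])\<close> (no factor 1/2), evaluated on any local extensions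
  \<open>A\<close>, \<open>B\<close> of the given tangent vectors; the value does not depend on the extensions.
\<close>

definition d1 :: "'m smooth_space \<Rightarrow> 'm form1 \<Rightarrow> 'm form2" where
  "d1 X \<alpha> = (\<lambda>x v w. THE r. \<forall>A B.
     vfield_near X x A \<and> vfield_near X x B \<and> A x = v \<and> B x = w \<longrightarrow>
     r = A x (\<lambda>y. \<alpha> y (B y)) - B x (\<lambda>y. \<alpha> y (A y)) - \<alpha> x (bracket X A B x))"

definition act1 :: "'m endo \<Rightarrow> 'm form1 \<Rightarrow> 'm form1" where
  "act1 I \<alpha> = (\<lambda>x v. - \<alpha> x (I x v))"

definition act2 :: "'m endo \<Rightarrow> 'm form2 \<Rightarrow> 'm form2" where
  "act2 I \<beta> = (\<lambda>x v w. \<beta> x (I x v) (I x w))"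

definition twisted_d0 :: "'m endo \<Rightarrow> ('m \<Rightarrow> real) \<Rightarrow> 'm form1" where
  "twisted_d0 I f = act1 I (d0 f)"

definition twisted_d1 :: "'m smooth_space \<Rightarrow> 'm endo \<Rightarrow> 'm form1 \<Rightarrow> 'm form2" where
  "twisted_d1 X I \<alpha> = (\<lambda>x v w. - act2 I (d1 X (act1 I \<alpha>)) x v w)"

definition smooth_endo :: "'m smooth_space \<Rightarrow> 'm endo \<Rightarrow> bool" where
  "smooth_endo X I \<longleftrightarrow>
     (\<forall>x\<in>points X.
        (\<forall>v\<in>tangent X x. I x v \<in> tangent X x) \<and>
        (\<forall>v\<in>tangent X x. \<forall>w\<in>tangent X x. I x (tadd v w) = tadd (I x v) (I x w)) \<and>
        (\<forall>c. \<forall>v\<in>tangent X x. I x (tscale c v) = tscale c (I x v)) \<and>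
        (\<forall>A. vfield_near X x A \<longrightarrow> vfield_near X x (\<lambda>y. I y (A y))))"

text \<open>Integrability is the vanishing of the Nijenhuis tensor.\<close>

definition complex_structure :: "'m smooth_space \<Rightarrow> 'm endo \<Rightarrow> bool" where
  "complex_structure X I \<longleftrightarrow> smooth_endo X I \<and>
     (\<forall>x\<in>points X. \<forall>v\<in>tangent X x. I x (I x v) = tscale (- 1) v) \<and>
     (\<forall>x\<in>points X. \<forall>A B. vfield_near X x A \<and> vfield_near X x B \<longrightarrow>
        tdiff (tdiff (bracket X (\<lambda>y. I y (A y)) (\<lambda>y. I y (B y)) x)
                     (I x (bracket X (\<lambda>y. I y (A y)) B x)))
              (tadd (I x (bracket X A (\<lambda>y. I y (B y)) x))
                    (bracket X A B x)) = tzero)"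

text \<open>The family \<open>J\<close> consists of \<open>J 1\<close>, \<open>J 2\<close>, \<open>J 3\<close>; its other values are irrelevant.\<close>

definition hypercomplex :: "'m smooth_space \<Rightarrow> (nat \<Rightarrow> 'm endo) \<Rightarrow> bool" where
  "hypercomplex X J \<longleftrightarrow>
     (\<forall>a\<in>{1,2,3}. complex_structure X (J a)) \<and>
     (\<forall>x\<in>points X. \<forall>v\<in>tangent X x.
        J 1 x (J 2 x v) = J 3 x v \<and> tscale (- 1) (J 2 x (J 1 x v)) = J 3 x v)"

definition riemannian_metric :: "'m smooth_space \<Rightarrow> 'm form2 \<Rightarrow> bool" where
  "riemannian_metric X g \<longleftrightarrow>
     (\<forall>x\<in>points X.
        (\<forall>v\<in>tangent X x. \<forall>w\<in>tangent X x. g x v w = g x w v) \<and>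
        (\<forall>u\<in>tangent X x. \<forall>v\<in>tangent X x. \<forall>w\<in>tangent X x.
           g x (tadd u v) w = g x u w + g x v w) \<and>
        (\<forall>c. \<forall>v\<in>tangent X x. \<forall>w\<in>tangent X x. g x (tscale c v) w = c * g x v w) \<and>
        (\<forall>v\<in>tangent X x. v \<noteq> tzero \<longrightarrow> 0 < g x v v) \<and>
        (\<forall>A B. vfield_near X x A \<and> vfield_near X x B \<longrightarrow> (\<lambda>y. g y (A y) (B y)) \<in> germs X x))"

definition hermitian :: "'m smooth_space \<Rightarrow> 'm form2 \<Rightarrow> 'm endo \<Rightarrow> bool" where
  "hermitian X g I \<longleftrightarrow>
     (\<forall>x\<in>points X. \<forall>v\<in>tangent X x. \<forall>w\<in>tangent X x. g x (I x v) (I x w) = g x v w)"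

text \<open>A connection sends a tangent vector \<open>v\<close> at \<open>x\<close> and a vector field \<open>A\<close> defined near \<open>x\<close>
  to the covariant derivative \<open>D x v A\<close> at \<open>x\<close>.\<close>

type_synonym 'm conn = "'m \<Rightarrow> 'm tvec \<Rightarrow> 'm vfield \<Rightarrow> 'm tvec"

definition connection :: "'m smooth_space \<Rightarrow> 'm conn \<Rightarrow> bool" where
  "connection X D \<longleftrightarrow>
     (\<forall>x\<in>points X. \<forall>A. vfield_near X x A \<longrightarrow>
        (\<forall>v\<in>tangent X x. D x v A \<in> tangent X x) \<and>
        (\<forall>v\<in>tangent X x. \<forall>w\<in>tangent X x. D x (tadd v w) A = tadd (D x v A) (D x w A)) \<and>
        (\<forall>c. \<forall>v\<in>tangent X x. D x (tscale c v) A = tscale c (D x v A)) \<and>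
        (\<forall>v\<in>tangent X x. \<forall>B. vfield_near X x B \<longrightarrow>
           D x v (\<lambda>y. tadd (A y) (B y)) = tadd (D x v A) (D x v B)) \<and>
        (\<forall>v\<in>tangent X x. \<forall>f\<in>germs X x.
           D x v (\<lambda>y. tscale (f y) (A y)) = tadd (tscale (v f) (A x)) (tscale (f x) (D x v A))) \<and>
        (\<forall>B. vfield_near X x B \<longrightarrow> vfield_near X x (\<lambda>y. D y (B y) A)))"

definition metric_parallel :: "'m smooth_space \<Rightarrow> 'm conn \<Rightarrow> 'm form2 \<Rightarrow> bool" where
  "metric_parallel X D g \<longleftrightarrow>
     (\<forall>x\<in>points X. \<forall>v\<in>tangent X x. \<forall>A B. vfield_near X x A \<and> vfield_near X x B \<longrightarrow>
        v (\<lambda>y. g y (A y) (B y)) = g x (D x v A) (B x) + g x (A x) (D x v B))"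

definition endo_parallel :: "'m smooth_space \<Rightarrow> 'm conn \<Rightarrow> 'm endo \<Rightarrow> bool" where
  "endo_parallel X D I \<longleftrightarrow>
     (\<forall>x\<in>points X. \<forall>v\<in>tangent X x. \<forall>A. vfield_near X x A \<longrightarrow>
        D x v (\<lambda>y. I y (A y)) = I x (D x v A))"

definition torsion :: "'m smooth_space \<Rightarrow> 'm conn \<Rightarrow> 'm vfield \<Rightarrow> 'm vfield \<Rightarrow> 'm vfield" where
  "torsion X D A B = (\<lambda>x. tdiff (tdiff (D x (A x) B) (D x (B x) A)) (bracket X A B x))"

text \<open>Multilinearity of \<open>g(T(A,B),C)\<close> holds for every connection and metric, so being a 3-form
  means being alternating.\<close>

definition torsion_3form :: "'m smooth_space \<Rightarrow> 'm conn \<Rightarrow> 'm form2 \<Rightarrow> bool" where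
  "torsion_3form X D g \<longleftrightarrow>
     (\<forall>x\<in>points X. \<forall>A B C. vfield_near X x A \<and> vfield_near X x B \<and> vfield_near X x C \<longrightarrow>
        g x (torsion X D A B x) (C x) = - g x (torsion X D B A x) (C x) \<and>
        g x (torsion X D A B x) (C x) = - g x (torsion X D A C x) (B x))"

definition HKT_manifold ::
  "'a::euclidean_space set \<Rightarrow> 'm smooth_space \<Rightarrow> (nat \<Rightarrow> 'm endo) \<Rightarrow> 'm form2 \<Rightarrow> bool" where
  "HKT_manifold W X J g \<longleftrightarrow>
     manifold W X \<and> hypercomplex X J \<and> riemannian_metric X g \<and>
     (\<forall>a\<in>{1,2,3}. hermitian X g (J a)) \<and>
     (\<exists>D. connection X D \<and> metric_parallel X D g \<and> (\<forall>a\<in>{1,2,3}. endo_parallel X D (J a)) \<and>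
        torsion_3form X D g)"

definition kaehler_form :: "'m endo \<Rightarrow> 'm form2 \<Rightarrow> 'm form2" where
  "kaehler_form I g = (\<lambda>x v w. g x (I x v) w)"

definition HKT_potential ::
  "'m smooth_space \<Rightarrow> (nat \<Rightarrow> 'm endo) \<Rightarrow> 'm form2 \<Rightarrow> ('m \<Rightarrow> real) \<Rightarrow> bool" where
  "HKT_potential X J g \<rho> \<longleftrightarrow> smooth_fun X \<rho> \<and>
     (\<forall>(a, b, c)\<in>{(1,2,3), (2,3,1), (3,1,2)}.
        \<forall>x\<in>points X. \<forall>v\<in>tangent X x. \<forall>w\<in>tangent X x.
          2 * kaehler_form (J a) g x v w =
            d1 X (twisted_d0 (J a) \<rho>) x v w + twisted_d1 X (J b) (twisted_d0 (J c) \<rho>) x v w)"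

definition lie_group ::
  "'b::euclidean_space set \<Rightarrow> ('g, 'x) monoid_scheme \<Rightarrow> 'g smooth_space \<Rightarrow> bool" where
  "lie_group V G S \<longleftrightarrow> group G \<and> manifold V S \<and> points S = carrier G \<and>
     smooth_map (smooth_product V V S S) S (\<lambda>(h, k). h \<otimes>\<^bsub>G\<^esub> k) \<and>
     smooth_map S S (\<lambda>h. inv\<^bsub>G\<^esub> h)"

definition lie_algebra :: "('g, 'x) monoid_scheme \<Rightarrow> 'g smooth_space \<Rightarrow> 'g tvec set" where
  "lie_algebra G S = tangent S \<one>\<^bsub>G\<^esub>"

definition Ad :: "('g, 'x) monoid_scheme \<Rightarrow> 'g smooth_space \<Rightarrow> 'g \<Rightarrow> 'g tvec \<Rightarrow> 'g tvec" where
  "Ad G S h = differential S S (\<lambda>k. h \<otimes>\<^bsub>G\<^esub> k \<otimes>\<^bsub>G\<^esub> inv\<^bsub>G\<^esub> h) \<one>\<^bsub>G\<^esub>"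

definition smooth_action ::
  "'b::euclidean_space set \<Rightarrow> 'a::euclidean_space set \<Rightarrow> ('g, 'x) monoid_scheme \<Rightarrow>
   'g smooth_space \<Rightarrow> 'm smooth_space \<Rightarrow> ('g \<Rightarrow> 'm \<Rightarrow> 'm) \<Rightarrow> bool" where
  "smooth_action V W G S M \<phi> \<longleftrightarrow> group_action G (points M) \<phi> \<and>
     smooth_map (smooth_product V W S M) M (\<lambda>(h, m). \<phi> h m)"

text \<open>The differential of the orbit map \<open>h \<mapsto> \<phi> h m\<close> at the identity, i.e. the velocity
  of \<open>\<phi> (exp (t \<xi>)) m\<close> at \<open>t = 0\<close>.\<close>

definition generated_field ::
  "('g, 'x) monoid_scheme \<Rightarrow> 'g smooth_space \<Rightarrow> 'm smooth_space \<Rightarrow> ('g \<Rightarrow> 'm \<Rightarrow> 'm) \<Rightarrow>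
   'g tvec \<Rightarrow> 'm vfield" where
  "generated_field G S M \<phi> \<xi> = (\<lambda>m. differential S M (\<lambda>h. \<phi> h m) \<one>\<^bsub>G\<^esub> \<xi>)"

definition hypercomplex_isometry ::
  "'m smooth_space \<Rightarrow> (nat \<Rightarrow> 'm endo) \<Rightarrow> 'm form2 \<Rightarrow> ('m \<Rightarrow> 'm) \<Rightarrow> bool" where
  "hypercomplex_isometry M J g F \<longleftrightarrow>
     bij_betw F (points M) (points M) \<and> smooth_map M M F \<and>
     smooth_map M M (inv_into (points M) F) \<and>
     (\<forall>m\<in>points M. \<forall>v\<in>tangent M m.
        (\<forall>w\<in>tangent M m. g (F m) (differential M M F m v) (differential M M F m w) = g m v w) \<and>
        (\<forall>a\<in>{1,2,3}. differential M M F m (J a m v) = J a (F m) (differential M M F m v)))"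

text \<open>
  A map into \<open>\<real>\<^sup>3 \<otimes> \<gg>\<^sup>*\<close> is given by the real functions \<open>\<lambda>m. \<nu> a m \<xi>\<close> for \<open>a = 1, 2, 3\<close>
  and \<open>\<xi>\<close> in the Lie algebra, linear in \<open>\<xi>\<close>. Hence the \<open>\<gg>\<^sup>*\<close>-valued 1-form \<open>I\<^sub>a d\<nu>\<^sub>a\<close> evaluated
  at \<open>\<eta>\<close> is \<open>twisted_d0 (J a) (\<lambda>m. \<nu> a m \<eta>)\<close>.
\<close>

definition twisted_dnu ::
  "(nat \<Rightarrow> 'm endo) \<Rightarrow> (nat \<Rightarrow> 'm \<Rightarrow> 'g tvec \<Rightarrow> real) \<Rightarrow> nat \<Rightarrow> 'm \<Rightarrow> 'm tvec \<Rightarrow> 'g tvec \<Rightarrow> real" where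
  "twisted_dnu J \<nu> a m v \<eta> = twisted_d0 (J a) (\<lambda>y. \<nu> a y \<eta>) m v"

definition moment_map ::
  "('g, 'x) monoid_scheme \<Rightarrow> 'g smooth_space \<Rightarrow> 'm smooth_space \<Rightarrow> (nat \<Rightarrow> 'm endo) \<Rightarrow>
   ('g \<Rightarrow> 'm \<Rightarrow> 'm) \<Rightarrow> (nat \<Rightarrow> 'm \<Rightarrow> 'g tvec \<Rightarrow> real) \<Rightarrow> bool" where
  "moment_map G S M J \<phi> \<nu> \<longleftrightarrow>
     (\<forall>a\<in>{1,2,3}. \<forall>m\<in>points M. \<forall>\<xi>\<in>lie_algebra G S.
        (\<forall>\<eta>\<in>lie_algebra G S. \<nu> a m (tadd \<xi> \<eta>) = \<nu> a m \<xi> + \<nu> a m \<eta>) \<and>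
        (\<forall>c. \<nu> a m (tscale c \<xi>) = c * \<nu> a m \<xi>)) \<and>
     (\<forall>a\<in>{1,2,3}. \<forall>\<xi>\<in>lie_algebra G S. smooth_fun M (\<lambda>m. \<nu> a m \<xi>)) \<and>
     (\<forall>a\<in>{1,2,3}. \<forall>h\<in>carrier G. \<forall>m\<in>points M. \<forall>\<xi>\<in>lie_algebra G S.
        \<nu> a (\<phi> h m) \<xi> = \<nu> a m (Ad G S (inv\<^bsub>G\<^esub> h) \<xi>)) \<and>
     (\<forall>m\<in>points M. \<forall>v\<in>tangent M m. \<forall>\<xi>\<in>lie_algebra G S.
        twisted_dnu J \<nu> 1 m v \<xi> = twisted_dnu J \<nu> 2 m v \<xi> \<and>
        twisted_dnu J \<nu> 2 m v \<xi> = twisted_dnu J \<nu> 3 m v \<xi>) \<and>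
     (\<forall>a\<in>{1,2,3}. \<forall>m\<in>points M. \<forall>\<xi>\<in>lie_algebra G S. \<xi> \<noteq> tzero \<longrightarrow>
        (\<exists>\<eta>\<in>lie_algebra G S. twisted_dnu J \<nu> a m (generated_field G S M \<phi> \<xi> m) \<eta> \<noteq> 0))"

definition zero_level ::
  "('g, 'x) monoid_scheme \<Rightarrow> 'g smooth_space \<Rightarrow> 'm smooth_space \<Rightarrow>
   (nat \<Rightarrow> 'm \<Rightarrow> 'g tvec \<Rightarrow> real) \<Rightarrow> 'm set" where
  "zero_level G S M \<nu> = {m \<in> points M. \<forall>a\<in>{1,2,3}. \<forall>\<xi>\<in>lie_algebra G S. \<nu> a m \<xi> = 0}"

definition reduced_space ::
  "('g, 'x) monoid_scheme \<Rightarrow> 'g smooth_space \<Rightarrow> 'm smooth_space \<Rightarrow> ('g \<Rightarrow> 'm \<Rightarrow> 'm) \<Rightarrow>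
   (nat \<Rightarrow> 'm \<Rightarrow> 'g tvec \<Rightarrow> real) \<Rightarrow> 'm set smooth_space" where
  "reduced_space G S M \<phi> \<nu> =
     smooth_quotient (smooth_subspace M (zero_level G S M \<nu>)) (orbit G \<phi>)"

text \<open>
  \<open>tangent (smooth_subspace M P) m\<close> consists of derivations of the germs of smooth functions on
  \<open>P\<close>; \<open>tangent_sub M P m\<close> is its image in the tangent space of \<open>M\<close> under the (injective)
  differential of the inclusion.
\<close>

definition tangent_incl :: "'m smooth_space \<Rightarrow> 'm set \<Rightarrow> 'm \<Rightarrow> 'm tvec \<Rightarrow> 'm tvec" where
  "tangent_incl M P m = differential (smooth_subspace M P) M (\<lambda>x. x) m"

definition tangent_sub :: "'m smooth_space \<Rightarrow> 'm set \<Rightarrow> 'm \<Rightarrow> 'm tvec set" where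
  "tangent_sub M P m = tangent_incl M P m ` tangent (smooth_subspace M P) m"

definition horizontal ::
  "('g, 'x) monoid_scheme \<Rightarrow> 'g smooth_space \<Rightarrow> 'm smooth_space \<Rightarrow> (nat \<Rightarrow> 'm endo) \<Rightarrow>
   (nat \<Rightarrow> 'm \<Rightarrow> 'g tvec \<Rightarrow> real) \<Rightarrow> 'm \<Rightarrow> 'm tvec set" where
  "horizontal G S M J \<nu> m =
     {t \<in> tangent_sub M (zero_level G S M \<nu>) m.
        \<forall>a\<in>{1,2,3}. \<forall>\<eta>\<in>lie_algebra G S. twisted_dnu J \<nu> a m t \<eta> = 0}"

text \<open>The differential of the projection from the zero level \<open>P\<close> to \<open>P/G\<close>, defined on
  \<open>tangent_sub M P m\<close>.\<close>

definition d_proj ::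
  "('g, 'x) monoid_scheme \<Rightarrow> 'g smooth_space \<Rightarrow> 'm smooth_space \<Rightarrow> ('g \<Rightarrow> 'm \<Rightarrow> 'm) \<Rightarrow>
   (nat \<Rightarrow> 'm \<Rightarrow> 'g tvec \<Rightarrow> real) \<Rightarrow> 'm \<Rightarrow> 'm tvec \<Rightarrow> 'm set tvec" where
  "d_proj G S M \<phi> \<nu> m t =
     (let P = zero_level G S M \<nu>
      in differential (smooth_subspace M P) (reduced_space G S M \<phi> \<nu>) (orbit G \<phi>) m
           (the_inv_into (tangent (smooth_subspace M P) m) (tangent_incl M P m) t))"

definition horizontal_lift ::
  "('g, 'x) monoid_scheme \<Rightarrow> 'g smooth_space \<Rightarrow> 'm smooth_space \<Rightarrow> (nat \<Rightarrow> 'm endo) \<Rightarrow>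
   ('g \<Rightarrow> 'm \<Rightarrow> 'm) \<Rightarrow> (nat \<Rightarrow> 'm \<Rightarrow> 'g tvec \<Rightarrow> real) \<Rightarrow> 'm \<Rightarrow> 'm set tvec \<Rightarrow> 'm tvec" where
  "horizontal_lift G S M J \<phi> \<nu> m A =
     (THE u. u \<in> horizontal G S M J \<nu> m \<and> d_proj G S M \<phi> \<nu> m u = A)"

text \<open>The induced structure is independent of the chosen point of the fibre.\<close>

definition fibre_point ::
  "('g, 'x) monoid_scheme \<Rightarrow> 'g smooth_space \<Rightarrow> 'm smooth_space \<Rightarrow> ('g \<Rightarrow> 'm \<Rightarrow> 'm) \<Rightarrow>
   (nat \<Rightarrow> 'm \<Rightarrow> 'g tvec \<Rightarrow> real) \<Rightarrow> 'm set \<Rightarrow> 'm" where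
  "fibre_point G S M \<phi> \<nu> n = (SOME m. m \<in> zero_level G S M \<nu> \<and> orbit G \<phi> m = n)"

definition reduced_hypercomplex ::
  "('g, 'x) monoid_scheme \<Rightarrow> 'g smooth_space \<Rightarrow> 'm smooth_space \<Rightarrow> (nat \<Rightarrow> 'm endo) \<Rightarrow>
   ('g \<Rightarrow> 'm \<Rightarrow> 'm) \<Rightarrow> (nat \<Rightarrow> 'm \<Rightarrow> 'g tvec \<Rightarrow> real) \<Rightarrow> nat \<Rightarrow> 'm set endo" where
  "reduced_hypercomplex G S M J \<phi> \<nu> a n A =
     (let m = fibre_point G S M \<phi> \<nu> n
      in d_proj G S M \<phi> \<nu> m (J a m (horizontal_lift G S M J \<phi> \<nu> m A)))"

definition reduced_metric ::
  "('g, 'x) monoid_scheme \<Rightarrow> 'g smooth_space \<Rightarrow> 'm smooth_space \<Rightarrow> (nat \<Rightarrow> 'm endo) \<Rightarrow> 'm form2 \<Rightarrow>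
   ('g \<Rightarrow> 'm \<Rightarrow> 'm) \<Rightarrow> (nat \<Rightarrow> 'm \<Rightarrow> 'g tvec \<Rightarrow> real) \<Rightarrow> 'm set form2" where
  "reduced_metric G S M J g \<phi> \<nu> n A B =
     (let m = fibre_point G S M \<phi> \<nu> n
      in g m (horizontal_lift G S M J \<phi> \<nu> m A) (horizontal_lift G S M J \<phi> \<nu> m B))"

end

theory Submission
  imports Defs
begin

text \<open>
  Let \<open>P = \<nu>\<inverse>(0)\<close>, \<open>\<pi> : P \<rightarrow> N\<close> the projection and \<open>\<alpha>\<^sub>a = I\<^sub>a d\<rho>\<close>. Because
  \<open>I\<^sub>c I\<^sub>b = - I\<^sub>a\<close> for \<open>(a, b, c)\<close> a cyclic permutation of \<open>(1, 2, 3)\<close>, the form \<open>d\<^sub>b d\<^sub>c \<rho>\<close> is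
  \<open>- I\<^sub>b d\<alpha>\<^sub>a\<close>, so the potential equation says
  \<open>2 \<omega>\<^sub>a(v, w) = d\<alpha>\<^sub>a(v, w) - d\<alpha>\<^sub>a(I\<^sub>b v, I\<^sub>b w)\<close>. It only involves the exterior derivative of
  \<open>\<alpha>\<^sub>a\<close>. On \<open>P\<close> the form \<open>\<alpha>\<^sub>a\<close> is invariant and vanishes on the tangent vectors of the orbits, and on
  horizontal vectors it is the corresponding form of the induced function on \<open>N\<close>. Hence the restriction
  of \<open>\<alpha>\<^sub>a\<close> to \<open>P\<close> is the pull-back of that form (\<open>reduced_form_pullback\<close>). Exterior derivatives commute
  with pull-backs, and metric and hypercomplex structure of \<open>N\<close> are defined through horizontal lifts, so
  the equation on \<open>N\<close> is the equation on \<open>M\<close> evaluated at horizontal lifts (\<open>d1_reduced\<close>,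
  \<open>reduced_potential\<close>).

  Naturality of the exterior derivative is obtained without lifting vector fields. Near \<open>\<pi> m\<close> there is a
  smooth section \<open>s\<close> of \<open>\<pi>\<close> with \<open>s (\<pi> m) = m\<close> whose differential at \<open>\<pi> m\<close> takes horizontal values
  (\<open>reduced_slice\<close>), so this differential is the horizontal lift. The form on \<open>N\<close> is the pull-back of
  \<open>\<alpha>\<^sub>a\<close> along \<open>s\<close>; writing \<open>\<alpha>\<^sub>a\<close> as a combination of differentials of coordinates, its
  exterior derivative is computed on both sides by the Leibniz rule alone (\<open>d1_eq\<close>). The exterior derivative is
  defined by a description that ranges over all local extensions of two tangent vectors, and extensions exist because
  \<open>N\<close> is locally a smooth retract of an open subset of a Euclidean space (\<open>reduced_retract\<close>).

  The geometry behind this is two applications of the smooth implicit function theorem. Solving \<open>\<nu> = 0\<close> along the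
  directions \<open>I\<^sub>a \<xi>\<^sub>M\<close> gives a smooth retraction onto \<open>P\<close> (\<open>zero_level_retraction\<close>). It shows that the tangent
  space of \<open>P\<close> is the whole kernel of \<open>d\<nu>\<close>, and then the Cauchy--Riemann condition makes the horizontal
  space stable under each \<open>I\<^sub>a\<close> (\<open>J_hor\<close>). Solving \<open>y (\<phi> h x) = 0\<close> for \<open>h\<close> near 1, where \<open>dy\<close> is
  \<open>I\<^sub>1 d\<nu>\<^sub>1\<close> at \<open>m\<close>, moves points near \<open>m\<close> along their orbits into a slice that is tangent to
  the horizontal space (\<open>slice_exists\<close>); transversality makes both systems nondegenerate. Freeness and
  compactness of the group ensure that the resulting point of the slice depends only on the orbit.
\<close>

section \<open>Smooth functions on Euclidean open sets\<close>

lemma Ck_on_cong: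
  assumes "open U" "\<And>x. x \<in> U \<Longrightarrow> f x = g x"
  shows "Ck_on k U f \<longleftrightarrow> Ck_on k U g"
proof -
  have *: "Ck_on k U g" if "Ck_on k U f" "\<And>x. x \<in> U \<Longrightarrow> f x = g x" for f g :: "'a \<Rightarrow> real"
    using that
  proof (induction k arbitrary: f g)
    case 0
    then show ?case by (simp cong: continuous_on_cong)
  next
    case (Suc k)
    have "(f has_derivative D) (at x) \<longleftrightarrow> (g has_derivative D) (at x)" if "x \<in> U" for x D
      using has_derivative_transform_within_open[of f D x UNIV U g]
        has_derivative_transform_within_open[of g D x UNIV U f] that Suc.prems(2) assms(1) by auto
    then have D: "frechet_derivative f (at x) = frechet_derivative g (at x)"
      "f differentiable at x \<longleftrightarrow> g differentiable at x" if "x \<in> U" for x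
      using that by (auto simp: frechet_derivative_def differentiable_def)
    have "Ck_on k U (\<lambda>x. frechet_derivative g (at x) v)" for v
      by (rule Suc.IH[of "\<lambda>x. frechet_derivative f (at x) v"]) (use Suc.prems D in auto)
    then show ?case using Suc.prems(1) D by simp
  qed
  from *[of f g] *[of g f] assms(2) show ?thesis by auto
qed

lemma smooth_on_cong:
  assumes "open U" "\<And>x. x \<in> U \<Longrightarrow> f x = g x"
  shows "smooth_on U f \<longleftrightarrow> smooth_on U g"
  using Ck_on_cong[OF assms] by (simp add: smooth_on_def)

lemma Ck_on_continuous: "Ck_on k U f \<Longrightarrow> continuous_on U f"
  by (cases k) (auto simp: continuous_on_eq_continuous_within intro: differentiable_imp_continuous_within
      differentiable_within_subset[of f _ UNIV])

lemma Ck_on_SucD: "Ck_on (Suc k) U f \<Longrightarrow> Ck_on k U f"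
proof (induction k arbitrary: f)
  case 0
  then show ?case using Ck_on_continuous[of "Suc 0" U f] by simp
next
  case (Suc k)
  have "\<forall>v. Ck_on (Suc k) U (\<lambda>x. frechet_derivative f (at x) v)"
    using Suc.prems Ck_on.simps(2)[of "Suc k"] by blast
  then have "\<forall>v. Ck_on k U (\<lambda>x. frechet_derivative f (at x) v)" using Suc.IH by blast
  moreover have "\<forall>x\<in>U. f differentiable (at x)"
    using Suc.prems Ck_on.simps(2)[of "Suc k"] by blast
  ultimately show ?case unfolding Ck_on.simps(2) by blast
qed

(* As a rewrite rule this equation keeps unfolding derivatives of derivatives. *)
declare Ck_on.simps(2) [simp del]

lemma Ck_on_SucI:
  assumes "open U" "\<And>x. x \<in> U \<Longrightarrow> (f has_derivative D x) (at x)" "\<And>v. Ck_on k U (\<lambda>x. D x v)"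
  shows "Ck_on (Suc k) U f"
proof -
  have eq: "frechet_derivative f (at x) = D x" if "x \<in> U" for x
    using frechet_derivative_at[OF assms(2)[OF that]] by simp
  have "Ck_on k U (\<lambda>x. frechet_derivative f (at x) v)" for v
    using Ck_on_cong[OF assms(1), of "\<lambda>x. frechet_derivative f (at x) v" "\<lambda>x. D x v"] eq assms(3) by simp
  then show ?thesis
    using assms(2) by (auto simp: differentiable_def Ck_on.simps(2))
qed

lemma Ck_on_derivative: "Ck_on (Suc k) U f \<Longrightarrow> x \<in> U \<Longrightarrow>
    (f has_derivative frechet_derivative f (at x)) (at x)"
  by (simp add: frechet_derivative_works[symmetric] Ck_on.simps(2))

lemma Ck_on_subset: "Ck_on k U f \<Longrightarrow> V \<subseteq> U \<Longrightarrow> Ck_on k V f"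
  by (induction k arbitrary: f) (auto simp: Ck_on.simps(2) intro: continuous_on_subset)

lemma Ck_on_const: "Ck_on k U (\<lambda>x. c)"
  by (induction k arbitrary: c) (auto simp: Ck_on.simps(2))

lemma Ck_on_add:
  assumes "open U"
  shows "Ck_on k U f \<Longrightarrow> Ck_on k U g \<Longrightarrow> Ck_on k U (\<lambda>x. f x + g x)"
proof (induction k arbitrary: f g)
  case 0
  then show ?case by (auto intro: continuous_intros)
next
  case (Suc k)
  have *: "Ck_on k U (\<lambda>x. frechet_derivative f (at x) v + frechet_derivative g (at x) v)" for v
    using Suc.prems by (intro Suc.IH) (auto simp: Ck_on.simps(2))
  show ?case
    by (rule Ck_on_SucI[OF assms has_derivative_add[OF Ck_on_derivative[OF Suc.prems(1)]
        Ck_on_derivative[OF Suc.prems(2)]]]) (assumption | rule *)+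
qed

lemma Ck_on_mult:
  assumes "open U"
  shows "Ck_on k U f \<Longrightarrow> Ck_on k U g \<Longrightarrow> Ck_on k U (\<lambda>x. f x * g x)"
proof (induction k arbitrary: f g)
  case 0
  then show ?case by (auto intro: continuous_intros)
next
  case (Suc k)
  have "Ck_on k U (\<lambda>x. f x * frechet_derivative g (at x) v + frechet_derivative f (at x) v * g x)" for v
    using Suc.prems Ck_on_SucD[OF Suc.prems(1)] Ck_on_SucD[OF Suc.prems(2)]
    by (intro Ck_on_add[OF assms] Suc.IH) (auto simp: Ck_on.simps(2))
  note * = this
  show ?case
    by (rule Ck_on_SucI[OF assms has_derivative_mult[OF Ck_on_derivative[OF Suc.prems(1)]
        Ck_on_derivative[OF Suc.prems(2)]]]) (assumption | rule *)+
qed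

lemma Ck_on_sum:
  assumes "open U" "finite I" "\<And>i. i \<in> I \<Longrightarrow> Ck_on k U (f i)"
  shows "Ck_on k U (\<lambda>x. \<Sum>i\<in>I. f i x)"
  using assms(2,3)
proof (induction I rule: finite_induct)
  case empty
  show ?case by (simp add: Ck_on_const)
next
  case (insert i I)
  then show ?case using Ck_on_add[OF assms(1), of k "f i"] by simp
qed

lemma Ck_on_compose:
  fixes F :: "'a::euclidean_space \<Rightarrow> 'b::euclidean_space"
  assumes U: "open U" and FU: "F ` U \<subseteq> V"
  shows "Ck_on k V f \<Longrightarrow> (\<And>b. b \<in> Basis \<Longrightarrow> Ck_on k U (\<lambda>x. F x \<bullet> b)) \<Longrightarrow> Ck_on k U (\<lambda>x. f (F x))"
proof (induction k arbitrary: f)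
  case 0
  have "continuous_on U F" using 0 by (subst continuous_on_componentwise) auto
  then show ?case using continuous_on_compose2[of V f U F] 0 FU by simp
next
  case (Suc k)
  define DF where "DF = (\<lambda>x v. \<Sum>b\<in>Basis. frechet_derivative (\<lambda>x. F x \<bullet> b) (at x) v *\<^sub>R b)"
  have DF: "(F has_derivative DF x) (at x)" if "x \<in> U" for x
    unfolding has_derivative_componentwise_within[of F]
    using Ck_on_derivative[OF Suc.prems(2) that] by (auto simp: DF_def)
  have D: "((\<lambda>x. f (F x)) has_derivative (\<lambda>v. frechet_derivative f (at (F x)) (DF x v))) (at x)"
    if "x \<in> U" for x
    using has_derivative_compose[OF DF[OF that] Ck_on_derivative[OF Suc.prems(1)]] FU that by auto
  have lin: "frechet_derivative f (at (F x)) (DF x v) =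
      (\<Sum>b\<in>Basis. frechet_derivative (\<lambda>x. F x \<bullet> b) (at x) v * frechet_derivative f (at (F x)) b)"
    if "x \<in> U" for x v
  proof -
    have "linear (frechet_derivative f (at (F x)))"
      using Suc.prems(1) FU that by (intro linear_frechet_derivative) (auto simp: Ck_on.simps(2))
    then show ?thesis by (simp add: DF_def linear_sum linear_scale)
  qed
  show ?case
  proof (rule Ck_on_SucI[OF U D])
    fix v
    have 1: "Ck_on k U (\<lambda>x. frechet_derivative (\<lambda>x. F x \<bullet> b) (at x) v)" if "b \<in> Basis" for b
      using Suc.prems(2)[OF that] Ck_on.simps(2) by blast
    have 2: "Ck_on k U (\<lambda>x. frechet_derivative f (at (F x)) b)" for b
    proof (rule Suc.IH[of "\<lambda>y. frechet_derivative f (at y) b"])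
      show "Ck_on k V (\<lambda>y. frechet_derivative f (at y) b)"
        using Suc.prems(1) Ck_on.simps(2) by blast
    qed (rule Ck_on_SucD[OF Suc.prems(2)])
    have "Ck_on k U (\<lambda>x. \<Sum>b\<in>Basis. frechet_derivative (\<lambda>x. F x \<bullet> b) (at x) v
        * frechet_derivative f (at (F x)) b)"
      by (intro Ck_on_sum[OF U finite_Basis] Ck_on_mult[OF U] 1 2)
    then show "Ck_on k U (\<lambda>x. frechet_derivative f (at (F x)) (DF x v))"
      by (rule iffD2[OF Ck_on_cong[OF U], rotated]) (erule lin)
  qed
qed

lemma Ck_on_inner: "open U \<Longrightarrow> Ck_on k U (\<lambda>x. x \<bullet> b)"
proof (cases k)
  case (Suc k)
  assume "open U"
  show ?thesis unfolding Suc
    by (rule Ck_on_SucI[OF \<open>open U\<close>, where D = "\<lambda>x v. v \<bullet> b"])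
      (auto intro!: derivative_eq_intros Ck_on_const)
qed (auto intro!: continuous_intros)

lemma smooth_on_derivative:
  "smooth_on U f \<Longrightarrow> x \<in> U \<Longrightarrow> (f has_derivative frechet_derivative f (at x)) (at x)"
  using Ck_on_derivative unfolding smooth_on_def by blast

lemma smooth_on_frechet: "smooth_on U f \<Longrightarrow> smooth_on U (\<lambda>x. frechet_derivative f (at x) v)"
  unfolding smooth_on_def by (metis Ck_on.simps(2))

lemma smooth_on_subset: "smooth_on U f \<Longrightarrow> V \<subseteq> U \<Longrightarrow> smooth_on V f"
  using Ck_on_subset unfolding smooth_on_def by blast

lemma smooth_on_continuous: "smooth_on U f \<Longrightarrow> continuous_on U f"
  using Ck_on_continuous unfolding smooth_on_def by blast

lemma smooth_on_const: "smooth_on U (\<lambda>x. c)"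
  using Ck_on_const unfolding smooth_on_def by blast

lemma smooth_on_add: "open U \<Longrightarrow> smooth_on U f \<Longrightarrow> smooth_on U g \<Longrightarrow> smooth_on U (\<lambda>x. f x + g x)"
  using Ck_on_add unfolding smooth_on_def by blast

lemma smooth_on_mult: "open U \<Longrightarrow> smooth_on U f \<Longrightarrow> smooth_on U g \<Longrightarrow> smooth_on U (\<lambda>x. f x * g x)"
  using Ck_on_mult unfolding smooth_on_def by blast

lemma smooth_on_sum: "open U \<Longrightarrow> finite I \<Longrightarrow> (\<And>i. i \<in> I \<Longrightarrow> smooth_on U (f i)) \<Longrightarrow>
    smooth_on U (\<lambda>x. \<Sum>i\<in>I. f i x)"
  using Ck_on_sum unfolding smooth_on_def by blast

lemma smooth_on_inner: "open U \<Longrightarrow> smooth_on U (\<lambda>x. x \<bullet> b)"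
  using Ck_on_inner unfolding smooth_on_def by blast

definition vsmooth_on :: "'a::euclidean_space set \<Rightarrow> ('a \<Rightarrow> 'b::euclidean_space) \<Rightarrow> bool" where
  "vsmooth_on U F \<longleftrightarrow> (\<forall>b\<in>Basis. smooth_on U (\<lambda>x. F x \<bullet> b))"

lemma vsmooth_on_inner:
  assumes "open U" "vsmooth_on U F" shows "smooth_on U (\<lambda>x. F x \<bullet> w)"
proof -
  have "smooth_on U (\<lambda>x. \<Sum>b\<in>Basis. (F x \<bullet> b) * (w \<bullet> b))"
    using assms by (intro smooth_on_sum smooth_on_mult smooth_on_const) (auto simp: vsmooth_on_def)
  then show ?thesis by (simp add: euclidean_inner[symmetric])
qed

lemma smooth_on_compose:
  assumes "open U" "F ` U \<subseteq> V" "smooth_on V f" "vsmooth_on U F"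
  shows "smooth_on U (\<lambda>x. f (F x))"
  using Ck_on_compose[OF assms(1,2)] assms(3,4) unfolding vsmooth_on_def smooth_on_def by blast

lemma vsmooth_on_compose:
  assumes "open U" "F ` U \<subseteq> V" "vsmooth_on V f" "vsmooth_on U F"
  shows "vsmooth_on U (\<lambda>x. f (F x))"
  using smooth_on_compose[OF assms(1,2)] assms(3,4) unfolding vsmooth_on_def[of V] vsmooth_on_def[of U "\<lambda>x. f (F x)"]
  by blast

lemma vsmooth_on_subset: "vsmooth_on U f \<Longrightarrow> V \<subseteq> U \<Longrightarrow> vsmooth_on V f"
  using smooth_on_subset unfolding vsmooth_on_def by blast

lemma vsmooth_on_continuous: "vsmooth_on U f \<Longrightarrow> continuous_on U f"
  by (subst continuous_on_componentwise) (auto simp: vsmooth_on_def intro: smooth_on_continuous)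

lemma vsmooth_on_derivative:
  assumes "vsmooth_on U F" "x \<in> U"
  shows "(F has_derivative frechet_derivative F (at x)) (at x)"
proof -
  have "F differentiable (at x)"
    unfolding differentiable_componentwise_within[of F]
    using assms smooth_on_derivative unfolding vsmooth_on_def differentiable_def by blast
  then show ?thesis by (simp add: frechet_derivative_works)
qed

lemma vsmooth_on_const: "vsmooth_on U (\<lambda>x. c)"
  by (simp add: vsmooth_on_def smooth_on_const)

lemma vsmooth_on_add:
  "open U \<Longrightarrow> vsmooth_on U f \<Longrightarrow> vsmooth_on U g \<Longrightarrow> vsmooth_on U (\<lambda>x. f x + g x)"
  by (simp add: vsmooth_on_def inner_add_left smooth_on_add)

lemma vsmooth_on_linear:
  fixes L :: "'a::euclidean_space \<Rightarrow> 'b::euclidean_space"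
  assumes "open U" "linear L" shows "vsmooth_on U L"
  unfolding vsmooth_on_def
proof
  fix b :: 'b
  have "L x \<bullet> b = x \<bullet> (adjoint L b)" for x by (simp add: adjoint_works assms(2))
  then show "smooth_on U (\<lambda>x. L x \<bullet> b)" using smooth_on_inner[OF assms(1)] by simp
qed

lemma vsmooth_on_linear_compose:
  fixes L :: "'b::euclidean_space \<Rightarrow> 'c::euclidean_space"
  assumes "open U" "linear L" "vsmooth_on U f" shows "vsmooth_on U (\<lambda>x. L (f x))"
  by (rule vsmooth_on_compose[OF assms(1) _ vsmooth_on_linear[OF open_UNIV assms(2)] assms(3)]) auto

lemma vsmooth_on_diff:
  "open U \<Longrightarrow> vsmooth_on U f \<Longrightarrow> vsmooth_on U g \<Longrightarrow> vsmooth_on U (\<lambda>x. f x - g x)"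
  using vsmooth_on_add[of U f "\<lambda>x. - g x"] vsmooth_on_linear_compose[of U "\<lambda>x. - x" g]
  by (simp add: linear_iff)

lemma vsmooth_on_Pair:
  assumes "vsmooth_on U f" "vsmooth_on U g" shows "vsmooth_on U (\<lambda>x. (f x, g x))"
  using assms smooth_on_const[of U 0] by (auto simp: vsmooth_on_def Basis_prod_def)

text \<open>
  If the entries of an invertible matrix depend smoothly on a parameter, so do those of its inverse \<open>L\<close>:
  the derivative of \<open>L\<close> is \<open>- L (DA) L\<close>, so each degree of smoothness of \<open>A\<close> passes to \<open>L\<close> by
  induction.
\<close>

lemma Ck_on_inverse_matrix:
  fixes A L :: "'x::euclidean_space \<Rightarrow> 'z::euclidean_space \<Rightarrow> 'z"
  assumes "open U"
    and lin: "\<And>x. x \<in> U \<Longrightarrow> linear (A x)" "\<And>x. x \<in> U \<Longrightarrow> linear (L x)"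
    and inv: "\<And>x v. x \<in> U \<Longrightarrow> L x (A x v) = v" "\<And>x v. x \<in> U \<Longrightarrow> A x (L x v) = v"
    and cont: "\<And>v. continuous_on U (\<lambda>x. L x v)"
    and A: "\<And>v b. b \<in> Basis \<Longrightarrow> Ck_on k U (\<lambda>x. A x v \<bullet> b)"
  shows "b \<in> Basis \<Longrightarrow> Ck_on k U (\<lambda>x. L x v \<bullet> b)"
  using A
proof (induction k arbitrary: b v)
  case 0
  then show ?case using cont by (auto intro: continuous_intros)
next
  case (Suc k)
  define DA where "DA = (\<lambda>x w v. \<Sum>b\<in>Basis. frechet_derivative (\<lambda>x. A x w \<bullet> b) (at x) v *\<^sub>R b)"
  have DA: "((\<lambda>x. A x w) has_derivative DA x w) (at x)" if "x \<in> U" for x w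
    unfolding has_derivative_componentwise_within[of "\<lambda>x. A x w"]
    using Ck_on_derivative[OF Suc.prems(2) that] by (auto simp: DA_def)
  define DL where "DL = (\<lambda>x h. - (\<Sum>c\<in>Basis. (DA x (L x v) h \<bullet> c) * (L x c \<bullet> b)))"
  have D: "((\<lambda>x. L x v \<bullet> b) has_derivative DL x) (at x)" if x: "x \<in> U" for x
  proof -
    (* L y v - L x v = - L y (A y w - A x w) with w = L x v, a product of a continuous function and
       a differentiable function that vanishes at x. Such a product is differentiable at x. *)
    let ?w = "L x v"
    have prod: "((\<lambda>y. f y * e y) has_derivative (\<lambda>h. e' h * f x)) (at x)"
      if f: "continuous_on U f" and e: "(e has_derivative e') (at x)" and e0: "e x = 0"
      for f e :: "'x \<Rightarrow> real" and e'
    proof -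
      have f0: "((\<lambda>y. f y - f x) \<longlongrightarrow> 0) (at x)"
        using f x \<open>open U\<close> by (simp add: continuous_on_eq_continuous_at isCont_def LIM_zero)
      obtain K where K: "\<And>h. norm (e' h) \<le> norm h * K"
        using bounded_linear.bounded[OF has_derivative_bounded_linear[OF e]] by blast
      have q: "((\<lambda>y. (e y - e x - e' (y - x)) /\<^sub>R norm (y - x)) \<longlongrightarrow> 0) (at x)"
        using e by (simp add: has_derivative_at_within) 
      have fl: "(f \<longlongrightarrow> f x) (at x)" using f0 LIM_zero_iff by blast
      have l1: "((\<lambda>y. f y * ((e y - e x - e' (y - x)) /\<^sub>R norm (y - x))) \<longlongrightarrow> f x * 0) (at x)"
        by (rule tendsto_mult[OF fl q])
      have l2: "((\<lambda>y. (f y - f x) * (e' (y - x) /\<^sub>R norm (y - x))) \<longlongrightarrow> 0) (at x)"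
      proof (rule Lim_null_comparison)
        show "\<forall>\<^sub>F y in at x. norm ((f y - f x) * (e' (y - x) /\<^sub>R norm (y - x))) \<le> norm (f y - f x) * \<bar>K\<bar>"
        proof (rule always_eventually, rule allI)
          fix y
          have "norm (e' (y - x) /\<^sub>R norm (y - x)) \<le> \<bar>K\<bar>"
          proof (cases "y = x")
            case True
            then show ?thesis by simp
          next
            case False
            have "norm (e' (y - x)) \<le> norm (y - x) * \<bar>K\<bar>"
              using K[of "y - x"] by (meson abs_ge_self mult_left_mono norm_ge_zero order_trans)
            then show ?thesis using False by (simp add: divide_simps mult.commute)
          qed
          then show "norm ((f y - f x) * (e' (y - x) /\<^sub>R norm (y - x))) \<le> norm (f y - f x) * \<bar>K\<bar>"
            unfolding norm_mult by (intro mult_left_mono) auto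
        qed
        show "((\<lambda>y. norm (f y - f x) * \<bar>K\<bar>) \<longlongrightarrow> 0) (at x)"
          using tendsto_mult[OF tendsto_norm[OF f0] tendsto_const[of "\<bar>K\<bar>"]] by simp
      qed
      have "((\<lambda>y. (f y * e y - f x * e x - e' (y - x) * f x) /\<^sub>R norm (y - x)) \<longlongrightarrow> 0) (at x)"
        using tendsto_add[OF l1 l2] by (simp add: algebra_simps e0)
      then show ?thesis
        using has_derivative_bounded_linear[OF e]
        by (simp add: has_derivative_at_within bounded_linear_mult_const)
    qed
    have e: "((\<lambda>y. (A y ?w - A x ?w) \<bullet> c) has_derivative (\<lambda>h. DA x ?w h \<bullet> c)) (at x)" for c
      by (rule derivative_eq_intros DA[OF x] | simp)+
    have c': "continuous_on U (\<lambda>y. L y c \<bullet> b)" for c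
      using cont by (auto intro: continuous_intros)
    have "((\<lambda>y. L x v \<bullet> b - (\<Sum>c\<in>Basis. (L y c \<bullet> b) * ((A y ?w - A x ?w) \<bullet> c))) has_derivative DL x) (at x)"
      unfolding DL_def
      by (rule derivative_eq_intros prod[OF c' e] refl | simp)+
    moreover have "L x v \<bullet> b - (\<Sum>c\<in>Basis. (L y c \<bullet> b) * ((A y ?w - A x ?w) \<bullet> c)) = L y v \<bullet> b"
      if y: "y \<in> U" for y
    proof -
      have "L y (A y ?w - A x ?w) = L y (\<Sum>c\<in>Basis. ((A y ?w - A x ?w) \<bullet> c) *\<^sub>R c)"
        by (simp add: euclidean_representation)
      also have "\<dots> = (\<Sum>c\<in>Basis. ((A y ?w - A x ?w) \<bullet> c) *\<^sub>R L y c)"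
        using lin(2)[OF y] by (simp add: linear_sum linear_scale)
      finally have "(\<Sum>c\<in>Basis. (L y c \<bullet> b) * ((A y ?w - A x ?w) \<bullet> c)) = L y (A y ?w - A x ?w) \<bullet> b"
        by (simp add: inner_sum_left mult.commute)
      also have "L y (A y ?w - A x ?w) = L x v - L y v"
        using lin(2)[OF y] inv x y by (simp add: linear_diff)
      finally show ?thesis by (simp add: inner_diff_left)
    qed
    ultimately show ?thesis
      by (rule has_derivative_transform_within_open[OF _ \<open>open U\<close> x])
  qed
  have IH: "Ck_on k U (\<lambda>x. L x v \<bullet> b)" if "b \<in> Basis" for v b
    using Suc.IH[OF that] Ck_on_SucD[OF Suc.prems(2)] by blast
  have lin': "DA x (L x v) h \<bullet> c =
      (\<Sum>d\<in>Basis. (L x v \<bullet> d) * frechet_derivative (\<lambda>x. A x d \<bullet> c) (at x) h)"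
    if x: "x \<in> U" and c: "c \<in> Basis" for x h c
  proof -
    have "((\<lambda>y. \<Sum>d\<in>Basis. (L x v \<bullet> d) * (A y d \<bullet> c)) has_derivative
        (\<lambda>h. \<Sum>d\<in>Basis. (L x v \<bullet> d) * frechet_derivative (\<lambda>x. A x d \<bullet> c) (at x) h)) (at x)"
      by (rule derivative_eq_intros Ck_on_derivative[OF Suc.prems(2)[OF c] x] refl | simp)+
    moreover have "(\<Sum>d\<in>Basis. (L x v \<bullet> d) * (A y d \<bullet> c)) = A y (L x v) \<bullet> c" if "y \<in> U" for y
    proof -
      have "A y (L x v) = A y (\<Sum>d\<in>Basis. (L x v \<bullet> d) *\<^sub>R d)" by (simp add: euclidean_representation)
      also have "\<dots> = (\<Sum>d\<in>Basis. (L x v \<bullet> d) *\<^sub>R A y d)"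
        using lin(1)[OF that] by (simp add: linear_sum linear_scale)
      finally show ?thesis by (simp add: inner_sum_left)
    qed
    ultimately have "((\<lambda>y. A y (L x v) \<bullet> c) has_derivative
        (\<lambda>h. \<Sum>d\<in>Basis. (L x v \<bullet> d) * frechet_derivative (\<lambda>x. A x d \<bullet> c) (at x) h)) (at x)"
      by (rule has_derivative_transform_within_open[OF _ \<open>open U\<close> x])
    moreover have "((\<lambda>y. A y (L x v) \<bullet> c) has_derivative (\<lambda>h. DA x (L x v) h \<bullet> c)) (at x)"
      by (rule derivative_eq_intros DA[OF x] | simp)+
    ultimately have "(\<lambda>h. \<Sum>d\<in>Basis. (L x v \<bullet> d) * frechet_derivative (\<lambda>x. A x d \<bullet> c) (at x) h) =
        (\<lambda>h. DA x (L x v) h \<bullet> c)"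
      by (rule has_derivative_unique)
    then show ?thesis by (metis (no_types, lifting))
  qed
  show ?case
  proof (rule Ck_on_SucI[OF \<open>open U\<close> D])
    fix h
    have 1: "Ck_on k U (\<lambda>x. frechet_derivative (\<lambda>x. A x d \<bullet> c) (at x) h)" if "c \<in> Basis" for c d
      using Suc.prems(2)[OF that] Ck_on.simps(2) by blast
    have "Ck_on k U (\<lambda>x. (-1) * (\<Sum>c\<in>Basis. (\<Sum>d\<in>Basis. (L x v \<bullet> d) *
        frechet_derivative (\<lambda>x. A x d \<bullet> c) (at x) h) * (L x c \<bullet> b)))"
      by (intro Ck_on_mult[OF \<open>open U\<close>] Ck_on_sum[OF \<open>open U\<close> finite_Basis] Ck_on_const IH
          Suc.prems(1) 1)
    then show "Ck_on k U (\<lambda>x. DL x h)"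
      using Ck_on_cong[OF \<open>open U\<close>, of "\<lambda>x. DL x h" "\<lambda>x. (-1) * (\<Sum>c\<in>Basis. (\<Sum>d\<in>Basis. (L x v \<bullet> d) *
        frechet_derivative (\<lambda>x. A x d \<bullet> c) (at x) h) * (L x c \<bullet> b))"] by (simp add: DL_def lin')
  qed
qed

section \<open>The inverse and the implicit function theorem\<close>

lemma continuous_on_inverse_blinfun:
  fixes A :: "'y::euclidean_space \<Rightarrow> ('z::euclidean_space \<Rightarrow>\<^sub>L 'z)"
  assumes "continuous_on V A" and bij: "\<And>y. y \<in> V \<Longrightarrow> bij (blinfun_apply (A y))"
  shows "continuous_on V (\<lambda>y. inv_into UNIV (blinfun_apply (A y)) v)"
  unfolding continuous_on_def
proof
  fix y0 assume y0: "y0 \<in> V"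
  define L where "L = (\<lambda>y. inv_into UNIV (blinfun_apply (A y)))"
  have AL: "A y (L y v) = v" and LA: "L y (A y v) = v" if "y \<in> V" for y v
    using bij[OF that] by (auto simp: L_def bij_is_surj surj_f_inv_f bij_is_inj inv_f_f)
  have "linear (blinfun_apply (A y0))" by (simp add: blinfun.bounded_linear_right bounded_linear.linear)
  then have "\<exists>B>0. \<forall>x. B * norm x \<le> norm (A y0 x)"
    using linear_inj_bounded_below_pos[of "blinfun_apply (A y0)"] bij[OF y0] bij_is_inj
    by (metis)
  then obtain B where B: "B > 0" "\<And>x. B * norm x \<le> norm (A y0 x)" by blast
  have ev: "\<forall>\<^sub>F y in at y0 within V. norm (A y - A y0) < B / 2"
    using tendstoD[of A "A y0" "at y0 within V" "B / 2"] assms(1) y0 B(1)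
    by (simp add: continuous_on_def dist_norm)
  let ?w = "L y0 v"
  have bd: "norm (L y v - L y0 v) \<le> (2 / B) * norm (A y ?w - A y0 ?w)"
    if y: "y \<in> V" and d: "norm (A y - A y0) < B / 2" for y
  proof -
    let ?u = "L y v - L y0 v"
    have 1: "A y ?u = - (A y ?w - A y0 ?w)" using AL y y0 by (simp add: blinfun.diff_right)
    have "B * norm ?u \<le> norm (A y0 ?u)" by (rule B)
    also have "A y0 ?u = A y ?u - (A y - A y0) ?u" by (simp add: blinfun.diff_left)
    also have "norm \<dots> \<le> norm (A y ?u) + norm ((A y - A y0) ?u)" by (rule norm_triangle_ineq4)
    also have "norm ((A y - A y0) ?u) \<le> norm (A y - A y0) * norm ?u" by (rule norm_blinfun)
    also have "norm (A y - A y0) * norm ?u \<le> B / 2 * norm ?u"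
      using d by (intro mult_right_mono) auto
    finally have "B / 2 * norm ?u \<le> norm (A y ?w - A y0 ?w)" using 1 by (simp add: norm_minus_commute)
    then show ?thesis using B(1) by (simp add: field_simps)
  qed
  have lim: "((\<lambda>y. A y ?w - A y0 ?w) \<longlongrightarrow> 0) (at y0 within V)"
    using assms(1) y0 unfolding continuous_on_def
    by (intro LIM_zero tendsto_intros) auto
  have "((\<lambda>y. L y v - L y0 v) \<longlongrightarrow> 0) (at y0 within V)"
  proof (rule Lim_null_comparison)
    show "\<forall>\<^sub>F y in at y0 within V. norm (L y v - L y0 v) \<le> (2 / B) * norm (A y ?w - A y0 ?w)"
    proof -
      have "\<forall>\<^sub>F y in at y0 within V. y \<in> V" by (simp add: eventually_at_filter)
      with ev show ?thesis by eventually_elim (rule bd)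
    qed
    show "((\<lambda>y. (2 / B) * norm (A y ?w - A y0 ?w)) \<longlongrightarrow> 0) (at y0 within V)"
      using tendsto_mult[OF tendsto_const[of "2 / B"] tendsto_norm[OF lim]] by simp
  qed
  then show "((\<lambda>y. inv_into UNIV (blinfun_apply (A y)) v) \<longlongrightarrow> inv_into UNIV (blinfun_apply (A y0)) v) (at y0 within V)"
    by (simp add: L_def LIM_zero_iff)
qed

text \<open>
  The derivative of the local inverse \<open>g\<close> at \<open>y\<close> is the inverse of the derivative of \<open>f\<close> at \<open>g y\<close>. So
  if \<open>g\<close> is \<open>k\<close> times continuously differentiable, then so is its derivative, and the smoothness of \<open>g\<close>
  follows by induction.
\<close>

theorem smooth_inverse_function:
  fixes f :: "'a::euclidean_space \<Rightarrow> 'a"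
  assumes "open U" and f: "vsmooth_on U f" and "x0 \<in> U"
    and inj: "\<And>v. frechet_derivative f (at x0) v = 0 \<Longrightarrow> v = 0"
  obtains U' V g where "open U'" "U' \<subseteq> U" "x0 \<in> U'" "open V" "f x0 \<in> V"
    "homeomorphism U' V f g" "vsmooth_on V g"
proof -
  define f' where "f' = (\<lambda>x. Blinfun (frechet_derivative f (at x)))"
  have bl: "bounded_linear (frechet_derivative f (at x))" if "x \<in> U" for x
    using vsmooth_on_derivative[OF f that] has_derivative_bounded_linear by blast
  have f': "blinfun_apply (f' x) = frechet_derivative f (at x)" if "x \<in> U" for x
    using bl[OF that] by (simp add: f'_def bounded_linear_Blinfun_apply)
  have comp: "frechet_derivative f (at x) v \<bullet> b = frechet_derivative (\<lambda>x. f x \<bullet> b) (at x) v"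
    if "x \<in> U" for x v b
  proof -
    have "((\<lambda>x. f x \<bullet> b) has_derivative (\<lambda>v. frechet_derivative f (at x) v \<bullet> b)) (at x)"
      by (rule derivative_eq_intros vsmooth_on_derivative[OF f that] | simp)+
    from frechet_derivative_at[OF this] show ?thesis by metis
  qed
  have f'C: "smooth_on U (\<lambda>x. f' x v \<bullet> b)" if "b \<in> Basis" for v b
    using smooth_on_frechet[of U "\<lambda>x. f x \<bullet> b" v] f that 
      smooth_on_cong[OF \<open>open U\<close>, of "\<lambda>x. f' x v \<bullet> b" "\<lambda>x. frechet_derivative (\<lambda>x. f x \<bullet> b) (at x) v"]
    by (simp add: f' comp vsmooth_on_def)
  have cont: "continuous_on U f'"
  proof (rule continuous_on_blinfun_componentwise)
    show "continuous_on U (\<lambda>x. f' x i)" for i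
      by (subst continuous_on_componentwise) (use smooth_on_continuous f'C in blast)
  qed
  have lin: "linear (frechet_derivative f (at x0))" using bl[OF \<open>x0 \<in> U\<close>] bounded_linear.linear by blast
  then have "inj (frechet_derivative f (at x0))" using inj linear_injective_0 by blast
  then obtain i where i: "linear i" "i \<circ> frechet_derivative f (at x0) = id"
    using linear_injective_left_inverse[OF lin] by blast
  have "Blinfun i o\<^sub>L f' x0 = id_blinfun"
    using i f'[OF \<open>x0 \<in> U\<close>] linear_conv_bounded_linear[of i]
    by (intro blinfun_eqI) (simp add: bounded_linear_Blinfun_apply o_def fun_eq_iff)
  then obtain U' V g g' where *: "open U'" "U' \<subseteq> U" "x0 \<in> U'" "open V" "f x0 \<in> V" "homeomorphism U' V f g"
    "\<And>y. y \<in> V \<Longrightarrow> (g has_derivative (g' y)) (at y)"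
    "\<And>y. y \<in> V \<Longrightarrow> g' y = inv_into UNIV (blinfun_apply (f'(g y)))"
    "\<And>y. y \<in> V \<Longrightarrow> bij (blinfun_apply (f'(g y)))"
    using inverse_function_theorem[OF \<open>open U\<close> _ cont \<open>x0 \<in> U\<close>] vsmooth_on_derivative[OF f] f'
    by metis
  have gU: "g y \<in> U" if "y \<in> V" for y using *(2,6) that by (auto simp: homeomorphism_def)
  have cg: "continuous_on V g" using *(6) by (simp add: homeomorphism_def)
  have "\<forall>b\<in>Basis. Ck_on k V (\<lambda>y. g y \<bullet> b)" for k
  proof (induction k)
    case 0
    then show ?case using cg by (auto intro: continuous_intros)
  next
    case (Suc k)
    show ?case
    proof
      fix b :: 'a assume b: "b \<in> Basis"
      have D: "((\<lambda>y. g y \<bullet> b) has_derivative (\<lambda>v. g' y v \<bullet> b)) (at y)" if "y \<in> V" for y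
        by (rule derivative_eq_intros *(7)[OF that] | simp)+
      show "Ck_on (Suc k) V (\<lambda>y. g y \<bullet> b)"
      proof (rule Ck_on_SucI[OF \<open>open V\<close> D])
        show "Ck_on k V (\<lambda>y. g' y v \<bullet> b)" for v
        proof (rule Ck_on_inverse_matrix[where A = "\<lambda>y. blinfun_apply (f' (g y))" and L = g'])
          show "linear (blinfun_apply (f' (g y)))" for y
            by (simp add: blinfun.bounded_linear_right bounded_linear.linear)
          show "linear (g' y)" if "y \<in> V" for y
            using *(7)[OF that] has_derivative_linear by blast
          show "g' y (f' (g y) v) = v" "f' (g y) (g' y v) = v" if "y \<in> V" for y v
            using *(8,9)[OF that] by (auto simp: bij_is_surj surj_f_inv_f bij_is_inj inv_f_f)
          have "continuous_on V (\<lambda>y. f' (g y))"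
            using continuous_on_compose2[OF cont cg] gU by blast
          then have "continuous_on V (\<lambda>y. inv_into UNIV (blinfun_apply (f' (g y))) v)" for v
            by (rule continuous_on_inverse_blinfun) (rule *(9))
          then show "continuous_on V (\<lambda>y. g' y v)" for v
            using *(8) continuous_on_cong[of V V "\<lambda>y. g' y v"] by simp
          show "Ck_on k V (\<lambda>y. f' (g y) v \<bullet> b)" if "b \<in> Basis" for v b
            by (rule Ck_on_compose[OF \<open>open V\<close>, of g U k "\<lambda>x. f' x v \<bullet> b"])
              (use gU f'C[OF that] Suc in \<open>auto simp: smooth_on_def\<close>)
        qed (use b \<open>open V\<close> in auto)
      qed
    qed
  qed
  then have "vsmooth_on V g" by (simp add: vsmooth_on_def smooth_on_def)
  with * show ?thesis using that by blast
qed

text \<open>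
  The inverse function theorem for \<open>(z, x) \<mapsto> (F (z, x), x)\<close>. Uniqueness of the solution within \<open>Z\<close>
  is part of the conclusion, because it forces solutions that are obtained in different ways to agree.
\<close>

theorem smooth_implicit_function:
  fixes F :: "'z::euclidean_space \<times> 'x::euclidean_space \<Rightarrow> 'z"
  assumes "open Q" and F: "vsmooth_on Q F" and Q: "(z0, x0) \<in> Q" and F0: "F (z0, x0) = 0"
    and inj: "\<And>v. frechet_derivative F (at (z0, x0)) (v, 0) = 0 \<Longrightarrow> v = 0"
  obtains Z X h where "open Z" "open X" "z0 \<in> Z" "x0 \<in> X" "Z \<times> X \<subseteq> Q" "vsmooth_on X h" "h ` X \<subseteq> Z"
    "\<And>z x. z \<in> Z \<Longrightarrow> x \<in> X \<Longrightarrow> F (z, x) = 0 \<longleftrightarrow> z = h x"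
proof -
  define f where "f = (\<lambda>p. (F p, snd p))"
  have f: "vsmooth_on Q f"
    unfolding f_def by (rule vsmooth_on_Pair[OF F vsmooth_on_linear[OF \<open>open Q\<close> linear_snd]])
  have D: "(f has_derivative (\<lambda>v. (frechet_derivative F (at (z0, x0)) v, snd v))) (at (z0, x0))"
    unfolding f_def
    by (rule derivative_eq_intros vsmooth_on_derivative[OF F Q] refl | simp)+
  have lin: "linear (frechet_derivative F (at (z0, x0)))"
    using vsmooth_on_derivative[OF F Q] has_derivative_linear by blast
  have inj': "v = 0" if "frechet_derivative f (at (z0, x0)) v = 0" for v
  proof -
    have "(frechet_derivative F (at (z0, x0)) v, snd v) = 0"
      using frechet_derivative_at[OF D] that by metis
    then show ?thesis using inj by (cases v) (auto simp: zero_prod_def)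
  qed
  obtain U' V g where *: "open U'" "U' \<subseteq> Q" "(z0, x0) \<in> U'" "open V" "f (z0, x0) \<in> V"
    "homeomorphism U' V f g" "vsmooth_on V g"
    using smooth_inverse_function[OF \<open>open Q\<close> f Q inj'] by blast
  obtain Z X1 where Z: "open Z" "open X1" "z0 \<in> Z" "x0 \<in> X1" "Z \<times> X1 \<subseteq> U'"
    using *(1,3) by (auto simp: open_prod_def)
  have gf: "g (f p) = p" if "p \<in> U'" for p using *(6) that by (simp add: homeomorphism_def)
  have fg: "f (g p) = p" "g p \<in> U'" if "p \<in> V" for p using *(6) that by (auto simp: homeomorphism_def)
  have cg: "continuous_on V g" using *(6) by (simp add: homeomorphism_def)
  define V' where "V' = V \<inter> g -` (Z \<times> X1)"
  have "open V'" unfolding V'_def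
    using continuous_open_preimage[OF cg \<open>open V\<close> open_Times[OF Z(1,2)]] by simp
  define X where "X = X1 \<inter> (\<lambda>x. (0, x)) -` V'"
  define h where "h = (\<lambda>x. fst (g (0, x)))"
  have "open X" unfolding X_def
    by (intro open_Int Z open_vimage \<open>open V'\<close> continuous_intros)
  have ghx: "g (0, x) = (h x, x)" if "x \<in> X" for x
  proof -
    have "f (g (0, x)) = (0, x)" using that fg by (simp add: X_def V'_def)
    then show ?thesis by (cases "g (0, x)") (simp add: f_def h_def)
  qed
  show ?thesis
  proof
    show "x0 \<in> X" using *(3,5) Z gf[OF *(3)] F0 by (simp add: X_def V'_def f_def)
    show "Z \<times> X \<subseteq> Q" using Z(5) *(2) by (auto simp: X_def)
    show "h ` X \<subseteq> Z"
    proof clarify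
      fix x assume "x \<in> X"
      then have "g (0, x) \<in> Z \<times> X1" by (simp add: X_def V'_def)
      then show "h x \<in> Z" by (auto simp: h_def)
    qed
    have "vsmooth_on X (\<lambda>x. (0::'z, x))"
      by (rule vsmooth_on_Pair[OF vsmooth_on_const vsmooth_on_linear[OF \<open>open X\<close> linear_id[unfolded id_def]]])
    then have "vsmooth_on X (\<lambda>x. g (0, x))"
      by (rule vsmooth_on_compose[where F = "\<lambda>x. (0::'z, x)", OF \<open>open X\<close> _ *(7), rotated]) (auto simp: X_def V'_def)
    then show "vsmooth_on X h" unfolding h_def
      by (rule vsmooth_on_linear_compose[OF \<open>open X\<close> linear_fst])
    show "F (z, x) = 0 \<longleftrightarrow> z = h x" if "z \<in> Z" "x \<in> X" for z x
    proof
      assume "F (z, x) = 0"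
      then have "f (z, x) = (0, x)" by (simp add: f_def)
      moreover have "(z, x) \<in> U'" using that Z by (auto simp: X_def)
      ultimately have "g (0, x) = (z, x)" using gf by metis
      then show "z = h x" by (simp add: h_def)
    next
      assume "z = h x"
      then have "f (z, x) = (0, x)" using ghx[OF that(2)] fg(1)[of "(0, x)"] that by (simp add: X_def V'_def)
      then show "F (z, x) = 0" by (simp add: f_def)
    qed
  qed (use Z \<open>open X\<close> in auto)
qed

section \<open>Hadamard's lemma\<close>

text \<open>
  Each differentiation under the integral produces a further factor \<open>t\<close>; the power \<open>t ^ j\<close> makes the
  class of such integrals closed under partial derivatives, so that the induction goes through.
\<close>

lemma Ck_on_segment_integral:
  fixes p :: "'a::euclidean_space"
  assumes "r > 0"
  shows "smooth_on (ball p r) F \<Longrightarrow> Ck_on k (ball p r) (\<lambda>x. integral {0..1} (\<lambda>t. t ^ j * F (p + t *\<^sub>R (x - p))))"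
proof (induction k arbitrary: F j)
  have seg: "p + t *\<^sub>R (x - p) \<in> ball p r" if "t \<in> {0..1}" "x \<in> ball p r" for t x
  proof -
    have "\<bar>t\<bar> * norm (x - p) \<le> 1 * norm (x - p)" using that by (intro mult_right_mono) auto
    then show ?thesis using that by (simp add: dist_norm norm_minus_commute)
  qed
  have cont2: "continuous_on (ball p r \<times> {0..1}) (\<lambda>(x, t). t ^ j * F (p + t *\<^sub>R (x - p)))"
    if F: "continuous_on (ball p r) F" for F :: "'a \<Rightarrow> real" and j
    unfolding split_beta
    by (intro continuous_intros continuous_on_compose2[OF F]) (use seg in auto)
  have D: "((\<lambda>x. integral {0..1} (\<lambda>t. t ^ j * F (p + t *\<^sub>R (x - p)))) has_derivative
      (\<lambda>v. integral {0..1} (\<lambda>t. t ^ Suc j * frechet_derivative F (at (p + t *\<^sub>R (x - p))) v))) (at x)"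
    if F: "smooth_on (ball p r) F" and x: "x \<in> ball p r" for F :: "'a \<Rightarrow> real" and j x
  proof -
    define fx where "fx = (\<lambda>x t. Blinfun (\<lambda>v. t ^ Suc j * frechet_derivative F (at (p + t *\<^sub>R (x - p))) v))"
    have D1: "((\<lambda>x. t ^ j * F (p + t *\<^sub>R (x - p))) has_derivative
        (\<lambda>v. t ^ Suc j * frechet_derivative F (at (p + t *\<^sub>R (x - p))) v)) (at x)"
      if x: "x \<in> ball p r" and t: "t \<in> {0..1}" for x t
    proof -
      have DF: "(F has_derivative frechet_derivative F (at (p + t *\<^sub>R (x - p)))) (at (p + t *\<^sub>R (x - p)))"
        by (rule smooth_on_derivative[OF F seg[OF t x]])
      have "((\<lambda>x. F (p + t *\<^sub>R (x - p))) has_derivative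
        (\<lambda>v. frechet_derivative F (at (p + t *\<^sub>R (x - p))) (t *\<^sub>R v))) (at x)"
        by (rule has_derivative_compose[where f = "\<lambda>x. p + t *\<^sub>R (x - p)" and g = F and x = x, OF _ DF]) (rule derivative_eq_intros refl | simp)+
      moreover have "linear (frechet_derivative F (at (p + t *\<^sub>R (x - p))))"
        using DF has_derivative_linear by blast
      ultimately have "((\<lambda>x. F (p + t *\<^sub>R (x - p))) has_derivative
        (\<lambda>v. t * frechet_derivative F (at (p + t *\<^sub>R (x - p))) v)) (at x)"
        by (simp add: linear_scale)
      from has_derivative_mult_right[OF this, of "t ^ j"] show ?thesis
        by (simp add: algebra_simps)
    qed
    have fx: "blinfun_apply (fx x t) = (\<lambda>v. t ^ Suc j * frechet_derivative F (at (p + t *\<^sub>R (x - p))) v)"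
      if "x \<in> ball p r" "t \<in> {0..1}" for x t
      using D1[OF that] unfolding fx_def by (intro bounded_linear_Blinfun_apply has_derivative_bounded_linear)
    have cfx: "continuous_on (ball p r \<times> cbox 0 1) (\<lambda>(x, t). fx x t)"
    proof (rule continuous_on_blinfun_componentwise)
      fix i :: 'a
      have "continuous_on (ball p r \<times> {0..1}) (\<lambda>(x, t). t ^ Suc j * frechet_derivative F (at (p + t *\<^sub>R (x - p))) i)"
        by (rule cont2) (rule smooth_on_continuous[OF smooth_on_frechet[OF F]])
      moreover have "(case z of (x, t) \<Rightarrow> t ^ Suc j * frechet_derivative F (at (p + t *\<^sub>R (x - p))) i) =
          blinfun_apply (case z of (x, t) \<Rightarrow> fx x t) i" if "z \<in> ball p r \<times> {0..1}" for z
        using that fx by (auto split: prod.splits)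
      ultimately show "continuous_on (ball p r \<times> cbox 0 1) (\<lambda>z. blinfun_apply (case z of (x, t) \<Rightarrow> fx x t) i)"
        by (subst continuous_on_cong[OF refl, symmetric]) auto
    qed
    have "((\<lambda>x. integral (cbox 0 1) (\<lambda>t. t ^ j * F (p + t *\<^sub>R (x - p)))) has_derivative
        integral (cbox 0 1) (fx x)) (at x within ball p r)"
    proof (rule leibniz_rule[OF _ _ cfx x convex_ball])
      show "((\<lambda>x. t ^ j * F (p + t *\<^sub>R (x - p))) has_derivative blinfun_apply (fx x t)) (at x within ball p r)"
        if "x \<in> ball p r" "t \<in> cbox 0 1" for x t
        using D1[of x t] fx[of x t] that by (auto intro: has_derivative_at_withinI)
      show "(\<lambda>t. t ^ j * F (p + t *\<^sub>R (x - p))) integrable_on cbox 0 1" if "x \<in> ball p r" for x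
        by (rule integrable_continuous, intro continuous_intros continuous_on_compose2[OF smooth_on_continuous[OF F]])
          (use seg that in auto)
    qed
    moreover have "blinfun_apply (integral (cbox 0 1) (fx x)) v =
        integral {0..1} (\<lambda>t. t ^ Suc j * frechet_derivative F (at (p + t *\<^sub>R (x - p))) v)" for v
    proof -
      have "fx x integrable_on cbox 0 1"
        by (rule integrable_continuous, rule continuous_on_compose2[OF cfx, of _ "\<lambda>t. (x, t)", simplified])
          (use x in \<open>auto intro!: continuous_intros\<close>)
      then have "blinfun_apply (integral (cbox 0 1) (fx x)) v = integral (cbox 0 1) (\<lambda>t. fx x t v)"
        using integral_linear[of "fx x" "cbox 0 1" "\<lambda>B. blinfun_apply B v"] 
        by (simp add: o_def blinfun.bounded_linear_left)
      also have "\<dots> = integral {0..1} (\<lambda>t. t ^ Suc j * frechet_derivative F (at (p + t *\<^sub>R (x - p))) v)"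
        using fx x by (auto intro!: integral_cong)
      finally show ?thesis .
    qed
    then have "blinfun_apply (integral (cbox 0 1) (fx x)) =
        (\<lambda>v. integral {0..1} (\<lambda>t. t ^ Suc j * frechet_derivative F (at (p + t *\<^sub>R (x - p))) v))"
      by (rule ext)
    ultimately show ?thesis
      using at_within_open[OF x open_ball] by simp
  qed
  {
    case 0
    have "continuous_on (ball p r) (\<lambda>x. integral {0..1} (\<lambda>t. t ^ j * F (p + t *\<^sub>R (x - p))))"
      by (intro continuous_at_imp_continuous_on ballI has_derivative_continuous[OF D[OF 0]])
    then show ?case by simp
  next
    case (Suc k)
    show ?case
      by (rule Ck_on_SucI[OF open_ball D[OF Suc.prems]])
        (assumption | rule Suc.IH smooth_on_frechet Suc.prems)+
  }
qed

text \<open>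
  The fundamental theorem of calculus along the segment from \<open>p\<close> to \<open>x\<close>.
\<close>

lemma hadamard:
  fixes f :: "'a::euclidean_space \<Rightarrow> real"
  assumes "open U" "smooth_on U f" "p \<in> U"
  obtains V G where "open V" "V \<subseteq> U" "p \<in> V" "\<And>b. smooth_on V (G b)"
    "\<And>x. x \<in> V \<Longrightarrow> f x = f p + (\<Sum>b\<in>Basis. ((x - p) \<bullet> b) * G b x)"
    "\<And>b. G b p = frechet_derivative f (at p) b"
proof -
  obtain r where r: "r > 0" "ball p r \<subseteq> U" using assms open_contains_ball by blast
  have f: "smooth_on (ball p r) f" using smooth_on_subset assms r by blast
  define G where "G = (\<lambda>b x. integral {0..1} (\<lambda>t. frechet_derivative f (at (p + t *\<^sub>R (x - p))) b))"
  show ?thesis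
  proof (rule that[of "ball p r" G])
    show "smooth_on (ball p r) (G b)" for b
      unfolding smooth_on_def G_def
      using Ck_on_segment_integral[OF r(1) smooth_on_frechet[OF f], of _ 0] by simp
    show "f x = f p + (\<Sum>b\<in>Basis. ((x - p) \<bullet> b) * G b x)" if x: "x \<in> ball p r" for x
    proof -
      have seg: "p + t *\<^sub>R (x - p) \<in> ball p r" if "t \<in> {0..1}" for t
      proof -
        have "\<bar>t\<bar> * norm (x - p) \<le> 1 * norm (x - p)" using that by (intro mult_right_mono) auto
        then show ?thesis using x by (simp add: dist_norm norm_minus_commute)
      qed
      let ?D = "\<lambda>t b. frechet_derivative f (at (p + t *\<^sub>R (x - p))) b"
      have vd: "((\<lambda>t. f (p + t *\<^sub>R (x - p))) has_vector_derivative (\<Sum>b\<in>Basis. ((x - p) \<bullet> b) * ?D t b)) (at t within {0..1})"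
        if t: "t \<in> {0..1}" for t
      proof -
        have DF: "(f has_derivative ?D t) (at (p + t *\<^sub>R (x - p)))"
          by (rule smooth_on_derivative[OF f seg[OF t]])
        have lin: "linear (?D t)" using DF has_derivative_linear by blast
        have "?D t (x - p) = ?D t (\<Sum>b\<in>Basis. ((x - p) \<bullet> b) *\<^sub>R b)" by (simp add: euclidean_representation)
        also have "\<dots> = (\<Sum>b\<in>Basis. ((x - p) \<bullet> b) * ?D t b)" using lin by (simp add: linear_sum linear_scale)
        finally have eq: "?D t (x - p) = (\<Sum>b\<in>Basis. ((x - p) \<bullet> b) * ?D t b)" .
        have "((\<lambda>t. f (p + t *\<^sub>R (x - p))) has_derivative (\<lambda>h. ?D t (h *\<^sub>R (x - p)))) (at t within {0..1})"
          by (rule has_derivative_compose[where f = "\<lambda>t. p + t *\<^sub>R (x - p)" and g = f and x = t, OF _ DF]) (rule derivative_eq_intros refl | simp)+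
        then show ?thesis unfolding has_vector_derivative_def using lin eq by (simp add: linear_scale)
      qed
      have ci: "(\<lambda>t. ?D t b) integrable_on {0..1}" for b
        by (rule integrable_continuous_real, rule continuous_on_compose2[OF smooth_on_continuous[OF smooth_on_frechet[OF f]]])
          (use seg in \<open>auto intro!: continuous_intros\<close>)
      have "((\<lambda>t. \<Sum>b\<in>Basis. ((x - p) \<bullet> b) * ?D t b) has_integral (f x - f p)) {0..1}"
        using fundamental_theorem_of_calculus[OF _ vd] by simp
      then have "f x - f p = integral {0..1} (\<lambda>t. \<Sum>b\<in>Basis. ((x - p) \<bullet> b) * ?D t b)"
        by (simp add: integral_unique)
      also have "\<dots> = (\<Sum>b\<in>Basis. ((x - p) \<bullet> b) * G b x)"
        using ci by (subst integral_sum) (auto simp: G_def intro!: integrable_on_mult_right)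
      finally show ?thesis by simp
    qed
    show "G b p = frechet_derivative f (at p) b" for b by (simp add: G_def)
  qed (use r in auto)
qed

section \<open>Germs and derivations\<close>

lemma nbhd_Int: "nbhd X x U \<Longrightarrow> nbhd X x V \<Longrightarrow> nbhd X x (U \<inter> V)"
  by (auto simp: nbhd_def)

lemma nbhd_points: "nbhd X x U \<Longrightarrow> x \<in> points X"
  using openin_subset by (fastforce simp: nbhd_def)

text \<open>
  The properties of the sheaf of smooth functions that derivations need. They hold for manifolds and
  are inherited by subspaces and by quotients.
\<close>

locale germ_space =
  fixes X :: "'m smooth_space"
  assumes const_germ: "x \<in> points X \<Longrightarrow> (\<lambda>y. r) \<in> germs X x"
    and add_germ: "x \<in> points X \<Longrightarrow> f \<in> germs X x \<Longrightarrow> h \<in> germs X x \<Longrightarrow> (\<lambda>y. f y + h y) \<in> germs X x"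
    and mult_germ: "x \<in> points X \<Longrightarrow> f \<in> germs X x \<Longrightarrow> h \<in> germs X x \<Longrightarrow> (\<lambda>y. f y * h y) \<in> germs X x"
    and cong_germ: "f \<in> germs X x \<Longrightarrow> nbhd X x U \<Longrightarrow> (\<And>y. y \<in> U \<Longrightarrow> h y = f y) \<Longrightarrow> h \<in> germs X x"
begin

lemma sum_germ:
  assumes "x \<in> points X" "finite I" "\<And>i. i \<in> I \<Longrightarrow> f i \<in> germs X x"
  shows "(\<lambda>y. \<Sum>i\<in>I. f i y) \<in> germs X x"
  using assms(2,3) by (induction I rule: finite_induct) (auto simp: const_germ add_germ assms(1))

lemma scale_germ: "x \<in> points X \<Longrightarrow> f \<in> germs X x \<Longrightarrow> (\<lambda>y. r * f y) \<in> germs X x"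
  by (intro mult_germ const_germ)

lemma tangent_const:
  assumes "x \<in> points X" "v \<in> tangent X x" shows "v (\<lambda>y. r) = 0"
proof -
  have 1: "v (\<lambda>y. f y * h y) = f x * v h + h x * v f" if "f \<in> germs X x" "h \<in> germs X x" for f h
    using assms(2) that by (simp add: tangent_def)
  have "v (\<lambda>y. 1) = 0" using 1[OF const_germ const_germ, of 1 1] assms(1) by simp
  moreover have "v (\<lambda>y. r * (\<lambda>y. 1) y) = r * v (\<lambda>y. 1)"
    using assms(2) const_germ[OF assms(1), of 1] by (simp only: tangent_def mem_Collect_eq)
  ultimately show ?thesis by simp
qed

lemma tangent_add: "v \<in> tangent X x \<Longrightarrow> f \<in> germs X x \<Longrightarrow> h \<in> germs X x \<Longrightarrow> v (\<lambda>y. f y + h y) = v f + v h"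
  by (simp add: tangent_def)

lemma tangent_mult: "v \<in> tangent X x \<Longrightarrow> f \<in> germs X x \<Longrightarrow> h \<in> germs X x \<Longrightarrow>
    v (\<lambda>y. f y * h y) = f x * v h + h x * v f"
  by (simp add: tangent_def)

lemma tangent_scale: "v \<in> tangent X x \<Longrightarrow> f \<in> germs X x \<Longrightarrow> v (\<lambda>y. r * f y) = r * v f"
  by (simp add: tangent_def)

lemma tangent_sum:
  assumes "x \<in> points X" "v \<in> tangent X x" "finite I" "\<And>i. i \<in> I \<Longrightarrow> f i \<in> germs X x"
  shows "v (\<lambda>y. \<Sum>i\<in>I. f i y) = (\<Sum>i\<in>I. v (f i))"
  using assms(3,4)
proof (induction I rule: finite_induct)
  case empty
  then show ?case using tangent_const[OF assms(1,2)] by simp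
next
  case (insert i I)
  then show ?case
    using tangent_add[OF assms(2), of "f i" "\<lambda>y. \<Sum>i\<in>I. f i y"] sum_germ[OF assms(1), of I f] by simp
qed

lemma tangent_vector:
  fixes F :: "'m \<Rightarrow> 'e::euclidean_space"
  assumes "x \<in> points X" "v \<in> tangent X x" "\<And>b. b \<in> Basis \<Longrightarrow> (\<lambda>y. F y \<bullet> b) \<in> germs X x"
  shows "v (\<lambda>y. F y \<bullet> w) = (\<Sum>b\<in>Basis. v (\<lambda>y. F y \<bullet> b) *\<^sub>R b) \<bullet> w"
proof -
  have "v (\<lambda>y. F y \<bullet> w) = v (\<lambda>y. \<Sum>b\<in>Basis. (w \<bullet> b) * (F y \<bullet> b))"
    by (simp add: euclidean_inner[of _ w] mult.commute)
  also have "\<dots> = (\<Sum>b\<in>Basis. v (\<lambda>y. (w \<bullet> b) * (F y \<bullet> b)))"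
    by (rule tangent_sum[OF assms(1,2) finite_Basis scale_germ[OF assms(1,3)]])
  also have "\<dots> = (\<Sum>b\<in>Basis. (w \<bullet> b) * v (\<lambda>y. F y \<bullet> b))"
    by (rule sum.cong[OF refl tangent_scale[OF assms(2,3)]])
  finally show ?thesis by (simp add: inner_sum_left inner_commute[of w] mult.commute)
qed

text \<open>
  Derivations are local. The indicator function of a neighbourhood serves as a cut-off function: it
  agrees with the constant 1 near the base point and hence has a smooth germ there.
\<close>

lemma tangent_cong:
  assumes v: "v \<in> tangent X x" and f: "f \<in> germs X x" and U: "nbhd X x U" and eq: "\<And>y. y \<in> U \<Longrightarrow> h y = f y"
  shows "v h = v f"
proof -
  have x: "x \<in> points X" using nbhd_points[OF U] .
  have h: "h \<in> germs X x" using cong_germ[OF f U eq] .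
  define e where "e = (\<lambda>y. if y \<in> U then 1 else (0::real))"
  have e: "e \<in> germs X x" by (rule cong_germ[OF const_germ[OF x, of 1] U]) (simp add: e_def)
  have ex: "e x = 1" using U by (simp add: e_def nbhd_def)
  have "v (\<lambda>y. e y * h y) = v h + h x * v e" using tangent_mult[OF v e h] ex by simp
  moreover have "v (\<lambda>y. e y * f y) = v f + f x * v e" using tangent_mult[OF v e f] ex by simp
  moreover have "(\<lambda>y. e y * h y) = (\<lambda>y. e y * f y)" by (auto simp: e_def eq)
  moreover have "h x = f x" using eq U by (simp add: nbhd_def)
  ultimately show ?thesis by simp
qed

lemma tangent_cong_const:
  assumes "v \<in> tangent X x" "nbhd X x U" "\<And>y. y \<in> U \<Longrightarrow> h y = r"
  shows "v h = 0"
  using tangent_cong[OF assms(1) const_germ[OF nbhd_points[OF assms(2)]] assms(2), of h r]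
    tangent_const[OF nbhd_points[OF assms(2)] assms(1)] assms(3) by simp

lemma tangent_outside: "v \<in> tangent X x \<Longrightarrow> f \<notin> germs X x \<Longrightarrow> v f = 0"
  by (simp add: tangent_def)

lemma tadd_tangent:
  assumes "x \<in> points X" "v \<in> tangent X x" "w \<in> tangent X x" shows "tadd v w \<in> tangent X x"
  using assms unfolding tangent_def tadd_def by (auto simp: algebra_simps)

lemma tscale_tangent:
  assumes "x \<in> points X" "v \<in> tangent X x" shows "tscale r v \<in> tangent X x"
  using assms unfolding tangent_def tscale_def by (auto simp: algebra_simps)

end

text \<open>A smooth map pulls germs back and hence pushes derivations forward.\<close>

lemma differential_tangent:
  assumes X: "germ_space X" and Y: "germ_space Y" and x: "F x \<in> points Y"
    and pull: "\<And>h. h \<in> germs Y (F x) \<Longrightarrow> h \<circ> F \<in> germs X x" and v: "v \<in> tangent X x"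
  shows "differential X Y F x v \<in> tangent Y (F x)"
proof -
  interpret X: germ_space X by fact
  interpret Y: germ_space Y by fact
  have 1: "(\<lambda>y. h (F y)) \<in> germs X x" if "h \<in> germs Y (F x)" for h
    using pull[OF that] by (simp add: o_def)
  show ?thesis
    unfolding tangent_def differential_def
    using Y.add_germ[OF x] Y.mult_germ[OF x] Y.scale_germ[OF x] 1
    by (auto simp: o_def X.tangent_add[OF v] X.tangent_mult[OF v] X.tangent_scale[OF v])
qed

section \<open>Euclidean retracts\<close>

text \<open>
  Generalised charts: \<open>c\<close> embeds a neighbourhood into a Euclidean space and \<open>\<kappa>\<close> is a smooth left
  inverse of it, defined on a full open set of the Euclidean space. Besides inverting charts this
  covers quotients, where charts would require a submanifold chart of the zero level and of
  a slice, whereas a retraction is a composition of smooth maps.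
\<close>

locale euclidean_retract = germ_space X for X :: "'m smooth_space" +
  fixes c :: "'m \<Rightarrow> 'a::euclidean_space" and \<kappa> :: "'a \<Rightarrow> 'm" and U :: "'m set" and E :: "'a set"
  assumes openU: "openin (topo X) U" and openE: "open E"
    and cE: "y \<in> U \<Longrightarrow> c y \<in> E" and \<kappa>c: "y \<in> U \<Longrightarrow> \<kappa> (c y) = y"
    and \<kappa>_points: "p \<in> E \<Longrightarrow> \<kappa> p \<in> points X"
    and c_cont: "open V \<Longrightarrow> openin (topo X) {y \<in> U. c y \<in> V}"
    and c_smooth: "y \<in> U \<Longrightarrow> open V \<Longrightarrow> c y \<in> V \<Longrightarrow> smooth_on V F \<Longrightarrow> F \<circ> c \<in> germs X y"
    and \<kappa>_smooth: "p \<in> E \<Longrightarrow> f \<in> germs X (\<kappa> p) \<Longrightarrow> \<exists>V. open V \<and> p \<in> V \<and> smooth_on V (f \<circ> \<kappa>)"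
begin

lemma U_points: "x \<in> U \<Longrightarrow> x \<in> points X"
  using openU openin_subset by blast

lemma nbhd_U: "x \<in> U \<Longrightarrow> nbhd X x U"
  by (simp add: nbhd_def openU)

lemma germ_smooth:
  assumes "x \<in> U" "f \<in> germs X x"
  obtains V where "open V" "c x \<in> V" "smooth_on V (f \<circ> \<kappa>)"
  using \<kappa>_smooth[OF cE[OF assms(1)]] assms \<kappa>c[OF assms(1)] by auto

lemma nbhd_c: "x \<in> U \<Longrightarrow> open V \<Longrightarrow> c x \<in> V \<Longrightarrow> nbhd X x {y \<in> U. c y \<in> V}"
  by (simp add: nbhd_def c_cont)

lemma germ_near:
  assumes "x \<in> U" "open V" "c x \<in> V" "smooth_on V (f \<circ> \<kappa>)"
  shows "f \<in> germs X x"
  by (rule cong_germ[OF c_smooth[OF assms] nbhd_U[OF assms(1)]]) (simp add: \<kappa>c)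

lemma germ_open:
  assumes "x \<in> U" "f \<in> germs X x"
  obtains N where "nbhd X x N" "\<And>y. y \<in> N \<Longrightarrow> f \<in> germs X y"
proof -
  obtain V where V: "open V" "c x \<in> V" "smooth_on V (f \<circ> \<kappa>)" using germ_smooth[OF assms] .
  show ?thesis
    by (rule that[OF nbhd_c[OF assms(1) V(1,2)]]) (use germ_near V in auto)
qed

lemma coord_germ: "x \<in> U \<Longrightarrow> (\<lambda>y. c y \<bullet> b) \<in> germs X x"
  using c_smooth[OF _ open_UNIV UNIV_I smooth_on_inner[OF open_UNIV, of b]] by (simp add: o_def)

text \<open>The directional derivative along the constant field \<open>w\<close> on the Euclidean space.\<close>

definition coord_field :: "'a \<Rightarrow> 'm vfield" where
  "coord_field w = (\<lambda>y f. if f \<in> germs X y then frechet_derivative (f \<circ> \<kappa>) (at (c y)) w else 0)"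

lemma germ_derivative:
  assumes "x \<in> U" "f \<in> germs X x"
  shows "(f \<circ> \<kappa> has_derivative (\<lambda>w. coord_field w x f)) (at (c x))"
proof -
  obtain V where V: "open V" "c x \<in> V" "smooth_on V (f \<circ> \<kappa>)" using germ_smooth[OF assms] .
  show ?thesis using smooth_on_derivative[OF V(3,2)] assms(2) by (simp add: coord_field_def)
qed

lemma coord_field_eqI:
  assumes "x \<in> U" "f \<in> germs X x" "(f \<circ> \<kappa> has_derivative D) (at (c x))"
  shows "coord_field w x f = D w"
  using has_derivative_unique[OF germ_derivative[OF assms(1,2)] assms(3)] by metis

lemma coord_field_tangent:
  assumes x: "x \<in> U" shows "coord_field w x \<in> tangent X x"
proof -
  note d = germ_derivative[OF x, unfolded o_def]
  have "coord_field w x (\<lambda>y. r * f y) = r * coord_field w x f" if "f \<in> germs X x" for r f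
    by (rule coord_field_eqI[OF x scale_germ[OF U_points[OF x] that]])
      (use has_derivative_mult_right[OF d[OF that]] in \<open>simp add: o_def\<close>)
  moreover have "coord_field w x (\<lambda>y. f y + h y) = coord_field w x f + coord_field w x h"
    if "f \<in> germs X x" "h \<in> germs X x" for f h
    by (rule coord_field_eqI[OF x add_germ[OF U_points[OF x] that]])
      (use has_derivative_add[OF d[OF that(1)] d[OF that(2)]] in \<open>simp add: o_def\<close>)
  moreover have "coord_field w x (\<lambda>y. f y * h y) = f x * coord_field w x h + h x * coord_field w x f"
    if "f \<in> germs X x" "h \<in> germs X x" for f h
    using coord_field_eqI[OF x mult_germ[OF U_points[OF x] that], unfolded o_def,
        OF has_derivative_mult[OF d[OF that(1)] d[OF that(2)]]]
    by (simp add: \<kappa>c[OF x])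
  ultimately show ?thesis by (auto simp: tangent_def coord_field_def)
qed

lemma coord_field_add:
  assumes "x \<in> U" shows "coord_field (w + w') x = tadd (coord_field w x) (coord_field w' x)"
proof
  fix f
  show "coord_field (w + w') x f = tadd (coord_field w x) (coord_field w' x) f"
  proof (cases "f \<in> germs X x")
    case True
    have "linear (\<lambda>w. coord_field w x f)"
      using germ_derivative[OF assms True] has_derivative_linear by blast
    from linear_add[OF this] show ?thesis by (simp add: tadd_def)
  qed (simp add: tadd_def coord_field_def)
qed

lemma coord_field_scale:
  assumes "x \<in> U" shows "coord_field (r *\<^sub>R w) x = tscale r (coord_field w x)"
proof
  fix f
  show "coord_field (r *\<^sub>R w) x f = tscale r (coord_field w x) f"
  proof (cases "f \<in> germs X x")
    case True
    have "linear (\<lambda>w. coord_field w x f)"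
      using germ_derivative[OF assms True] has_derivative_linear by blast
    from linear_scale[OF this] show ?thesis by (simp add: tscale_def)
  qed (simp add: tscale_def coord_field_def)
qed

lemma coord_field_vfield:
  assumes x: "x \<in> U" shows "vfield_near X x (coord_field w)"
  unfolding vfield_near_def
proof (intro exI conjI ballI)
  show "nbhd X x U" by (rule nbhd_U[OF x])
  fix y assume y: "y \<in> U"
  show "coord_field w y \<in> tangent X y" by (rule coord_field_tangent[OF y])
  fix f assume f: "f \<in> germs X y"
  obtain V where V: "open V" "c y \<in> V" "smooth_on V (f \<circ> \<kappa>)" using germ_smooth[OF y f] .
  show "(\<lambda>z. coord_field w z f) \<in> germs X y"
  proof (rule cong_germ[OF c_smooth[OF y V(1,2) smooth_on_frechet[OF V(3)]] nbhd_c[OF y V(1,2)]])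
    fix z assume "z \<in> {y \<in> U. c y \<in> V}"
    then show "coord_field w z f = ((\<lambda>x. frechet_derivative (f \<circ> \<kappa>) (at x) w) \<circ> c) z"
      using germ_near[of z V f] V by (simp add: coord_field_def)
  qed
qed

definition coords :: "'m tvec \<Rightarrow> 'a" where
  "coords v = (\<Sum>b\<in>Basis. v (\<lambda>y. c y \<bullet> b) *\<^sub>R b)"

text \<open>
  \<open>coords v\<close> is the vector whose directional derivative is \<open>v\<close>, see \<open>tangent_eq_coord_field\<close>.
\<close>

lemma coords_add: "coords (tadd t u) = coords t + coords u"
  by (simp add: coords_def tadd_def scaleR_add_left sum.distrib)

lemma coords_scale: "coords (tscale r t) = r *\<^sub>R coords t"
  by (simp add: coords_def tscale_def scaleR_sum_right)

lemma tangent_inner: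
  assumes "x \<in> U" "v \<in> tangent X x" shows "v (\<lambda>y. c y \<bullet> w) = coords v \<bullet> w"
proof -
  have "v (\<lambda>y. c y \<bullet> w) = v (\<lambda>y. \<Sum>b\<in>Basis. (w \<bullet> b) * (c y \<bullet> b))"
    by (simp add: euclidean_inner[of _ w] mult.commute)
  also have "\<dots> = (\<Sum>b\<in>Basis. (w \<bullet> b) * v (\<lambda>y. c y \<bullet> b))"
    using assms U_points coord_germ
    by (subst tangent_sum[of x]) (auto intro!: scale_germ sum.cong tangent_scale)
  finally show ?thesis
    by (simp add: coords_def inner_sum_left inner_commute[of w] mult.commute)
qed

text \<open>Every derivation is a directional derivative, by Hadamard's lemma.\<close>

lemma tangent_eq_coord_field:
  assumes x: "x \<in> U" and v: "v \<in> tangent X x"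
  shows "v = coord_field (coords v) x"
proof
  fix f
  show "v f = coord_field (coords v) x f"
  proof (cases "f \<in> germs X x")
    case False
    then show ?thesis using v by (simp add: coord_field_def tangent_outside)
  next
    case True
    note xp = U_points[OF x]
    obtain V where V: "open V" "c x \<in> V" "smooth_on V (f \<circ> \<kappa>)" using germ_smooth[OF x True] .
    obtain V' G where V': "open V'" "V' \<subseteq> V" "c x \<in> V'" and G: "\<And>b. smooth_on V' (G b)"
      "\<And>p. p \<in> V' \<Longrightarrow> (f \<circ> \<kappa>) p = (f \<circ> \<kappa>) (c x) + (\<Sum>b\<in>Basis. ((p - c x) \<bullet> b) * G b p)"
      "\<And>b. G b (c x) = frechet_derivative (f \<circ> \<kappa>) (at (c x)) b"
      by (rule hadamard[OF V(1,3,2)], rule that)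
    let ?d = "\<lambda>b y. c y \<bullet> b + - (c x \<bullet> b)"
    let ?g = "\<lambda>b y. G b (c y)"
    have g: "?g b \<in> germs X x" for b using c_smooth[OF x V'(1,3) G(1)] by (simp add: o_def)
    have d: "?d b \<in> germs X x" for b by (rule add_germ[OF xp coord_germ[OF x] const_germ[OF xp]])
    have vd: "v (?d b) = v (\<lambda>y. c y \<bullet> b)" for b
      using tangent_add[OF v coord_germ[OF x, of b] const_germ[OF xp, of "- (c x \<bullet> b)"]]
        tangent_const[OF xp v, of "- (c x \<bullet> b)"] by simp
    have vdg: "v (\<lambda>y. ?d b y * ?g b y) = v (\<lambda>y. c y \<bullet> b) * coord_field b x f" for b
      using tangent_mult[OF v d g] vd G(3) True by (simp add: coord_field_def)
    have "v f = v (\<lambda>y. f x + (\<Sum>b\<in>Basis. ?d b y * ?g b y))"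
    proof (rule tangent_cong[OF v _ nbhd_c[OF x V'(1,3)]])
      show "(\<lambda>y. f x + (\<Sum>b\<in>Basis. ?d b y * ?g b y)) \<in> germs X x"
        by (rule add_germ[OF xp const_germ[OF xp] sum_germ[OF xp finite_Basis mult_germ[OF xp d g]]])
      show "f y = f x + (\<Sum>b\<in>Basis. ?d b y * ?g b y)" if "y \<in> {y \<in> U. c y \<in> V'}" for y
        using G(2)[of "c y"] that \<kappa>c x by (simp add: inner_diff_left)
    qed
    also have "\<dots> = v (\<lambda>y. f x) + v (\<lambda>y. \<Sum>b\<in>Basis. ?d b y * ?g b y)"
      by (rule tangent_add[OF v const_germ[OF xp] sum_germ[OF xp finite_Basis mult_germ[OF xp d g]]])
    also have "v (\<lambda>y. \<Sum>b\<in>Basis. ?d b y * ?g b y) = (\<Sum>b\<in>Basis. v (\<lambda>y. ?d b y * ?g b y))"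
      by (rule tangent_sum[OF xp v finite_Basis mult_germ[OF xp d g]])
    also have "\<dots> = (\<Sum>b\<in>Basis. v (\<lambda>y. c y \<bullet> b) * coord_field b x f)"
      using vdg tangent_const[OF xp v] by simp
    also have "\<dots> = coord_field (coords v) x f"
    proof -
      have "linear (\<lambda>w. coord_field w x f)"
        using germ_derivative[OF x True] has_derivative_linear by blast
      from linear_sum[OF this, of "\<lambda>b. v (\<lambda>y. c y \<bullet> b) *\<^sub>R b" Basis] linear_scale[OF this]
      show ?thesis by (simp add: coords_def)
    qed
    finally show ?thesis using tangent_const[OF xp v] by simp
  qed
qed

lemma tangent_derivative:
  assumes "x \<in> U" "v \<in> tangent X x" "f \<in> germs X x" "(f \<circ> \<kappa> has_derivative D) (at (c x))"
  shows "v f = D (coords v)"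
  using tangent_eq_coord_field[OF assms(1,2)] coord_field_eqI[OF assms(1,3,4)] by metis

lemma vector_germ_derivative:
  fixes F :: "'m \<Rightarrow> 'e::euclidean_space"
  assumes x: "x \<in> U" and F: "(\<lambda>y. F y \<bullet> b) \<in> germs X x"
    and V: "open V" "c x \<in> V" "vsmooth_on V (F \<circ> \<kappa>)" and t: "t \<in> tangent X x"
  shows "frechet_derivative (F \<circ> \<kappa>) (at (c x)) (coords t) \<bullet> b = t (\<lambda>y. F y \<bullet> b)"
proof -
  have "((\<lambda>p. (F \<circ> \<kappa>) p \<bullet> b) has_derivative (\<lambda>w. frechet_derivative (F \<circ> \<kappa>) (at (c x)) w \<bullet> b)) (at (c x))"
    by (rule derivative_eq_intros vsmooth_on_derivative[OF V(3,2)] | simp)+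
  then have "((\<lambda>y. F y \<bullet> b) \<circ> \<kappa> has_derivative (\<lambda>w. frechet_derivative (F \<circ> \<kappa>) (at (c x)) w \<bullet> b)) (at (c x))"
    by (simp add: o_def)
  from tangent_derivative[OF x t F this] show ?thesis by simp
qed

section \<open>The exterior derivative of a 1-form\<close>

text \<open>
  The second derivatives in the Leibniz rule for the two composites cancel.
\<close>

lemma bracket_tangent:
  assumes x: "x \<in> U" and A: "vfield_near X x A" and B: "vfield_near X x B"
  shows "bracket X A B x \<in> tangent X x"
proof -
  note xp = U_points[OF x]
  obtain NA where NA: "nbhd X x NA" "\<And>y. y \<in> NA \<Longrightarrow> A y \<in> tangent X y"
    "\<And>y f. y \<in> NA \<Longrightarrow> f \<in> germs X y \<Longrightarrow> (\<lambda>z. A z f) \<in> germs X y"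
    using A by (auto simp: vfield_near_def)
  obtain NB where NB: "nbhd X x NB" "\<And>y. y \<in> NB \<Longrightarrow> B y \<in> tangent X y"
    "\<And>y f. y \<in> NB \<Longrightarrow> f \<in> germs X y \<Longrightarrow> (\<lambda>z. B z f) \<in> germs X y"
    using B by (auto simp: vfield_near_def)
  have xA: "x \<in> NA" "x \<in> NB" using NA(1) NB(1) by (auto simp: nbhd_def)
  have second: "e (\<lambda>y. D y (\<lambda>y. f y + h y)) = e (\<lambda>y. D y f) + e (\<lambda>y. D y h)"
    "e (\<lambda>y. D y (\<lambda>y. r * f y)) = r * e (\<lambda>y. D y f)"
    "e (\<lambda>y. D y (\<lambda>y. f y * h y)) =
        f x * e (\<lambda>y. D y h) + D x h * e f + (h x * e (\<lambda>y. D y f) + D x f * e h)"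
    if f: "f \<in> germs X x" and h: "h \<in> germs X x" and C: "e \<in> tangent X x"
      and N: "nbhd X x N" and D: "\<And>y. y \<in> N \<Longrightarrow> D y \<in> tangent X y"
      and Dg: "\<And>f. f \<in> germs X x \<Longrightarrow> (\<lambda>z. D z f) \<in> germs X x"
    for f h r N and e and D :: "'m vfield"
  proof -
    obtain Nf Nh where Nf: "nbhd X x Nf" "\<And>y. y \<in> Nf \<Longrightarrow> f \<in> germs X y"
      and Nh: "nbhd X x Nh" "\<And>y. y \<in> Nh \<Longrightarrow> h \<in> germs X y"
      using germ_open[OF x f] germ_open[OF x h] by metis
    note n = nbhd_Int[OF N nbhd_Int[OF Nf(1) Nh(1)]]
    have "e (\<lambda>y. D y (\<lambda>y. f y + h y)) = e (\<lambda>y. D y f + D y h)"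
      by (rule tangent_cong[OF C add_germ[OF xp Dg[OF f] Dg[OF h]] n])
        (use Nf Nh D in \<open>auto intro: tangent_add\<close>)
    then show "e (\<lambda>y. D y (\<lambda>y. f y + h y)) = e (\<lambda>y. D y f) + e (\<lambda>y. D y h)"
      using tangent_add[OF C Dg[OF f] Dg[OF h]] by simp
    have "e (\<lambda>y. D y (\<lambda>y. r * f y)) = e (\<lambda>y. r * D y f)"
      by (rule tangent_cong[OF C scale_germ[OF xp Dg[OF f]] n])
        (use Nf D in \<open>auto intro: tangent_scale\<close>)
    then show "e (\<lambda>y. D y (\<lambda>y. r * f y)) = r * e (\<lambda>y. D y f)"
      using tangent_scale[OF C Dg[OF f]] by simp
    note m1 = mult_germ[OF xp f Dg[OF h]] and m2 = mult_germ[OF xp h Dg[OF f]]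
    have "e (\<lambda>y. D y (\<lambda>y. f y * h y)) = e (\<lambda>y. f y * D y h + h y * D y f)"
      by (rule tangent_cong[OF C add_germ[OF xp m1 m2] n])
        (use Nf Nh D in \<open>auto intro: tangent_mult\<close>)
    then show "e (\<lambda>y. D y (\<lambda>y. f y * h y)) =
        f x * e (\<lambda>y. D y h) + D x h * e f + (h x * e (\<lambda>y. D y f) + D x f * e h)"
      using tangent_add[OF C m1 m2] tangent_mult[OF C f Dg[OF h]] tangent_mult[OF C h Dg[OF f]] by simp
  qed
  have AB: "A x (\<lambda>y. B y (\<lambda>y. f y + h y)) = A x (\<lambda>y. B y f) + A x (\<lambda>y. B y h)"
    "A x (\<lambda>y. B y (\<lambda>y. r * f y)) = r * A x (\<lambda>y. B y f)"
    "A x (\<lambda>y. B y (\<lambda>y. f y * h y)) =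
        f x * A x (\<lambda>y. B y h) + B x h * A x f + (h x * A x (\<lambda>y. B y f) + B x f * A x h)"
    if "f \<in> germs X x" "h \<in> germs X x" for f h r
    by (rule second[OF that NA(2)[OF xA(1)] NB(1,2) NB(3)[OF xA(2)]]; assumption)+
  have BA: "B x (\<lambda>y. A y (\<lambda>y. f y + h y)) = B x (\<lambda>y. A y f) + B x (\<lambda>y. A y h)"
    "B x (\<lambda>y. A y (\<lambda>y. r * f y)) = r * B x (\<lambda>y. A y f)"
    "B x (\<lambda>y. A y (\<lambda>y. f y * h y)) =
        f x * B x (\<lambda>y. A y h) + A x h * B x f + (h x * B x (\<lambda>y. A y f) + A x f * B x h)"
    if "f \<in> germs X x" "h \<in> germs X x" for f h r
    by (rule second[OF that NB(2)[OF xA(2)] NA(1,2) NA(3)[OF xA(1)]]; assumption)+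
  show ?thesis
    unfolding tangent_def
  proof (intro CollectI conjI allI ballI impI)
    show "bracket X A B x f = 0" if "f \<notin> germs X x" for f using that by (simp add: bracket_def)
    fix f assume f: "f \<in> germs X x"
    show "bracket X A B x (\<lambda>y. r * f y) = r * bracket X A B x f" for r
      using f scale_germ[OF xp f] AB(2)[OF f f] BA(2)[OF f f] by (simp add: bracket_def algebra_simps)
    fix h assume h: "h \<in> germs X x"
    show "bracket X A B x (\<lambda>y. f y + h y) = bracket X A B x f + bracket X A B x h"
      using f h add_germ[OF xp f h] AB(1)[OF f h] BA(1)[OF f h] by (simp add: bracket_def algebra_simps)
    show "bracket X A B x (\<lambda>y. f y * h y) = f x * bracket X A B x h + h x * bracket X A B x f"
      using f h mult_germ[OF xp f h] AB(3)[OF f h] BA(3)[OF f h] by (simp add: bracket_def algebra_simps)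
  qed
qed

text \<open>
  The Leibniz rule, together with the definition of the bracket, computes \<open>d(\<Sum>\<^sub>i a\<^sub>i dC\<^sub>i)\<close> as
  \<open>\<Sum>\<^sub>i da\<^sub>i \<and> dC\<^sub>i\<close> for any extensions of \<open>v\<close> and \<open>w\<close>; constant fields in the coordinates supply
  extensions.
\<close>

lemma d1_eq:
  fixes a C :: "'i \<Rightarrow> 'm \<Rightarrow> real"
  assumes x: "x \<in> U" and v: "v \<in> tangent X x" and w: "w \<in> tangent X x" and "finite I"
    and a: "\<And>i. i \<in> I \<Longrightarrow> a i \<in> germs X x" and C: "\<And>i. i \<in> I \<Longrightarrow> C i \<in> germs X x"
    and N: "nbhd X x N" and \<alpha>: "\<And>y u. y \<in> N \<Longrightarrow> u \<in> tangent X y \<Longrightarrow> \<alpha> y u = (\<Sum>i\<in>I. a i y * u (C i))"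
  shows "d1 X \<alpha> x v w = (\<Sum>i\<in>I. v (a i) * w (C i) - w (a i) * v (C i))"
proof -
  note xp = U_points[OF x]
  have "x \<in> N" using N by (simp add: nbhd_def)
  have main: "A x (\<lambda>y. \<alpha> y (B y)) = (\<Sum>i\<in>I. a i x * A x (\<lambda>y. B y (C i)) + B x (C i) * A x (a i))"
    if A: "vfield_near X x A" and B: "vfield_near X x B" for A B
  proof -
    obtain NB where NB: "nbhd X x NB" "\<And>y. y \<in> NB \<Longrightarrow> B y \<in> tangent X y"
      "\<And>y f. y \<in> NB \<Longrightarrow> f \<in> germs X y \<Longrightarrow> (\<lambda>z. B z f) \<in> germs X y"
      using B by (auto simp: vfield_near_def)
    have Ax: "A x \<in> tangent X x" using A by (auto simp: vfield_near_def nbhd_def)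
    have BC: "(\<lambda>z. B z (C i)) \<in> germs X x" if "i \<in> I" for i
      using NB C[OF that] by (auto simp: nbhd_def)
    have m: "(\<lambda>y. a i y * B y (C i)) \<in> germs X x" if "i \<in> I" for i
      using mult_germ[OF xp a BC] that by blast
    have "A x (\<lambda>y. \<alpha> y (B y)) = A x (\<lambda>y. \<Sum>i\<in>I. a i y * B y (C i))"
      by (rule tangent_cong[OF Ax sum_germ[OF xp \<open>finite I\<close> m] nbhd_Int[OF N NB(1)]])
        (use \<alpha> NB(2) in auto)
    also have "\<dots> = (\<Sum>i\<in>I. A x (\<lambda>y. a i y * B y (C i)))"
      by (rule tangent_sum[OF xp Ax \<open>finite I\<close> m])
    finally show ?thesis using tangent_mult[OF Ax a BC] by simp
  qed
  have val: "A x (\<lambda>y. \<alpha> y (B y)) - B x (\<lambda>y. \<alpha> y (A y)) - \<alpha> x (bracket X A B x) =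
      (\<Sum>i\<in>I. A x (a i) * B x (C i) - B x (a i) * A x (C i))"
    if A: "vfield_near X x A" and B: "vfield_near X x B" for A B
  proof -
    have "\<alpha> x (bracket X A B x) = (\<Sum>i\<in>I. a i x * (A x (\<lambda>y. B y (C i)) - B x (\<lambda>y. A y (C i))))"
      using \<alpha>[OF \<open>x \<in> N\<close> bracket_tangent[OF x A B]] C by (simp add: bracket_def)
    then show ?thesis
      unfolding main[OF A B] main[OF B A]
      by (simp add: sum_subtractf[symmetric] algebra_simps)
  qed
  obtain A B where AB: "vfield_near X x A" "vfield_near X x B" "A x = v" "B x = w"
    using coord_field_vfield[OF x] tangent_eq_coord_field[OF x v] tangent_eq_coord_field[OF x w] by metis
  show ?thesis
    unfolding d1_def
  proof (rule the_equality)
    show "\<forall>A B. vfield_near X x A \<and> vfield_near X x B \<and> A x = v \<and> B x = w \<longrightarrow>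
        (\<Sum>i\<in>I. v (a i) * w (C i) - w (a i) * v (C i)) =
        A x (\<lambda>y. \<alpha> y (B y)) - B x (\<lambda>y. \<alpha> y (A y)) - \<alpha> x (bracket X A B x)"
    proof (intro allI impI, elim conjE)
      fix A B assume "vfield_near X x A" "vfield_near X x B" "A x = v" "B x = w"
      then show "(\<Sum>i\<in>I. v (a i) * w (C i) - w (a i) * v (C i)) =
          A x (\<lambda>y. \<alpha> y (B y)) - B x (\<lambda>y. \<alpha> y (A y)) - \<alpha> x (bracket X A B x)"
        using val[of A B] by simp
    qed
    fix r assume "\<forall>A B. vfield_near X x A \<and> vfield_near X x B \<and> A x = v \<and> B x = w \<longrightarrow>
        r = A x (\<lambda>y. \<alpha> y (B y)) - B x (\<lambda>y. \<alpha> y (A y)) - \<alpha> x (bracket X A B x)"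
    with AB have "r = A x (\<lambda>y. \<alpha> y (B y)) - B x (\<lambda>y. \<alpha> y (A y)) - \<alpha> x (bracket X A B x)" by blast
    then show "r = (\<Sum>i\<in>I. v (a i) * w (C i) - w (a i) * v (C i))"
      using val[OF AB(1,2)] AB(3,4) by simp
  qed
qed

text \<open>The representation of a 1-form to which \<open>d1_eq\<close> applies, with the coordinates \<open>c\<close> as functions.\<close>

lemma form_eq_coords:
  assumes x: "x \<in> U" and u: "u \<in> tangent X x"
    and add: "\<And>u v. u \<in> tangent X x \<Longrightarrow> v \<in> tangent X x \<Longrightarrow> \<alpha> x (tadd u v) = \<alpha> x u + \<alpha> x v"
    and scale: "\<And>r v. v \<in> tangent X x \<Longrightarrow> \<alpha> x (tscale r v) = r * \<alpha> x v"
  shows "\<alpha> x u = (\<Sum>b\<in>Basis. \<alpha> x (coord_field b x) * u (\<lambda>y. c y \<bullet> b))"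
proof -
  have "linear (\<lambda>w. \<alpha> x (coord_field w x))"
    by (rule linearI) (simp_all add: coord_field_add[OF x] coord_field_scale[OF x] add scale coord_field_tangent[OF x])
  then have "\<alpha> x (coord_field (coords u) x) = (\<Sum>b\<in>Basis. u (\<lambda>y. c y \<bullet> b) * \<alpha> x (coord_field b x))"
    using linear_sum[of "\<lambda>w. \<alpha> x (coord_field w x)" "\<lambda>b. u (\<lambda>y. c y \<bullet> b) *\<^sub>R b" Basis]
      linear_scale[of "\<lambda>w. \<alpha> x (coord_field w x)"]
    unfolding coords_def by simp
  then show ?thesis using tangent_eq_coord_field[OF x u] by (simp add: mult.commute)
qed

end

section \<open>Manifolds, subspaces, quotients and products\<close>

text \<open>
  The orthogonal projection; being self-adjoint is what distinguishes it among the linear projections.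
\<close>

definition proj_onto :: "'a::euclidean_space set \<Rightarrow> 'a \<Rightarrow> 'a" where
  "proj_onto W = (SOME P. linear P \<and> range P \<subseteq> W \<and> (\<forall>w\<in>W. P w = w) \<and> (\<forall>p q. P p \<bullet> q = p \<bullet> P q))"

lemma
  assumes "subspace W"
  shows linear_proj_onto: "linear (proj_onto W)" and proj_onto_mem: "proj_onto W p \<in> W"
    and proj_onto_id: "w \<in> W \<Longrightarrow> proj_onto W w = w"
    and proj_onto_adjoint: "proj_onto W p \<bullet> q = p \<bullet> proj_onto W q"
proof -
  obtain B where B: "B \<subseteq> W" "pairwise orthogonal B" "\<And>x. x \<in> B \<Longrightarrow> norm x = 1" "independent B"
    "card B = dim W" "span B = W"
    using orthonormal_basis_subspace[OF assms] by blast
  have fin: "finite B" using B(4) independent_imp_finite by blast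
  define P where "P = (\<lambda>p. \<Sum>b\<in>B. (p \<bullet> b) *\<^sub>R b)"
  have "linear P" unfolding P_def
    by (rule linearI) (simp_all add: inner_add_left scaleR_add_left sum.distrib scaleR_sum_right)
  moreover have "P p \<in> W" for p
    unfolding P_def using B(1) assms by (auto intro!: subspace_sum subspace_scale)
  moreover have "P w = w" if "w \<in> W" for w
  proof -
    have orth: "b' \<bullet> b = (if b' = b then 1 else 0)" if "b \<in> B" "b' \<in> B" for b b'
      using B(2,3) that by (auto simp: pairwise_def orthogonal_def norm_eq_1)
    have "P b = b" if "b \<in> B" for b
    proof -
      have "P b = (\<Sum>b'\<in>B. (if b' = b then b else 0))"
        unfolding P_def using orth that by (intro sum.cong) (auto simp: inner_commute)
      then show ?thesis using fin that by simp
    qed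
    then show ?thesis
      using linear_eq_on_span[OF \<open>linear P\<close> linear_id, of B] that B(6) by auto
  qed
  moreover have "P p \<bullet> q = p \<bullet> P q" for p q
    unfolding P_def by (simp add: inner_sum_left inner_sum_right mult.commute inner_commute)
  ultimately have "\<exists>P. linear P \<and> range P \<subseteq> W \<and> (\<forall>w\<in>W. P w = w) \<and> (\<forall>p q. P p \<bullet> q = p \<bullet> P q)"
    by blast
  from someI_ex[OF this, folded proj_onto_def] show
    "linear (proj_onto W)" "proj_onto W p \<in> W" "w \<in> W \<Longrightarrow> proj_onto W w = w"
    "proj_onto W p \<bullet> q = p \<bullet> proj_onto W q" by blast+
qed

lemma chart_germ:
  assumes "chart W X U \<phi>" "x \<in> U" "open V" "\<phi> x \<in> V" "smooth_on V F"
  shows "(\<lambda>y. F (\<phi> y)) \<in> germs X x"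
  using assms unfolding chart_def nbhd_def by blast

lemma chart_germE:
  assumes "chart W X U \<phi>" "x \<in> U" "f \<in> germs X x"
  obtains V F U' where "open V" "\<phi> x \<in> V" "smooth_on V F" "nbhd X x U'" "\<And>y. y \<in> U' \<Longrightarrow> f y = F (\<phi> y)"
proof -
  have "\<exists>V F U'. open V \<and> \<phi> x \<in> V \<and> smooth_on V F \<and> nbhd X x U' \<and> (\<forall>y\<in>U'. f y = F (\<phi> y))"
    using assms unfolding chart_def by blast
  then show ?thesis using that by blast
qed

lemma manifold_germ_space:
  assumes "manifold W X" shows "germ_space X"
proof
  have ch: "\<exists>U \<phi>. x \<in> U \<and> chart W X U \<phi>" if "x \<in> points X" for x
    using assms that by (auto simp: manifold_def)
  fix x
  show "(\<lambda>y. r) \<in> germs X x" if "x \<in> points X" for r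
    using ch[OF that] chart_germ[of W X _ _ x UNIV "\<lambda>p. r"] smooth_on_const by auto
  show "h \<in> germs X x" if f: "f \<in> germs X x" and U: "nbhd X x U" and eq: "\<And>y. y \<in> U \<Longrightarrow> h y = f y" for f h U
  proof -
    obtain U0 \<phi> where c: "x \<in> U0" "chart W X U0 \<phi>" using ch nbhd_points[OF U] by blast
    obtain V F U' where *: "open V" "\<phi> x \<in> V" "smooth_on V F" "nbhd X x U'" "\<And>y. y \<in> U' \<Longrightarrow> f y = F (\<phi> y)"
      by (rule chart_germE[OF c(2,1) f], rule that)
    have "nbhd X x (U' \<inter> U)" using nbhd_Int[OF *(4) U] .
    moreover have "\<forall>y\<in>U' \<inter> U. h y = F (\<phi> y)" using eq *(5) by auto
    ultimately have "\<exists>V F U'. open V \<and> \<phi> x \<in> V \<and> smooth_on V F \<and> nbhd X x U' \<and> (\<forall>y\<in>U'. h y = F (\<phi> y))"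
      using * by blast
    then show ?thesis using c unfolding chart_def by blast
  qed
  note cong = this
  have bin: "(\<lambda>y. op (f y) (h y)) \<in> germs X x"
    if x: "x \<in> points X" and f: "f \<in> germs X x" and h: "h \<in> germs X x"
      and op: "\<And>V F H :: 'a \<Rightarrow> real. open V \<Longrightarrow> smooth_on V F \<Longrightarrow> smooth_on V H \<Longrightarrow> smooth_on V (\<lambda>p. op (F p) (H p))"
    for f h and op :: "real \<Rightarrow> real \<Rightarrow> real"
  proof -
    obtain U0 \<phi> where c: "x \<in> U0" "chart W X U0 \<phi>" using ch[OF x] by blast
    obtain V F U' where F: "open V" "\<phi> x \<in> V" "smooth_on V F" "nbhd X x U'" "\<And>y. y \<in> U' \<Longrightarrow> f y = F (\<phi> y)"
      by (rule chart_germE[OF c(2,1) f], rule that)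
    obtain V' H U'' where H: "open V'" "\<phi> x \<in> V'" "smooth_on V' H" "nbhd X x U''" "\<And>y. y \<in> U'' \<Longrightarrow> h y = H (\<phi> y)"
      by (rule chart_germE[OF c(2,1) h], rule that)
    have "smooth_on (V \<inter> V') (\<lambda>p. op (F p) (H p))"
      by (rule op) (use F H in \<open>auto intro: smooth_on_subset\<close>)
    then have "(\<lambda>y. op (F (\<phi> y)) (H (\<phi> y))) \<in> germs X x"
      using chart_germ[OF c(2,1), of "V \<inter> V'"] F H by auto
    then show ?thesis
      by (rule cong[OF _ nbhd_Int[OF F(4) H(4)]]) (use F(5) H(5) in auto)
  qed
  show "(\<lambda>y. f y + h y) \<in> germs X x" if "x \<in> points X" "f \<in> germs X x" "h \<in> germs X x" for f h
    by (rule bin[OF that]) (rule smooth_on_add)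
  show "(\<lambda>y. f y * h y) \<in> germs X x" if "x \<in> points X" "f \<in> germs X x" "h \<in> germs X x" for f h
    by (rule bin[OF that]) (rule smooth_on_mult)
qed

text \<open>A chart with values in \<open>W\<close>, inverted on a neighbourhood in the ambient space by means of the
  orthogonal projection onto \<open>W\<close>.\<close>

locale linear_chart = euclidean_retract X c \<kappa> U E
  for X :: "'m smooth_space" and c :: "'m \<Rightarrow> 'a::euclidean_space" and \<kappa> U E +
  fixes W :: "'a set"
  assumes subspaceW: "subspace W" and c_W: "y \<in> U \<Longrightarrow> c y \<in> W"
    and \<kappa>_U: "p \<in> E \<Longrightarrow> \<kappa> p \<in> U" and c\<kappa>: "p \<in> E \<Longrightarrow> c (\<kappa> p) = proj_onto W p"
    and \<kappa>_cont: "openin (topo X) T \<Longrightarrow> open {p \<in> E. \<kappa> p \<in> T}"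
begin

lemma \<kappa>_proj: "p \<in> E \<Longrightarrow> \<kappa> (proj_onto W p) = \<kappa> p"
  using \<kappa>c[OF \<kappa>_U] c\<kappa> by metis

lemma coords_W:
  assumes x: "x \<in> U" and v: "v \<in> tangent X x" shows "coords v \<in> W"
proof -
  have "coords v \<bullet> b = proj_onto W (coords v) \<bullet> b" for b
  proof -
    have "coords v \<bullet> b = v (\<lambda>y. c y \<bullet> b)" using tangent_inner[OF x v] by simp
    also have "\<dots> = v (\<lambda>y. c y \<bullet> proj_onto W b)"
      by (rule tangent_cong[OF v coord_germ[OF x] nbhd_U[OF x]])
        (metis c_W proj_onto_id[OF subspaceW] proj_onto_adjoint[OF subspaceW])
    also have "\<dots> = proj_onto W (coords v) \<bullet> b"
      using tangent_inner[OF x v] proj_onto_adjoint[OF subspaceW] by simp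
    finally show ?thesis .
  qed
  then have "coords v = proj_onto W (coords v)" by (metis vector_eq_rdot)
  then show ?thesis using proj_onto_mem[OF subspaceW] by metis
qed

text \<open>
  The inverse chart factors through the projection, so directions orthogonal to \<open>W\<close> give the zero vector.
\<close>

lemma coord_field_proj:
  assumes x: "x \<in> U" shows "coord_field (proj_onto W w) x = coord_field w x"
proof
  fix f
  show "coord_field (proj_onto W w) x f = coord_field w x f"
  proof (cases "f \<in> germs X x")
    case True
    let ?P = "proj_onto W"
    have Pc: "?P (c x) = c x" using proj_onto_id[OF subspaceW c_W[OF x]] .
    have D: "(?P has_derivative ?P) (at (c x))"
      by (rule bounded_linear_imp_has_derivative) (simp add: linear_linear linear_proj_onto[OF subspaceW])
    have "((\<lambda>p. (f \<circ> \<kappa>) (?P p)) has_derivative (\<lambda>w. coord_field (?P w) x f)) (at (c x))"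
      by (rule has_derivative_compose[OF D]) (simp only: Pc germ_derivative[OF x True])
    then have "(f \<circ> \<kappa> has_derivative (\<lambda>w. coord_field (?P w) x f)) (at (c x))"
      by (rule has_derivative_transform_within_open[OF _ openE cE[OF x]]) (simp add: \<kappa>_proj)
    from coord_field_eqI[OF x True this] show ?thesis by simp
  qed (simp add: coord_field_def)
qed

lemma coords_coord_field:
  assumes x: "x \<in> U" shows "coords (coord_field w x) = proj_onto W w"
proof -
  have "coord_field w x (\<lambda>y. c y \<bullet> b) = proj_onto W w \<bullet> b" for b
  proof (rule coord_field_eqI[OF x coord_germ[OF x]])
    have "((\<lambda>p. proj_onto W p \<bullet> b) has_derivative (\<lambda>w. proj_onto W w \<bullet> b)) (at (c x))"
      by (intro bounded_linear_imp_has_derivative bounded_linear_inner_left_comp)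
        (simp add: linear_linear linear_proj_onto[OF subspaceW])
    then show "((\<lambda>y. c y \<bullet> b) \<circ> \<kappa> has_derivative (\<lambda>w. proj_onto W w \<bullet> b)) (at (c x))"
      by (rule has_derivative_transform_within_open[OF _ openE cE[OF x]]) (simp add: c\<kappa>)
  qed
  then have "coords (coord_field w x) \<bullet> b = proj_onto W w \<bullet> b" for b
    using tangent_inner[OF x coord_field_tangent[OF x]] by metis
  then show ?thesis by (metis vector_eq_rdot)
qed

lemma tangent_coord_fun:
  assumes x: "x \<in> U" and v: "v \<in> tangent X x" and T: "open T" "c x \<in> T" and K: "smooth_on T K"
    and D: "(K has_derivative D) (at (c x))"
  shows "v (\<lambda>y. K (c y)) = D (coords v)"
proof -
  let ?P = "proj_onto W"
  have Pc: "?P (c x) = c x" using proj_onto_id[OF subspaceW c_W[OF x]] .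
  have DP: "(?P has_derivative ?P) (at (c x))"
    by (rule bounded_linear_imp_has_derivative) (simp add: linear_linear linear_proj_onto[OF subspaceW])
  have "((\<lambda>p. K (?P p)) has_derivative (\<lambda>w. D (?P w))) (at (c x))"
    by (rule has_derivative_compose[OF DP]) (simp only: Pc D)
  then have "((\<lambda>y. K (c y)) \<circ> \<kappa> has_derivative (\<lambda>w. D (?P w))) (at (c x))"
    by (rule has_derivative_transform_within_open[OF _ openE cE[OF x]]) (simp add: c\<kappa>)
  moreover have "(\<lambda>y. K (c y)) \<in> germs X x" using c_smooth[OF x T K] by (simp add: o_def)
  ultimately have "v (\<lambda>y. K (c y)) = D (?P (coords v))" using tangent_derivative[OF x v] by blast
  then show ?thesis using proj_onto_id[OF subspaceW coords_W[OF x v]] by simp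
qed

lemma continuous_map_\<kappa>: "continuous_map (top_of_set E) (topo X) \<kappa>"
  unfolding continuous_map_def
proof (intro conjI allI impI)
  show "\<kappa> \<in> topspace (top_of_set E) \<rightarrow> topspace (topo X)" using \<kappa>_points by auto
  fix T assume "openin (topo X) T"
  from \<kappa>_cont[OF this] show "openin (top_of_set E) {p \<in> topspace (top_of_set E). \<kappa> p \<in> T}"
    by (simp add: openin_open_eq[OF openE])
qed

lemma vector_germ_smooth:
  fixes F :: "'m \<Rightarrow> 'e::euclidean_space"
  assumes p: "p \<in> E" and F: "\<And>b. b \<in> Basis \<Longrightarrow> (\<lambda>y. F y \<bullet> b) \<in> germs X (\<kappa> p)"
  obtains V where "open V" "p \<in> V" "V \<subseteq> E" "vsmooth_on V (F \<circ> \<kappa>)"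
proof -
  have "\<exists>V. open V \<and> p \<in> V \<and> smooth_on V ((\<lambda>y. F y \<bullet> b) \<circ> \<kappa>)" if "b \<in> Basis" for b
    using \<kappa>_smooth[OF p F[OF that]] .
  then obtain V where V: "\<And>b. b \<in> Basis \<Longrightarrow> open (V b)" "\<And>b. b \<in> Basis \<Longrightarrow> p \<in> V b"
    "\<And>b. b \<in> Basis \<Longrightarrow> smooth_on (V b) (\<lambda>q. F (\<kappa> q) \<bullet> b)" unfolding o_def by metis
  show ?thesis
  proof (rule that[of "(\<Inter>b\<in>Basis. V b) \<inter> E"])
    show "open ((\<Inter>b\<in>Basis. V b) \<inter> E)" using V(1) openE by (intro open_Int open_INT) auto
    show "vsmooth_on ((\<Inter>b\<in>Basis. V b) \<inter> E) (F \<circ> \<kappa>)"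
      unfolding vsmooth_on_def o_def using V(3) by (auto intro: smooth_on_subset)
  qed (use p V(2) in auto)
qed

end

lemma manifold_linear_chart:
  fixes W :: "'a::euclidean_space set"
  assumes m: "manifold W X" and x: "x \<in> points X"
  obtains c \<kappa> U E where "x \<in> U" "linear_chart X c \<kappa> U E W"
proof -
  interpret germ_space X by (rule manifold_germ_space[OF m])
  have sW: "subspace W" using m by (simp add: manifold_def)
  obtain U \<phi> where xU: "x \<in> U" and ch: "chart W X U \<phi>" using m x by (auto simp: manifold_def)
  have oU: "openin (topo X) U" and oW: "openin (top_of_set W) (\<phi> ` U)"
    and hom: "homeomorphic_map (subtopology (topo X) U) (top_of_set (\<phi> ` U)) \<phi>"
    using ch by (auto simp: chart_def)
  have tU: "topspace (subtopology (topo X) U) = U" using oU openin_subset by fastforce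
  have inj: "inj_on \<phi> U" using homeomorphic_imp_injective_map[OF hom] tU by simp
  let ?P = "proj_onto W"
  note linP = linear_proj_onto[OF sW]
  have contP: "continuous_on UNIV ?P" using linear_continuous_on linear_linear linP by blast
  have pre: "open (?P -` A)" if A: "openin (top_of_set W) A" for A
  proof -
    obtain T where T: "open T" "A = W \<inter> T" using A unfolding openin_open by blast
    have "?P -` A = ?P -` T" using T(2) proj_onto_mem[OF sW] by auto
    then show ?thesis using open_vimage[OF T(1) contP] by simp
  qed
  define \<kappa> where "\<kappa> = inv_into U \<phi> \<circ> ?P"
  define E where "E = ?P -` (\<phi> ` U)"
  have \<phi>W: "\<phi> y \<in> W" if "y \<in> U" for y using oW that openin_subset by fastforce
  have k1: "\<kappa> p \<in> U" "\<phi> (\<kappa> p) = ?P p" if "p \<in> E" for p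
    using that by (auto simp: E_def \<kappa>_def inv_into_into f_inv_into_f)
  have k2: "\<kappa> (\<phi> y) = y" if "y \<in> U" for y
    using that inj proj_onto_id[OF sW \<phi>W] by (simp add: \<kappa>_def)
  have kc: "open {p \<in> E. \<kappa> p \<in> T}" if T: "openin (topo X) T" for T
  proof -
    have "openin (subtopology (topo X) U) (T \<inter> U)" using T by (simp add: openin_subtopology_Int)
    then have "openin (top_of_set (\<phi> ` U)) (\<phi> ` (T \<inter> U))"
      using homeomorphic_imp_open_map[OF hom] by (simp add: open_map_def)
    then have "openin (top_of_set W) (\<phi> ` (T \<inter> U))" using openin_trans[OF _ oW] by blast
    moreover have "{p \<in> E. \<kappa> p \<in> T} = ?P -` (\<phi> ` (T \<inter> U))"
    proof (intro equalityI subsetI)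
      fix p assume "p \<in> {p \<in> E. \<kappa> p \<in> T}"
      then have "\<kappa> p \<in> T \<inter> U" "\<phi> (\<kappa> p) = ?P p" using k1 by auto
      then show "p \<in> ?P -` (\<phi> ` (T \<inter> U))" by (metis imageI vimageI)
    next
      fix p assume "p \<in> ?P -` (\<phi> ` (T \<inter> U))"
      then obtain y where y: "y \<in> T" "y \<in> U" "?P p = \<phi> y" by auto
      then have "\<kappa> p = y" using inj by (simp add: \<kappa>_def)
      then show "p \<in> {p \<in> E. \<kappa> p \<in> T}" using y by (auto simp: E_def)
    qed
    ultimately show ?thesis using pre by simp
  qed
  have "linear_chart X \<phi> \<kappa> U E W"
  proof
    show "openin (topo X) U" by fact
    show "open E" unfolding E_def by (rule pre[OF oW])
    show "\<phi> y \<in> E" if "y \<in> U" for y using that proj_onto_id[OF sW \<phi>W] by (simp add: E_def)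
    show "\<kappa> (\<phi> y) = y" if "y \<in> U" for y by (rule k2[OF that])
    show "\<kappa> p \<in> points X" if "p \<in> E" for p using k1[OF that] openin_subset[OF oU] by blast
    show "openin (topo X) {y \<in> U. \<phi> y \<in> V}" if V: "open V" for V
    proof -
      have "openin (top_of_set (\<phi> ` U)) (\<phi> ` U \<inter> V)" using V by (simp add: openin_open_Int)
      then have "openin (subtopology (topo X) U) {y \<in> U. \<phi> y \<in> \<phi> ` U \<inter> V}"
        using openin_continuous_map_preimage[OF homeomorphic_imp_continuous_map[OF hom]] unfolding tU by blast
      then have "openin (topo X) {y \<in> U. \<phi> y \<in> \<phi> ` U \<inter> V}" using openin_trans_full oU by blast
      moreover have "{y \<in> U. \<phi> y \<in> \<phi> ` U \<inter> V} = {y \<in> U. \<phi> y \<in> V}" by auto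
      ultimately show ?thesis by simp
    qed
    show "F \<circ> \<phi> \<in> germs X y" if "y \<in> U" "open V" "\<phi> y \<in> V" "smooth_on V F" for y V F
      using chart_germ[OF ch that] by (simp add: o_def)
    show "\<exists>V. open V \<and> p \<in> V \<and> smooth_on V (f \<circ> \<kappa>)" if p: "p \<in> E" and f: "f \<in> germs X (\<kappa> p)" for p f
    proof -
      obtain V F U' where *: "open V" "\<phi> (\<kappa> p) \<in> V" "smooth_on V F" "nbhd X (\<kappa> p) U'" "\<And>y. y \<in> U' \<Longrightarrow> f y = F (\<phi> y)"
        by (rule chart_germE[OF ch k1(1)[OF p] f], rule that)
      define V' where "V' = {p \<in> E. \<kappa> p \<in> U'} \<inter> ?P -` V"
      have oV: "open V'" unfolding V'_def using *(1,4) kc open_vimage[OF *(1) contP] by (auto simp: nbhd_def)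
      have "smooth_on V' (\<lambda>q. F (?P q))"
        by (rule smooth_on_compose[OF oV _ *(3) vsmooth_on_linear[OF oV linP]]) (auto simp: V'_def)
      then have "smooth_on V' (f \<circ> \<kappa>)"
        by (rule iffD1[OF smooth_on_cong[OF oV], rotated]) (auto simp: V'_def *(5) k1)
      moreover have "p \<in> V'" using p *(2,4) k1[OF p] by (simp add: V'_def nbhd_def)
      ultimately show ?thesis using oV by blast
    qed
  qed (use sW \<phi>W k1 kc in auto)
  then show ?thesis using that xU by blast
qed

lemma points_subspace [simp]: "points (smooth_subspace X P) = points X \<inter> P"
  by (simp add: smooth_subspace_def)

lemma germs_subspace: "f \<in> germs (smooth_subspace X P) x \<longleftrightarrow>
    (\<exists>F\<in>germs X x. \<exists>U. nbhd X x U \<and> (\<forall>y\<in>U \<inter> P. f y = F y))"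
  by (simp add: smooth_subspace_def)

lemma germ_in_subspace: "f \<in> germs X x \<Longrightarrow> x \<in> points X \<Longrightarrow> f \<in> germs (smooth_subspace X P) x"
  unfolding germs_subspace nbhd_def by (metis openin_topspace)

lemma nbhd_subspace: "nbhd (smooth_subspace X P) x U \<longleftrightarrow> (\<exists>T. nbhd X x T \<and> x \<in> P \<and> U = T \<inter> P)"
  by (auto simp: nbhd_def smooth_subspace_def openin_subtopology)

lemma germ_space_subspace:
  assumes "germ_space X" shows "germ_space (smooth_subspace X P)"
proof
  interpret germ_space X by fact
  fix x
  show "(\<lambda>y. r) \<in> germs (smooth_subspace X P) x" if "x \<in> points (smooth_subspace X P)" for r
    using that by (auto intro: germ_in_subspace const_germ)
  have bin: "(\<lambda>y. op (f y) (h y)) \<in> germs (smooth_subspace X P) x"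
    if f: "f \<in> germs (smooth_subspace X P) x" and h: "h \<in> germs (smooth_subspace X P) x"
      and op: "\<And>F H. F \<in> germs X x \<Longrightarrow> H \<in> germs X x \<Longrightarrow> (\<lambda>y. op (F y) (H y)) \<in> germs X x"
    for f h and op :: "real \<Rightarrow> real \<Rightarrow> real"
  proof -
    obtain F U where F: "F \<in> germs X x" "nbhd X x U" "\<forall>y\<in>U \<inter> P. f y = F y" using f germs_subspace by metis
    obtain H U' where H: "H \<in> germs X x" "nbhd X x U'" "\<forall>y\<in>U' \<inter> P. h y = H y" using h germs_subspace by metis
    have "\<forall>y\<in>(U \<inter> U') \<inter> P. op (f y) (h y) = op (F y) (H y)" using F H by auto
    with nbhd_Int[OF F(2) H(2)] have "\<exists>U. nbhd X x U \<and> (\<forall>y\<in>U \<inter> P. op (f y) (h y) = op (F y) (H y))"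
      by blast
    then show ?thesis unfolding germs_subspace by (rule bexI[OF _ op[OF F(1) H(1)]])
  qed
  show "(\<lambda>y. f y + h y) \<in> germs (smooth_subspace X P) x"
    if "x \<in> points (smooth_subspace X P)" "f \<in> germs (smooth_subspace X P) x" "h \<in> germs (smooth_subspace X P) x" for f h
    using bin[OF that(2,3), of "(+)"] add_germ that(1) by simp
  show "(\<lambda>y. f y * h y) \<in> germs (smooth_subspace X P) x"
    if "x \<in> points (smooth_subspace X P)" "f \<in> germs (smooth_subspace X P) x" "h \<in> germs (smooth_subspace X P) x" for f h
    using bin[OF that(2,3), of "(*)"] mult_germ that(1) by simp
  show "h \<in> germs (smooth_subspace X P) x"
    if f: "f \<in> germs (smooth_subspace X P) x" and U: "nbhd (smooth_subspace X P) x U"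
      and eq: "\<And>y. y \<in> U \<Longrightarrow> h y = f y" for f h U
  proof -
    obtain T where T: "nbhd X x T" "U = T \<inter> P" using U nbhd_subspace by metis
    obtain F U' where F: "F \<in> germs X x" "nbhd X x U'" "\<forall>y\<in>U' \<inter> P. f y = F y" using f germs_subspace by metis
    have "\<forall>y\<in>(T \<inter> U') \<inter> P. h y = F y" using F eq T by auto
    then show ?thesis unfolding germs_subspace using F(1) nbhd_Int[OF T(1) F(2)] by blast
  qed
qed

lemma points_quotient [simp]: "points (smooth_quotient X \<pi>) = \<pi> ` points X"
proof -
  have "openin (quotient_topology (topo X) \<pi>) (\<pi> ` points X)"
  proof -
    have "{x \<in> points X. \<pi> x \<in> \<pi> ` points X} = points X" by auto
    then show ?thesis unfolding openin_quotient_topology by simp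
  qed
  then show ?thesis
    unfolding smooth_quotient_def
    by (auto simp: topspace_def openin_quotient_topology)
qed

lemma germs_quotient: "h \<in> germs (smooth_quotient X \<pi>) n \<longleftrightarrow>
    (\<forall>x\<in>points X. \<pi> x = n \<longrightarrow> h \<circ> \<pi> \<in> germs X x)"
  by (simp add: smooth_quotient_def)

lemma openin_quotient: "openin (topo (smooth_quotient X \<pi>)) V \<longleftrightarrow>
    V \<subseteq> \<pi> ` points X \<and> openin (topo X) {x \<in> points X. \<pi> x \<in> V}"
  by (simp add: smooth_quotient_def openin_quotient_topology)

lemma germ_space_quotient:
  assumes "germ_space X" shows "germ_space (smooth_quotient X \<pi>)"
proof
  interpret germ_space X by fact
  fix n
  show "(\<lambda>y. r) \<in> germs (smooth_quotient X \<pi>) n" for r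
    by (auto simp: germs_quotient o_def intro: const_germ)
  show "(\<lambda>y. f y + h y) \<in> germs (smooth_quotient X \<pi>) n"
    if "f \<in> germs (smooth_quotient X \<pi>) n" "h \<in> germs (smooth_quotient X \<pi>) n" for f h
    using that by (auto simp: germs_quotient o_def intro: add_germ)
  show "(\<lambda>y. f y * h y) \<in> germs (smooth_quotient X \<pi>) n"
    if "f \<in> germs (smooth_quotient X \<pi>) n" "h \<in> germs (smooth_quotient X \<pi>) n" for f h
    using that by (auto simp: germs_quotient o_def intro: mult_germ)
  show "h \<in> germs (smooth_quotient X \<pi>) n"
    if f: "f \<in> germs (smooth_quotient X \<pi>) n" and U: "nbhd (smooth_quotient X \<pi>) n U"
      and eq: "\<And>y. y \<in> U \<Longrightarrow> h y = f y" for f h U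
    unfolding germs_quotient
  proof (intro ballI impI)
    fix x assume x: "x \<in> points X" "\<pi> x = n"
    have nb: "nbhd X x {x \<in> points X. \<pi> x \<in> U}" using U x by (simp add: nbhd_def openin_quotient)
    have "f \<circ> \<pi> \<in> germs X x" using f x by (simp add: germs_quotient)
    then show "h \<circ> \<pi> \<in> germs X x" by (rule cong_germ[OF _ nb]) (simp add: eq)
  qed
qed

lemma product_germE:
  assumes "f \<in> germs (smooth_product V W S M) (h, m)"
  obtains U \<phi> U' \<psi> Q F A B where "chart V S U \<phi>" "h \<in> U" "chart W M U' \<psi>" "m \<in> U'"
    "open Q" "(\<phi> h, \<psi> m) \<in> Q" "smooth_on Q F" "nbhd S h A" "nbhd M m B"
    "\<And>x y. x \<in> A \<Longrightarrow> y \<in> B \<Longrightarrow> f (x, y) = F (\<phi> x, \<psi> y)"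
proof -
  have "\<exists>U \<phi> U' \<psi> Q F A B. chart V S U \<phi> \<and> h \<in> U \<and> chart W M U' \<psi> \<and> m \<in> U' \<and>
      open Q \<and> (\<phi> h, \<psi> m) \<in> Q \<and> smooth_on Q F \<and> nbhd S h A \<and> nbhd M m B \<and>
      (\<forall>x'\<in>A. \<forall>y'\<in>B. f (x', y') = F (\<phi> x', \<psi> y'))"
    using assms unfolding smooth_product_def by simp
  then show ?thesis by (elim exE conjE) (rule that, (assumption | simp)+)
qed

lemma product_germ_fst:
  fixes V :: "'b::euclidean_space set" and W :: "'a::euclidean_space set"
  assumes S: "germ_space S" and f: "f \<in> germs (smooth_product V W S M) (h, m)"
  shows "(\<lambda>k. f (k, m)) \<in> germs S h"
proof -
  obtain U \<phi> U' \<psi> Q F A B where *: "chart V S U \<phi>" "h \<in> U" "chart W M U' \<psi>" "m \<in> U'"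
    "open Q" "(\<phi> h, \<psi> m) \<in> Q" "smooth_on Q F" "nbhd S h A" "nbhd M m B"
    "\<And>x y. x \<in> A \<Longrightarrow> y \<in> B \<Longrightarrow> f (x, y) = F (\<phi> x, \<psi> y)"
    by (rule product_germE[OF f], rule that)
  let ?Q = "(\<lambda>p. (p, \<psi> m)) -` Q"
  have o: "open ?Q" by (intro open_vimage *(5) continuous_intros)
  have "vsmooth_on ?Q (\<lambda>p. (p, \<psi> m))"
    by (rule vsmooth_on_Pair[OF vsmooth_on_linear[OF o linear_id[unfolded id_def]] vsmooth_on_const])
  then have "smooth_on ?Q (\<lambda>p. F (p, \<psi> m))"
    by (rule smooth_on_compose[where F = "\<lambda>p. (p, \<psi> m)", OF o _ *(7), rotated]) auto
  then have "(\<lambda>k. F (\<phi> k, \<psi> m)) \<in> germs S h" using chart_germ[OF *(1,2) o] *(6) by simp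
  then show ?thesis
    by (rule germ_space.cong_germ[OF S _ *(8)]) (use *(9,10) in \<open>auto simp: nbhd_def\<close>)
qed

lemma product_germ_snd:
  fixes V :: "'b::euclidean_space set" and W :: "'a::euclidean_space set"
  assumes M: "germ_space M" and f: "f \<in> germs (smooth_product V W S M) (h, m)"
  shows "(\<lambda>y. f (h, y)) \<in> germs M m"
proof -
  obtain U \<phi> U' \<psi> Q F A B where *: "chart V S U \<phi>" "h \<in> U" "chart W M U' \<psi>" "m \<in> U'"
    "open Q" "(\<phi> h, \<psi> m) \<in> Q" "smooth_on Q F" "nbhd S h A" "nbhd M m B"
    "\<And>x y. x \<in> A \<Longrightarrow> y \<in> B \<Longrightarrow> f (x, y) = F (\<phi> x, \<psi> y)"
    by (rule product_germE[OF f], rule that)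
  let ?Q = "(\<lambda>p. (\<phi> h, p)) -` Q"
  have o: "open ?Q" by (intro open_vimage *(5) continuous_intros)
  have "vsmooth_on ?Q (\<lambda>p. (\<phi> h, p))"
    by (rule vsmooth_on_Pair[OF vsmooth_on_const vsmooth_on_linear[OF o linear_id[unfolded id_def]]])
  then have "smooth_on ?Q (\<lambda>p. F (\<phi> h, p))"
    by (rule smooth_on_compose[where F = "\<lambda>p. (\<phi> h, p)", OF o _ *(7), rotated]) auto
  then have "(\<lambda>y. F (\<phi> h, \<psi> y)) \<in> germs M m" using chart_germ[OF *(3,4) o] *(6) by simp
  then show ?thesis
    by (rule germ_space.cong_germ[OF M _ *(9)]) (use *(8,10) in \<open>auto simp: nbhd_def\<close>)
qed

text \<open>
  Germs on a product are smooth functions of some pair of charts. The pairs of coordinates used here are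
  arbitrary, so the change of coordinates in each factor enters.
\<close>

lemma product_germ_coords:
  fixes V :: "'b::euclidean_space set" and W :: "'a::euclidean_space set"
  assumes S: "linear_chart S cS \<kappa>S US ES V'" and M: "linear_chart M c \<kappa> UM E W'"
    and p: "p \<in> ES" and q: "q \<in> E" and f: "f \<in> germs (smooth_product V W S M) (\<kappa>S p, \<kappa> q)"
  obtains Q where "open Q" "(p, q) \<in> Q" "Q \<subseteq> ES \<times> E" "smooth_on Q (\<lambda>(p, q). f (\<kappa>S p, \<kappa> q))"
proof -
  interpret S: linear_chart S cS \<kappa>S US ES V' by fact
  interpret M: linear_chart M c \<kappa> UM E W' by fact
  obtain U \<phi> U' \<psi> Q F A B where *: "chart V S U \<phi>" "\<kappa>S p \<in> U" "chart W M U' \<psi>" "\<kappa> q \<in> U'"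
    "open Q" "(\<phi> (\<kappa>S p), \<psi> (\<kappa> q)) \<in> Q" "smooth_on Q F" "nbhd S (\<kappa>S p) A" "nbhd M (\<kappa> q) B"
    "\<And>x y. x \<in> A \<Longrightarrow> y \<in> B \<Longrightarrow> f (x, y) = F (\<phi> x, \<psi> y)"
    by (rule product_germE[OF f], rule that)
  have g1: "(\<lambda>y. \<phi> y \<bullet> b) \<in> germs S (\<kappa>S p)" for b
    using chart_germ[OF *(1,2) open_UNIV _ smooth_on_inner[OF open_UNIV]] by simp
  obtain V1 where V1: "open V1" "p \<in> V1" "V1 \<subseteq> ES" "vsmooth_on V1 (\<phi> \<circ> \<kappa>S)"
    by (rule S.vector_germ_smooth[OF p g1], rule that)
  have g2: "(\<lambda>y. \<psi> y \<bullet> b) \<in> germs M (\<kappa> q)" for b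
    using chart_germ[OF *(3,4) open_UNIV _ smooth_on_inner[OF open_UNIV]] by simp
  obtain V2 where V2: "open V2" "q \<in> V2" "V2 \<subseteq> E" "vsmooth_on V2 (\<psi> \<circ> \<kappa>)"
    by (rule M.vector_germ_smooth[OF q g2], rule that)
  define A' where "A' = V1 \<inter> {p \<in> ES. \<kappa>S p \<in> A}"
  define B' where "B' = V2 \<inter> {q \<in> E. \<kappa> q \<in> B}"
  have oA: "open A'" "open B'" unfolding A'_def B'_def
    using V1(1) V2(1) S.\<kappa>_cont M.\<kappa>_cont *(8,9) by (auto simp: nbhd_def)
  define T where "T = (\<lambda>z. (\<phi> (\<kappa>S (fst z)), \<psi> (\<kappa> (snd z))))"
  note oAB = open_Times[OF oA]
  have T1: "vsmooth_on (A' \<times> B') (\<lambda>z. \<phi> (\<kappa>S (fst z)))"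
    by (rule vsmooth_on_compose[where f = "\<lambda>p. \<phi> (\<kappa>S p)" and F = fst, OF oAB _ V1(4)[unfolded o_def] vsmooth_on_linear[OF oAB linear_fst]])
      (auto simp: A'_def)
  have T2: "vsmooth_on (A' \<times> B') (\<lambda>z. \<psi> (\<kappa> (snd z)))"
    by (rule vsmooth_on_compose[where f = "\<lambda>p. \<psi> (\<kappa> p)" and F = snd, OF oAB _ V2(4)[unfolded o_def] vsmooth_on_linear[OF oAB linear_snd]])
      (auto simp: B'_def)
  have T: "vsmooth_on (A' \<times> B') T" unfolding T_def by (rule vsmooth_on_Pair[OF T1 T2])
  define Q' where "Q' = (A' \<times> B') \<inter> T -` Q"
  have oQ: "open Q'" unfolding Q'_def
    using continuous_open_preimage[OF vsmooth_on_continuous[OF T] oAB *(5)] .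
  have "smooth_on Q' (\<lambda>z. F (T z))"
    by (rule smooth_on_compose[where F = T and f = F, OF oQ _ *(7) vsmooth_on_subset[OF T]]) (auto simp: Q'_def)
  moreover have "(\<lambda>(p, q). f (\<kappa>S p, \<kappa> q)) z = F (T z)" if "z \<in> Q'" for z
    using that *(10) by (cases z) (simp add: Q'_def A'_def B'_def T_def)
  ultimately have "smooth_on Q' (\<lambda>(p, q). f (\<kappa>S p, \<kappa> q))"
    using smooth_on_cong[OF oQ, of "\<lambda>(p, q). f (\<kappa>S p, \<kappa> q)" "\<lambda>z. F (T z)"] by blast
  moreover have "(p, q) \<in> Q'" using V1 V2 p q *(6,8,9) by (simp add: Q'_def A'_def B'_def T_def nbhd_def)
  moreover have "Q' \<subseteq> ES \<times> E" by (auto simp: Q'_def A'_def B'_def)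
  ultimately show ?thesis using that oQ by blast
qed

section \<open>Smooth retractions onto zero sets\<close>

text \<open>
  The retraction moves \<open>p\<close> to a solution of \<open>N = 0\<close> in the affine space through \<open>p\<close> parallel to the range
  of \<open>L\<close>. The map \<open>N\<close> takes values in the range of the projection \<open>Pr\<close>
  and is a submersion onto that range. Adding \<open>z - Pr z\<close> to the equation turns the resulting system into one to which
  the implicit function theorem applies.

  The last conclusion identifies the tangent space of the zero set, since a kernel vector is
  the velocity of its image under \<open>R\<close>.
\<close>

lemma submersion_retraction:
  fixes N :: "'a::euclidean_space \<Rightarrow> 'z::euclidean_space" and L :: "'z \<Rightarrow> 'a"
  assumes "open VN" and N: "vsmooth_on VN N" and p0: "p0 \<in> VN" "N p0 = 0"
    and Pr: "linear Pr" "\<And>v. Pr (Pr v) = Pr v" "\<And>p. p \<in> VN \<Longrightarrow> Pr (N p) = N p" and L: "linear L"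
    and inj: "\<And>v. Pr v = v \<Longrightarrow> frechet_derivative N (at p0) (L v) = 0 \<Longrightarrow> v = 0"
  obtains X R where "open X" "p0 \<in> X" "vsmooth_on X R" "R p0 = p0"
    "\<And>p. p \<in> X \<Longrightarrow> R p \<in> VN" "\<And>p. p \<in> X \<Longrightarrow> N (R p) = 0" "\<And>p. p \<in> X \<Longrightarrow> N p = 0 \<Longrightarrow> R p = p"
    "\<And>w. frechet_derivative N (at p0) w = 0 \<Longrightarrow> frechet_derivative R (at p0) w = w"
proof -
  let ?T = "\<lambda>q :: 'z \<times> 'a. snd q + L (fst q)"
  let ?DN = "frechet_derivative N (at p0)"
  have linT: "linear ?T" using L by (simp add: linear_iff algebra_simps)
  have linPr: "linear (\<lambda>q :: 'z \<times> 'a. fst q - Pr (fst q))" using Pr(1) by (simp add: linear_iff algebra_simps)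
  have DN: "(N has_derivative ?DN) (at p0)" by (rule vsmooth_on_derivative[OF N p0(1)])
  then have linDN: "linear ?DN" using has_derivative_linear by blast
  define Q where "Q = ?T -` VN"
  have oQ: "open Q" unfolding Q_def
    by (rule open_vimage[OF \<open>open VN\<close>]) (use linT linear_continuous_on linear_linear in blast)
  (* The two summands lie in complementary subspaces, so a zero of F is a common zero of both. *)
  define F where "F = (\<lambda>q. N (?T q) + (fst q - Pr (fst q)))"
  have F: "vsmooth_on Q F" unfolding F_def
  proof (rule vsmooth_on_add[OF oQ _ vsmooth_on_linear[OF oQ linPr]])
    show "vsmooth_on Q (\<lambda>q. N (?T q))"
      by (rule vsmooth_on_compose[where f = N and F = ?T, OF oQ _ N vsmooth_on_linear[OF oQ linT]]) (auto simp: Q_def)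
  qed
  have bl: "bounded_linear ?T" "bounded_linear (\<lambda>q :: 'z \<times> 'a. fst q - Pr (fst q))"
    using linT linPr linear_linear by blast+
  have DF: "(F has_derivative (\<lambda>q. ?DN (?T q) + (fst q - Pr (fst q)))) (at (0, p0))"
    unfolding F_def
  proof (rule has_derivative_add[OF _ bounded_linear_imp_has_derivative[OF bl(2)]])
    show "((\<lambda>q. N (?T q)) has_derivative (\<lambda>q. ?DN (?T q))) (at (0, p0))"
      by (rule has_derivative_compose[where f = ?T, OF bounded_linear_imp_has_derivative[OF bl(1)]])
        (simp add: linear_0[OF L] DN)
  qed
  have PrDN: "Pr (?DN w) = ?DN w" for w
  proof -
    have "((\<lambda>p. Pr (N p)) has_derivative (\<lambda>w. Pr (?DN w))) (at p0)"
      by (rule has_derivative_compose[OF DN bounded_linear_imp_has_derivative]) (use Pr(1) linear_linear in blast)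
    then have "(N has_derivative (\<lambda>w. Pr (?DN w))) (at p0)"
      by (rule has_derivative_transform_within_open[OF _ \<open>open VN\<close> p0(1)]) (simp add: Pr)
    then show ?thesis using has_derivative_unique[OF DN] by metis
  qed
  have inj': "v = 0" if "?DN (L v) + (v - Pr v) = 0" for v
  proof -
    have "Pr (?DN (L v) + (v - Pr v)) = 0" using that linear_0[OF Pr(1)] by simp
    then have "?DN (L v) = 0" using PrDN Pr by (simp add: linear_add linear_diff)
    then show ?thesis using inj[of v] that by simp
  qed
  have F0: "F (0, p0) = 0" using p0 by (simp add: F_def linear_0[OF L] linear_0[OF Pr(1)])
  have Q0: "(0, p0) \<in> Q" using p0 by (simp add: Q_def linear_0[OF L])
  have inj2: "v = 0" if "frechet_derivative F (at (0, p0)) (v, 0) = 0" for v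
    using inj'[of v] that frechet_derivative_at[OF DF, symmetric] by simp
  obtain Z X h where h: "open Z" "open X" "0 \<in> Z" "p0 \<in> X" "Z \<times> X \<subseteq> Q" "vsmooth_on X h" "h ` X \<subseteq> Z"
    "\<And>z x. z \<in> Z \<Longrightarrow> x \<in> X \<Longrightarrow> F (z, x) = 0 \<longleftrightarrow> z = h x"
    by (rule smooth_implicit_function[OF oQ F Q0 F0 inj2], assumption, rule that)
  have h0: "h p0 = 0" using h(8)[OF h(3,4)] F0 by simp
  have Fh: "F (h p, p) = 0" if "p \<in> X" for p using h(7,8) that by blast
  define R where "R = (\<lambda>p. p + L (h p))"
  have R: "vsmooth_on X R" unfolding R_def
    by (intro vsmooth_on_add vsmooth_on_linear_compose[OF _ L] h vsmooth_on_linear linear_id[unfolded id_def])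
  show ?thesis
  proof (rule that[OF h(2,4) R])
    show "R p0 = p0" by (simp add: R_def h0 linear_0[OF L])
    show "R p \<in> VN" if "p \<in> X" for p
    proof -
      have "(h p, p) \<in> Q" using h(5,7) that by blast
      then show ?thesis by (simp add: Q_def R_def)
    qed
    then show "N (R p) = 0" if "p \<in> X" for p
    proof -
      have e: "N (R p) + (h p - Pr (h p)) = 0" using Fh[OF that] by (simp add: F_def R_def)
      then have "Pr (N (R p) + (h p - Pr (h p))) = 0" using linear_0[OF Pr(1)] by simp
      then show ?thesis using Pr \<open>p \<in> X \<Longrightarrow> R p \<in> VN\<close> that by (simp add: linear_add linear_diff)
    qed
    show "R p = p" if "p \<in> X" "N p = 0" for p
    proof -
      have "F (0, p) = 0" using that by (simp add: F_def linear_0[OF L] linear_0[OF Pr(1)])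
      then have "h p = 0" using h(8)[OF h(3) that(1)] by simp
      then show ?thesis by (simp add: R_def linear_0[OF L])
    qed
    fix w assume w: "?DN w = 0"
    let ?Dh = "frechet_derivative h (at p0)"
    have Dh: "(h has_derivative ?Dh) (at p0)" by (rule vsmooth_on_derivative[OF h(6,4)])
    have "((\<lambda>p. F (h p, p)) has_derivative (\<lambda>w. ?DN (?T (?Dh w, w)) + (fst (?Dh w, w) - Pr (fst (?Dh w, w))))) (at p0)"
      by (rule has_derivative_compose[OF has_derivative_Pair[OF Dh has_derivative_ident]]) (simp only: h0 DF)
    then have "((\<lambda>p. 0) has_derivative (\<lambda>w. ?DN (?T (?Dh w, w)) + (fst (?Dh w, w) - Pr (fst (?Dh w, w))))) (at p0)"
      by (rule has_derivative_transform_within_open[OF _ h(2,4)]) (simp add: Fh)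
    then have "(\<lambda>w. ?DN (?T (?Dh w, w)) + (fst (?Dh w, w) - Pr (fst (?Dh w, w)))) = (\<lambda>w. 0)"
      using has_derivative_unique has_derivative_const by blast
    then have "?DN (?T (?Dh w, w)) + (fst (?Dh w, w) - Pr (fst (?Dh w, w))) = 0" by metis
    then have "?DN (L (?Dh w)) + (?Dh w - Pr (?Dh w)) = 0" using w linDN by (simp add: linear_add)
    then have "?Dh w = 0" by (rule inj')
    moreover have "(R has_derivative (\<lambda>w. w + L (?Dh w))) (at p0)" unfolding R_def
      by (intro has_derivative_add has_derivative_ident has_derivative_compose[OF Dh bounded_linear_imp_has_derivative])
        (use L linear_linear in blast)
    ultimately show "frechet_derivative R (at p0) w = w"
      using frechet_derivative_at[of R "\<lambda>w. w + L (?Dh w)" p0, symmetric] by (simp add: linear_0[OF L])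
  qed
qed

section \<open>Tangent vectors of a subspace\<close>

context germ_space
begin

text \<open>
  The derivations that descend to germs of functions on \<open>P\<close>.
\<close>

definition kills_on :: "'m set \<Rightarrow> 'm \<Rightarrow> 'm tvec \<Rightarrow> bool" where
  "kills_on P x t \<longleftrightarrow> (\<forall>f\<in>germs X x. (\<exists>U. nbhd X x U \<and> (\<forall>y\<in>U \<inter> P. f y = 0)) \<longrightarrow> t f = 0)"

lemma tangent_incl_eq:
  assumes "x \<in> points X"
  shows "tangent_incl X P x s = (\<lambda>f. if f \<in> germs X x then s f else 0)"
  by (auto simp: tangent_incl_def differential_def o_def fun_eq_iff)

lemma inj_on_tangent_incl:
  assumes x: "x \<in> points X" "x \<in> P"
  shows "inj_on (tangent_incl X P x) (tangent (smooth_subspace X P) x)"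
proof (rule inj_onI)
  interpret PS: germ_space "smooth_subspace X P" using germ_space_subspace germ_space_axioms .
  fix s s' assume s: "s \<in> tangent (smooth_subspace X P) x" "s' \<in> tangent (smooth_subspace X P) x"
    and eq: "tangent_incl X P x s = tangent_incl X P x s'"
  show "s = s'"
  proof
    fix f
    show "s f = s' f"
    proof (cases "f \<in> germs (smooth_subspace X P) x")
      case True
      then obtain F U where F: "F \<in> germs X x" "nbhd X x U" "\<forall>y\<in>U \<inter> P. f y = F y" using germs_subspace by metis
      have nb: "nbhd (smooth_subspace X P) x (U \<inter> P)" using F x nbhd_subspace by metis
      note FP = germ_in_subspace[OF F(1) x(1)]
      have "s f = s F" by (rule PS.tangent_cong[OF s(1) FP nb]) (simp add: F(3))
      moreover have "s' f = s' F" by (rule PS.tangent_cong[OF s(2) FP nb]) (simp add: F(3))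
      moreover have "s F = s' F" using fun_cong[OF eq, of F] F(1) tangent_incl_eq[OF x(1)] by simp
      ultimately show ?thesis by simp
    qed (simp add: PS.tangent_outside[OF s(1)] PS.tangent_outside[OF s(2)])
  qed
qed

text \<open>
  A derivation \<open>t\<close> that vanishes on functions vanishing on \<open>P\<close> takes the same value on all smooth
  extensions of a function on \<open>P\<close>, and thus is induced by a derivation of the germs on \<open>P\<close>.
\<close>

lemma tangent_sub_iff:
  assumes x: "x \<in> points X" "x \<in> P"
  shows "t \<in> tangent_sub X P x \<longleftrightarrow> t \<in> tangent X x \<and> kills_on P x t"
proof
  interpret PS: germ_space "smooth_subspace X P" using germ_space_subspace germ_space_axioms .
  {
    assume "t \<in> tangent_sub X P x"
    then obtain s where s: "s \<in> tangent (smooth_subspace X P) x" "t = tangent_incl X P x s"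
      by (auto simp: tangent_sub_def)
    have "differential (smooth_subspace X P) X (\<lambda>x. x) x s \<in> tangent X x"
      by (rule differential_tangent[of _ _ "\<lambda>x. x", OF PS.germ_space_axioms germ_space_axioms x(1) _ s(1)])
        (simp add: o_def germ_in_subspace x(1))
    then have "t \<in> tangent X x" using s by (simp add: tangent_incl_def)
    moreover have "kills_on P x t"
      unfolding kills_on_def
    proof (intro ballI impI, elim exE conjE)
      fix f U assume f: "f \<in> germs X x" and U: "nbhd X x U" "\<forall>y\<in>U \<inter> P. f y = 0"
      have "nbhd (smooth_subspace X P) x (U \<inter> P)" using U x nbhd_subspace by metis
      then have "s f = 0" using PS.tangent_cong_const[OF s(1)] U(2) by blast
      then show "t f = 0" by (simp add: s(2) tangent_incl_eq[OF x(1)])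
    qed
    ultimately show "t \<in> tangent X x \<and> kills_on P x t" ..
  }
  assume t: "t \<in> tangent X x \<and> kills_on P x t"
  then have tX: "t \<in> tangent X x" by blast
  have well: "t F = t F'" if F: "F \<in> germs X x" "F' \<in> germs X x" and U: "nbhd X x U"
    and eq: "\<And>y. y \<in> U \<inter> P \<Longrightarrow> F y = F' y" for F F' U
  proof -
    have d: "(\<lambda>y. F y + (- 1) * F' y) \<in> germs X x"
      by (rule add_germ[OF x(1) F(1) scale_germ[OF x(1) F(2)]])
    have ex: "\<exists>U. nbhd X x U \<and> (\<forall>y\<in>U \<inter> P. F y + (- 1) * F' y = 0)" by (rule exI[of _ U]) (use U eq in auto)
    have "t (\<lambda>y. F y + (- 1) * F' y) = 0"
      using t[THEN conjunct2, unfolded kills_on_def, THEN bspec, OF d] ex by (rule mp)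
    then show ?thesis using tangent_add[OF tX F(1) scale_germ[OF x(1) F(2), of "- 1"]]
      tangent_scale[OF tX F(2), of "- 1"] by simp
  qed
  define s where "s = (\<lambda>f. if f \<in> germs (smooth_subspace X P) x
    then t (SOME F. F \<in> germs X x \<and> (\<exists>U. nbhd X x U \<and> (\<forall>y\<in>U \<inter> P. f y = F y))) else 0)"
  have s: "s f = t F" if F: "F \<in> germs X x" "nbhd X x U" "\<forall>y\<in>U \<inter> P. f y = F y" for f F U
  proof -
    let ?Q = "\<lambda>F. F \<in> germs X x \<and> (\<exists>U. nbhd X x U \<and> (\<forall>y\<in>U \<inter> P. f y = F y))"
    define F0 where "F0 = (SOME F. ?Q F)"
    have "?Q F" using F by blast
    then have *: "?Q F0" unfolding F0_def by (rule someI[of ?Q])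
    then obtain U' where U': "nbhd X x U'" "\<forall>y\<in>U' \<inter> P. f y = F0 y" by blast
    have "f \<in> germs (smooth_subspace X P) x" using F germs_subspace by metis
    then have "s f = t F0" by (simp add: s_def F0_def)
    also have "t F0 = t F"
    proof (rule well[OF _ F(1) nbhd_Int[OF F(2) U'(1)]])
      show "F0 \<in> germs X x" using * by blast
      fix y assume "y \<in> U \<inter> U' \<inter> P"
      then have "f y = F y" "f y = F0 y" by (blast intro: F(3)[rule_format] U'(2)[rule_format])+
      then show "F0 y = F y" by simp
    qed
    finally show ?thesis .
  qed
  have "s \<in> tangent (smooth_subspace X P) x"
    unfolding tangent_def
  proof (intro CollectI conjI allI ballI impI)
    show "s f = 0" if "f \<notin> germs (smooth_subspace X P) x" for f using that by (simp add: s_def)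
    fix f assume f: "f \<in> germs (smooth_subspace X P) x"
    then obtain F U where F: "F \<in> germs X x" "nbhd X x U" "\<forall>y\<in>U \<inter> P. f y = F y" using germs_subspace by metis
    have fx: "f x = F x" using F x by (simp add: nbhd_def)
    have "s (\<lambda>y. c * f y) = t (\<lambda>y. c * F y)" for c
      by (rule s[OF scale_germ[OF x(1) F(1)] F(2)]) (use F(3) in auto)
    then show "s (\<lambda>y. c * f y) = c * s f" for c
      using tangent_scale[OF tX F(1)] s[OF F] by simp
    fix h assume h: "h \<in> germs (smooth_subspace X P) x"
    then obtain H U' where H: "H \<in> germs X x" "nbhd X x U'" "\<forall>y\<in>U' \<inter> P. h y = H y" using germs_subspace by metis
    have hx: "h x = H x" using H x by (simp add: nbhd_def)
    have "s (\<lambda>y. f y + h y) = t (\<lambda>y. F y + H y)"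
      by (rule s[OF add_germ[OF x(1) F(1) H(1)] nbhd_Int[OF F(2) H(2)]]) (use F(3) H(3) in auto)
    then show "s (\<lambda>y. f y + h y) = s f + s h"
      using tangent_add[OF tX F(1) H(1)] s[OF F] s[OF H] by simp
    have "s (\<lambda>y. f y * h y) = t (\<lambda>y. F y * H y)"
      by (rule s[OF mult_germ[OF x(1) F(1) H(1)] nbhd_Int[OF F(2) H(2)]]) (use F(3) H(3) in auto)
    then show "s (\<lambda>y. f y * h y) = f x * s h + h x * s f"
      using tangent_mult[OF tX F(1) H(1)] s[OF F] s[OF H] fx hx by simp
  qed
  moreover have "tangent_incl X P x s = t"
  proof
    fix f
    have "s f = t f" if f: "f \<in> germs X x" using s[OF f, of "points X" f] x by (simp add: nbhd_def)
    then show "tangent_incl X P x s f = t f"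
      using tangent_outside[OF tX] by (simp add: tangent_incl_eq[OF x(1)])
  qed
  ultimately show "t \<in> tangent_sub X P x" unfolding tangent_sub_def by blast
qed

lemma tangent_sub_extension:
  assumes x: "x \<in> points X" "x \<in> P" and t: "t \<in> tangent_sub X P x"
    and F: "F \<in> germs X x" "nbhd X x U" "\<And>y. y \<in> U \<Longrightarrow> y \<in> P \<Longrightarrow> f y = F y"
  shows "the_inv_into (tangent (smooth_subspace X P) x) (tangent_incl X P x) t f = t F"
proof -
  interpret PS: germ_space "smooth_subspace X P" using germ_space_subspace germ_space_axioms .
  obtain s where s: "s \<in> tangent (smooth_subspace X P) x" "t = tangent_incl X P x s"
    using t by (auto simp: tangent_sub_def)
  have "the_inv_into (tangent (smooth_subspace X P) x) (tangent_incl X P x) t = s"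
    using the_inv_into_f_f[OF inj_on_tangent_incl[OF x] s(1)] s(2) by simp
  moreover have "nbhd (smooth_subspace X P) x (U \<inter> P)" using F(2) x(2) by (auto simp: nbhd_subspace)
  then have "s f = s F"
    by (rule PS.tangent_cong[OF s(1) germ_in_subspace[OF F(1) x(1)]]) (use F(3) in auto)
  moreover have "t F = s F" using F(1) by (simp add: s(2) tangent_incl_eq[OF x(1)])
  ultimately show ?thesis by simp
qed

end

section \<open>Groups acting with a moment map\<close>

text \<open>
  The coordinates \<open>cS\<close>, \<open>\<kappa>S\<close> of the group at the identity serve to identify the Lie algebra with
  the model space \<open>V\<close>.
\<close>

locale reduction =
  fixes W :: "'a::euclidean_space set" and M :: "'m smooth_space" and J :: "nat \<Rightarrow> 'm endo"
    and V :: "'b::euclidean_space set" and G :: "('g, 'x) monoid_scheme" and S :: "'g smooth_space"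
    and \<phi> :: "'g \<Rightarrow> 'm \<Rightarrow> 'm" and \<nu> :: "nat \<Rightarrow> 'm \<Rightarrow> 'g tvec \<Rightarrow> real"
    and cS :: "'g \<Rightarrow> 'b" and \<kappa>S :: "'b \<Rightarrow> 'g" and US :: "'g set" and ES :: "'b set"
  assumes manifoldM: "manifold W M" and hyper: "hypercomplex M J" and lie: "lie_group V G S"
    and compactS: "compact_space (topo S)" and action: "smooth_action V W G S M \<phi>"
    and equivariantJ: "\<And>h m v a. h \<in> carrier G \<Longrightarrow> m \<in> points M \<Longrightarrow> v \<in> tangent M m \<Longrightarrow> a \<in> {1,2,3} \<Longrightarrow>
      differential M M (\<phi> h) m (J a m v) = J a (\<phi> h m) (differential M M (\<phi> h) m v)"
    and moment: "moment_map G S M J \<phi> \<nu>"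
    and free: "\<And>m. m \<in> zero_level G S M \<nu> \<Longrightarrow> stabilizer G \<phi> m = {\<one>\<^bsub>G\<^esub>}"
    and chartS: "linear_chart S cS \<kappa>S US ES V" and one_US: "\<one>\<^bsub>G\<^esub> \<in> US"
begin

abbreviation "P \<equiv> zero_level G S M \<nu>"
abbreviation "gen \<equiv> generated_field G S M \<phi>"
abbreviation "\<gg> \<equiv> lie_algebra G S"

sublocale M: germ_space M by (rule manifold_germ_space[OF manifoldM])
sublocale SC: linear_chart S cS \<kappa>S US ES V by (rule chartS)
sublocale G: group G using lie by (simp add: lie_group_def)

lemma points_S: "points S = carrier G" using lie by (simp add: lie_group_def)

lemma one_points: "\<one>\<^bsub>G\<^esub> \<in> points S" by (simp add: points_S)

section \<open>The group action\<close>

sublocale A: group_action G "points M" \<phi> using action by (simp add: smooth_action_def)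

lemma act_closed: "h \<in> carrier G \<Longrightarrow> x \<in> points M \<Longrightarrow> \<phi> h x \<in> points M"
  by (rule A.element_image) auto

lemma act_one: "x \<in> points M \<Longrightarrow> \<phi> \<one>\<^bsub>G\<^esub> x = x"
  using fun_cong[OF A.id_eq_one, of x] by simp

lemma act_mult: "h \<in> carrier G \<Longrightarrow> k \<in> carrier G \<Longrightarrow> x \<in> points M \<Longrightarrow> \<phi> (h \<otimes>\<^bsub>G\<^esub> k) x = \<phi> h (\<phi> k x)"
  by (rule A.composition_rule)

lemma act_inv: "h \<in> carrier G \<Longrightarrow> x \<in> points M \<Longrightarrow> \<phi> (inv\<^bsub>G\<^esub> h) (\<phi> h x) = x"
  using act_mult[of "inv\<^bsub>G\<^esub> h" h x] act_one by simp

lemma act_cont: "continuous_map (prod_topology (topo S) (topo M)) (topo M) (\<lambda>(h, x). \<phi> h x)"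
  using action by (simp add: smooth_action_def smooth_map_def smooth_product_def)

lemma act_germ:
  assumes "h \<in> carrier G" "x \<in> points M" "f \<in> germs M (\<phi> h x)"
  shows "(\<lambda>(k, y). f (\<phi> k y)) \<in> germs (smooth_product V W S M) (h, x)"
proof -
  have "(h, x) \<in> points (smooth_product V W S M)"
    using assms by (simp add: smooth_product_def points_S)
  then have "f \<circ> (\<lambda>(h, m). \<phi> h m) \<in> germs (smooth_product V W S M) (h, x)"
    using action assms(3) unfolding smooth_action_def smooth_map_def by fastforce
  moreover have "f \<circ> (\<lambda>(h, m). \<phi> h m) = (\<lambda>(k, y). f (\<phi> k y))" by auto
  ultimately show ?thesis by simp
qed

lemma act_germ_snd:
  assumes "h \<in> carrier G" "x \<in> points M" "f \<in> germs M (\<phi> h x)"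
  shows "(\<lambda>y. f (\<phi> h y)) \<in> germs M x"
  using product_germ_snd[OF M.germ_space_axioms act_germ[OF assms]] by simp

lemma act_germ_fst:
  assumes "x \<in> points M" "f \<in> germs M x"
  shows "(\<lambda>h. f (\<phi> h x)) \<in> germs S \<one>\<^bsub>G\<^esub>"
  using product_germ_fst[OF SC.germ_space_axioms act_germ[of "\<one>\<^bsub>G\<^esub>" x f]] assms act_one by simp

lemma act_openin:
  assumes "h \<in> carrier G" "openin (topo M) T"
  shows "openin (topo M) {x \<in> points M. \<phi> h x \<in> T}"
proof -
  have "continuous_map (topo M) (topo M) ((\<lambda>(h, x). \<phi> h x) \<circ> (\<lambda>x. (h, x)))"
    by (rule continuous_map_compose[OF _ act_cont])
      (use assms in \<open>auto intro!: continuous_map_pairedI simp: points_S\<close>)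
  from openin_continuous_map_preimage[OF this assms(2)] show ?thesis by (simp add: o_def)
qed

lemma act_tangent:
  assumes "h \<in> carrier G" "x \<in> points M" "t \<in> tangent M x"
  shows "differential M M (\<phi> h) x t \<in> tangent M (\<phi> h x)"
  by (rule differential_tangent[of M M "\<phi> h", OF M.germ_space_axioms M.germ_space_axioms act_closed[OF assms(1,2)] _ assms(3)])
    (use act_germ_snd[OF assms(1,2)] in \<open>simp add: o_def\<close>)

lemma gen_eq:
  assumes "x \<in> points M"
  shows "gen \<xi> x f = (if f \<in> germs M x then \<xi> (\<lambda>h. f (\<phi> h x)) else 0)"
  by (simp add: generated_field_def differential_def act_one[OF assms] o_def)

lemma gen_tangent:
  assumes "x \<in> points M" "\<xi> \<in> \<gg>" shows "gen \<xi> x \<in> tangent M x"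
proof -
  have "differential S M (\<lambda>h. \<phi> h x) \<one>\<^bsub>G\<^esub> \<xi> \<in> tangent M (\<phi> \<one>\<^bsub>G\<^esub> x)"
    by (rule differential_tangent[of S M "\<lambda>h. \<phi> h x", OF SC.germ_space_axioms M.germ_space_axioms])
      (use assms act_one act_germ_fst in \<open>auto simp: lie_algebra_def o_def\<close>)
  then show ?thesis using act_one[OF assms(1)] by (simp add: generated_field_def)
qed

section \<open>Quaternionic relations\<close>

lemma J_tangent: "a \<in> {1,2,3} \<Longrightarrow> x \<in> points M \<Longrightarrow> t \<in> tangent M x \<Longrightarrow> J a x t \<in> tangent M x"
  using hyper unfolding hypercomplex_def complex_structure_def smooth_endo_def by blast

lemma J_add: "a \<in> {1,2,3} \<Longrightarrow> x \<in> points M \<Longrightarrow> t \<in> tangent M x \<Longrightarrow> u \<in> tangent M x \<Longrightarrow>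
    J a x (tadd t u) = tadd (J a x t) (J a x u)"
  using hyper unfolding hypercomplex_def complex_structure_def smooth_endo_def by blast

lemma J_scale: "a \<in> {1,2,3} \<Longrightarrow> x \<in> points M \<Longrightarrow> t \<in> tangent M x \<Longrightarrow>
    J a x (tscale r t) = tscale r (J a x t)"
  using hyper unfolding hypercomplex_def complex_structure_def smooth_endo_def by blast

lemma J_vfield: "a \<in> {1,2,3} \<Longrightarrow> x \<in> points M \<Longrightarrow> vfield_near M x A \<Longrightarrow> vfield_near M x (\<lambda>y. J a y (A y))"
  using hyper unfolding hypercomplex_def complex_structure_def smooth_endo_def by blast

lemma tscale_tscale: "tscale r (tscale s t) = tscale (r * s) t"
  by (simp add: tscale_def fun_eq_iff)

lemma tscale_one [simp]: "tscale 1 t = t"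
  by (simp add: tscale_def)

lemma J_J:
  assumes x: "x \<in> points M" and t: "t \<in> tangent M x"
  shows "a \<in> {1,2,3} \<Longrightarrow> J a x (J a x t) = tscale (- 1) t"
    "J 1 x (J 2 x t) = J 3 x t" "J 2 x (J 1 x t) = tscale (- 1) (J 3 x t)"
    "J 2 x (J 3 x t) = J 1 x t" "J 3 x (J 2 x t) = tscale (- 1) (J 1 x t)"
    "J 3 x (J 1 x t) = J 2 x t" "J 1 x (J 3 x t) = tscale (- 1) (J 2 x t)"
proof -
  have sq: "J a x (J a x t) = tscale (- 1) t" if "a \<in> {1,2,3}" "t \<in> tangent M x" for a t
    using hyper that x unfolding hypercomplex_def complex_structure_def by blast
  have h12: "J 1 x (J 2 x t) = J 3 x t" "tscale (- 1) (J 2 x (J 1 x t)) = J 3 x t" if "t \<in> tangent M x" for t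
    using hyper that x unfolding hypercomplex_def by blast+
  have T: "J 1 x t \<in> tangent M x" "J 2 x t \<in> tangent M x" "J 3 x t \<in> tangent M x"
    using J_tangent[OF _ x t] by auto
  show "J a x (J a x t) = tscale (- 1) t" if "a \<in> {1,2,3}" by (rule sq[OF that t])
  show "J 1 x (J 2 x t) = J 3 x t" by (rule h12[OF t])
  show "J 2 x (J 1 x t) = tscale (- 1) (J 3 x t)"
    by (simp add: h12(2)[OF t, symmetric] tscale_tscale)
  have n: "J a x (tscale (- 1) u) = tscale (- 1) (J a x u)" if "a \<in> {1,2,3}" "u \<in> tangent M x" for a u
    using J_scale that x by blast
  show "J 2 x (J 3 x t) = J 1 x t"
    using J_tangent[OF _ x T(1), of 2] sq[OF _ T(1), of 2] n[of 2 "J 2 x (J 1 x t)"]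
    by (simp add: h12(2)[OF t, symmetric] tscale_tscale)
  show "J 3 x (J 2 x t) = tscale (- 1) (J 1 x t)"
    using h12(1)[OF T(2)] sq[OF _ t, of 2] n[of 1 t] t by simp
  show "J 3 x (J 1 x t) = J 2 x t"
    using h12(2)[OF T(1)] sq[OF _ t, of 1] n[of 2 t] t by (simp add: tscale_tscale)
  show "J 1 x (J 3 x t) = tscale (- 1) (J 2 x t)"
    using h12(1)[OF t] sq[OF _ T(2), of 1] by simp
qed

lemma tscale_uminus_apply: "tscale (- 1) t f = - t f"
  by (simp add: tscale_def)

section \<open>The kernel of the derivative of the moment map\<close>

lemma nu_add: "a \<in> {1,2,3} \<Longrightarrow> x \<in> points M \<Longrightarrow> \<xi> \<in> \<gg> \<Longrightarrow> \<eta> \<in> \<gg> \<Longrightarrow> \<nu> a x (tadd \<xi> \<eta>) = \<nu> a x \<xi> + \<nu> a x \<eta>"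
  using moment unfolding moment_map_def by blast

lemma nu_scale: "a \<in> {1,2,3} \<Longrightarrow> x \<in> points M \<Longrightarrow> \<xi> \<in> \<gg> \<Longrightarrow> \<nu> a x (tscale r \<xi>) = r * \<nu> a x \<xi>"
  using moment unfolding moment_map_def by blast

lemma nu_germ: "a \<in> {1,2,3} \<Longrightarrow> x \<in> points M \<Longrightarrow> \<xi> \<in> \<gg> \<Longrightarrow> (\<lambda>y. \<nu> a y \<xi>) \<in> germs M x"
  using moment unfolding moment_map_def smooth_fun_def by blast

lemma nu_equivariant: "a \<in> {1,2,3} \<Longrightarrow> h \<in> carrier G \<Longrightarrow> x \<in> points M \<Longrightarrow> \<xi> \<in> \<gg> \<Longrightarrow>
    \<nu> a (\<phi> h x) \<xi> = \<nu> a x (Ad G S (inv\<^bsub>G\<^esub> h) \<xi>)"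
  using moment unfolding moment_map_def by blast

lemma twisted_dnu_eq: "twisted_dnu J \<nu> a x t \<xi> = - J a x t (\<lambda>y. \<nu> a y \<xi>)"
  by (simp add: twisted_dnu_def twisted_d0_def act1_def d0_def)

lemma cauchy_riemann:
  assumes "x \<in> points M" "t \<in> tangent M x" "\<xi> \<in> \<gg>"
  shows "J 1 x t (\<lambda>y. \<nu> 1 y \<xi>) = J 2 x t (\<lambda>y. \<nu> 2 y \<xi>)" "J 2 x t (\<lambda>y. \<nu> 2 y \<xi>) = J 3 x t (\<lambda>y. \<nu> 3 y \<xi>)"
proof -
  have "twisted_dnu J \<nu> 1 x t \<xi> = twisted_dnu J \<nu> 2 x t \<xi>" "twisted_dnu J \<nu> 2 x t \<xi> = twisted_dnu J \<nu> 3 x t \<xi>"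
    using moment assms unfolding moment_map_def by blast+
  then show "J 1 x t (\<lambda>y. \<nu> 1 y \<xi>) = J 2 x t (\<lambda>y. \<nu> 2 y \<xi>)" "J 2 x t (\<lambda>y. \<nu> 2 y \<xi>) = J 3 x t (\<lambda>y. \<nu> 3 y \<xi>)"
    by (simp_all add: twisted_dnu_eq)
qed

lemma transversal:
  assumes "a \<in> {1,2,3}" "x \<in> points M" "\<xi> \<in> \<gg>" "\<And>\<eta>. \<eta> \<in> \<gg> \<Longrightarrow> twisted_dnu J \<nu> a x (gen \<xi> x) \<eta> = 0"
  shows "\<xi> = tzero"
  using moment assms unfolding moment_map_def by blast

lemma P_points: "m \<in> P \<Longrightarrow> m \<in> points M" and P_nu: "m \<in> P \<Longrightarrow> a \<in> {1,2,3} \<Longrightarrow> \<xi> \<in> \<gg> \<Longrightarrow> \<nu> a m \<xi> = 0"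
  by (auto simp: zero_level_def)

text \<open>
  Conjugation is a smooth map that fixes the identity.
\<close>

lemma Ad_closed:
  assumes h: "h \<in> carrier G" and \<xi>: "\<xi> \<in> \<gg>" shows "Ad G S h \<xi> \<in> \<gg>"
proof -
  let ?F = "\<lambda>k. h \<otimes>\<^bsub>G\<^esub> k \<otimes>\<^bsub>G\<^esub> inv\<^bsub>G\<^esub> h"
  have mult: "(\<lambda>(k, l). f (k \<otimes>\<^bsub>G\<^esub> l)) \<in> germs (smooth_product V V S S) (a, b)"
    if "a \<in> carrier G" "b \<in> carrier G" "f \<in> germs S (a \<otimes>\<^bsub>G\<^esub> b)" for a b f
  proof -
    have "(a, b) \<in> points (smooth_product V V S S)" using that by (simp add: smooth_product_def points_S)
    moreover have "smooth_map (smooth_product V V S S) S (\<lambda>(h, k). h \<otimes>\<^bsub>G\<^esub> k)"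
      using lie by (simp add: lie_group_def)
    ultimately have "f \<circ> (\<lambda>(h, k). h \<otimes>\<^bsub>G\<^esub> k) \<in> germs (smooth_product V V S S) (a, b)"
      using that(3) unfolding smooth_map_def by fastforce
    moreover have "f \<circ> (\<lambda>(h, k). h \<otimes>\<^bsub>G\<^esub> k) = (\<lambda>(k, l). f (k \<otimes>\<^bsub>G\<^esub> l))" by auto
    ultimately show ?thesis by simp
  qed
  have pull: "f \<circ> ?F \<in> germs S \<one>\<^bsub>G\<^esub>" if f: "f \<in> germs S (?F \<one>\<^bsub>G\<^esub>)" for f
  proof -
    have "(\<lambda>k. f (k \<otimes>\<^bsub>G\<^esub> inv\<^bsub>G\<^esub> h)) \<in> germs S (h \<otimes>\<^bsub>G\<^esub> \<one>\<^bsub>G\<^esub>)"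
      using product_germ_fst[OF SC.germ_space_axioms mult[of "h \<otimes>\<^bsub>G\<^esub> \<one>\<^bsub>G\<^esub>" "inv\<^bsub>G\<^esub> h" f]] h f by simp
    from product_germ_snd[OF SC.germ_space_axioms mult[OF h _ this]] show ?thesis by (simp add: o_def)
  qed
  have "differential S S ?F \<one>\<^bsub>G\<^esub> \<xi> \<in> tangent S (?F \<one>\<^bsub>G\<^esub>)"
    by (rule differential_tangent[OF SC.germ_space_axioms SC.germ_space_axioms _ pull])
      (use h \<xi> in \<open>simp_all add: points_S lie_algebra_def\<close>)
  then show ?thesis using h by (simp add: Ad_def lie_algebra_def)
qed

lemma P_invariant:
  assumes m: "m \<in> P" and h: "h \<in> carrier G" shows "\<phi> h m \<in> P"
proof -
  have "\<nu> a (\<phi> h m) \<xi> = 0" if "a \<in> {1,2,3}" "\<xi> \<in> \<gg>" for a \<xi>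
    using nu_equivariant[OF that(1) h P_points[OF m] that(2)]
      P_nu[OF m that(1) Ad_closed[OF G.inv_closed[OF h] that(2)]] by simp
  then show ?thesis
    unfolding zero_level_def using act_closed[OF h P_points[OF m]] by blast
qed

text \<open>
  The kernel of \<open>d\<nu>\<close>. At points of the zero level it is the tangent space of the zero level, see
  \<open>tangent_sub_P\<close>.
\<close>

definition tangent_nu :: "'m \<Rightarrow> 'm tvec set" where
  "tangent_nu x = {t \<in> tangent M x. \<forall>a\<in>{1,2,3}. \<forall>\<xi>\<in>\<gg>. t (\<lambda>y. \<nu> a y \<xi>) = 0}"

lemma tangent_nuD: "t \<in> tangent_nu x \<Longrightarrow> t \<in> tangent M x"
  "t \<in> tangent_nu x \<Longrightarrow> a \<in> {1,2,3} \<Longrightarrow> \<xi> \<in> \<gg> \<Longrightarrow> t (\<lambda>y. \<nu> a y \<xi>) = 0"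
  by (auto simp: tangent_nu_def)

text \<open>
  The zero level is invariant under the group by equivariance of \<open>\<nu>\<close>, so \<open>\<nu>\<close> vanishes along orbits in it.
\<close>

lemma gen_tangent_nu:
  assumes m: "m \<in> P" and \<xi>: "\<xi> \<in> \<gg>" shows "gen \<xi> m \<in> tangent_nu m"
  unfolding tangent_nu_def
proof (intro CollectI conjI ballI)
  note mp = P_points[OF m]
  show "gen \<xi> m \<in> tangent M m" by (rule gen_tangent[OF mp \<xi>])
  fix a \<eta> assume a: "a \<in> {1, 2, 3::nat}" and \<eta>: "\<eta> \<in> \<gg>"
  have "\<xi> (\<lambda>h. \<nu> a (\<phi> h m) \<eta>) = 0"
  proof (rule SC.tangent_cong_const[of \<xi> "\<one>\<^bsub>G\<^esub>" "points S"])
    show "\<xi> \<in> tangent S \<one>\<^bsub>G\<^esub>" using \<xi> by (simp add: lie_algebra_def)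
    show "nbhd S \<one>\<^bsub>G\<^esub> (points S)" by (simp add: nbhd_def one_points)
    show "\<nu> a (\<phi> h m) \<eta> = 0" if "h \<in> points S" for h
      using P_nu[OF P_invariant[OF m] a \<eta>] that points_S by simp
  qed
  then show "gen \<xi> m (\<lambda>y. \<nu> a y \<eta>) = 0" by (simp add: gen_eq[OF mp])
qed

text \<open>
  If \<open>d\<nu>\<close> vanishes on \<open>t\<close>, the Cauchy--Riemann condition applied to \<open>I\<^sub>c t\<close>, where \<open>c\<close> differs from
  \<open>a\<close> and \<open>b\<close>, turns \<open>d\<nu>\<^sub>a (I\<^sub>b t)\<close> into \<open>d\<nu>\<^sub>c t\<close> up to sign.
\<close>

lemma J_cross:
  assumes x: "x \<in> points M" and t: "t \<in> tangent_nu x" and \<xi>: "\<xi> \<in> \<gg>"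
    and ab: "a \<in> {1,2,3}" "b \<in> {1,2,3}" "a \<noteq> b"
  shows "J b x t (\<lambda>y. \<nu> a y \<xi>) = 0"
proof -
  note tM = tangent_nuD(1)[OF t]
  have T: "J 1 x t \<in> tangent M x" "J 2 x t \<in> tangent M x" "J 3 x t \<in> tangent M x"
    using J_tangent[OF _ x tM] by auto
  have z: "t (\<lambda>y. \<nu> 1 y \<xi>) = 0" "t (\<lambda>y. \<nu> 2 y \<xi>) = 0" "t (\<lambda>y. \<nu> 3 y \<xi>) = 0"
    using tangent_nuD(2)[OF t _ \<xi>] by auto
  note JJ = J_J(2-)[OF x tM] J_J(1)[OF x tM]
  have "J 3 x t (\<lambda>y. \<nu> 2 y \<xi>) = 0" "J 2 x t (\<lambda>y. \<nu> 3 y \<xi>) = 0"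
    using cauchy_riemann[OF x T(1) \<xi>] z by (simp_all add: JJ tscale_uminus_apply del: One_nat_def)
  moreover have "J 3 x t (\<lambda>y. \<nu> 1 y \<xi>) = 0" "J 1 x t (\<lambda>y. \<nu> 3 y \<xi>) = 0"
    using cauchy_riemann[OF x T(2) \<xi>] z by (simp_all add: JJ tscale_uminus_apply del: One_nat_def)
  moreover have "J 2 x t (\<lambda>y. \<nu> 1 y \<xi>) = 0" "J 1 x t (\<lambda>y. \<nu> 2 y \<xi>) = 0"
    using cauchy_riemann[OF x T(3) \<xi>] z by (simp_all add: JJ tscale_uminus_apply del: One_nat_def)
  ultimately show ?thesis using ab by auto
qed

text \<open>
  The horizontal space of the splitting of the tangent space of the zero level, described by
  linear equations; see \<open>horizontal_eq_hor\<close>.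
\<close>

definition hor :: "'m \<Rightarrow> 'm tvec set" where
  "hor x = {t \<in> tangent_nu x. \<forall>a\<in>{1,2,3}. \<forall>\<xi>\<in>\<gg>. J a x t (\<lambda>y. \<nu> a y \<xi>) = 0}"

text \<open>
  \<open>I\<^sub>a I\<^sub>b t\<close> is, up to sign, \<open>t\<close> or some \<open>I\<^sub>c t\<close> with \<open>c \<noteq> a\<close>, and \<open>d\<nu>\<^sub>a\<close> vanishes on
  both.
\<close>

lemma J_hor:
  assumes x: "x \<in> points M" and t: "t \<in> hor x" and b: "b \<in> {1,2,3}"
  shows "J b x t \<in> hor x"
proof -
  have tn: "t \<in> tangent_nu x" using t by (simp add: hor_def)
  note tM = tangent_nuD(1)[OF tn]
  have all: "J b x t (\<lambda>y. \<nu> a y \<xi>) = 0" if "a \<in> {1,2,3}" "b \<in> {1,2,3}" "\<xi> \<in> \<gg>" for a b \<xi>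
  proof (cases "a = b")
    case True
    then show ?thesis using t that unfolding hor_def by blast
  qed (rule J_cross[OF x tn that(3,1,2)])
  have z: "t (\<lambda>y. \<nu> a y \<xi>) = 0" if "a \<in> {1,2,3}" "\<xi> \<in> \<gg>" for a \<xi>
    by (rule tangent_nuD(2)[OF tn that])
  have "J a x (J b x t) (\<lambda>y. \<nu> a y \<xi>) = 0" if a: "a \<in> {1,2,3}" and \<xi>: "\<xi> \<in> \<gg>" for a \<xi>
  proof (cases "a = b")
    case True
    then show ?thesis using J_J(1)[OF x tM a] z[OF a \<xi>] by (simp add: tscale_uminus_apply)
  next
    case False
    have "\<exists>c\<in>{1,2,3}. J a x (J b x t) = J c x t \<or> J a x (J b x t) = tscale (- 1) (J c x t)"
      using a b False J_J(2-)[OF x tM] by (elim insertE emptyE) (simp_all del: One_nat_def)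
    then obtain c where "c \<in> {1,2,3}" "J a x (J b x t) = J c x t \<or> J a x (J b x t) = tscale (- 1) (J c x t)"
      by blast
    moreover have "J c x t (\<lambda>y. \<nu> a y \<xi>) = 0" by (rule all[OF a \<open>c \<in> {1,2,3}\<close> \<xi>])
    ultimately show ?thesis by (elim disjE) (simp_all add: tscale_uminus_apply)
  qed
  moreover have "J b x t \<in> tangent_nu x"
    unfolding tangent_nu_def using all[OF _ b] J_tangent[OF b x tM] by blast
  ultimately show ?thesis unfolding hor_def by blast
qed

section \<open>Coordinates on the Lie algebra\<close>

text \<open>
  The Lie algebra parametrised by vectors. Only the projection of \<open>w\<close> to \<open>V\<close> matters; restricted to \<open>V\<close>
  the map is an isomorphism.
\<close>

definition xi :: "'b \<Rightarrow> 'g tvec" where "xi w = SC.coord_field w \<one>\<^bsub>G\<^esub>"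

lemma xi_mem: "xi w \<in> \<gg>"
  using SC.coord_field_tangent[OF one_US] by (simp add: xi_def lie_algebra_def)

lemma xi_add: "xi (w + w') = tadd (xi w) (xi w')" and xi_scale: "xi (r *\<^sub>R w) = tscale r (xi w)"
  and xi_proj: "xi (proj_onto V w) = xi w"
  using SC.coord_field_add[OF one_US] SC.coord_field_scale[OF one_US] SC.coord_field_proj[OF one_US]
  by (simp_all add: xi_def)

lemma xi_surj: "\<xi> \<in> \<gg> \<Longrightarrow> \<xi> = xi (SC.coords \<xi>)"
  using SC.tangent_eq_coord_field[OF one_US] by (simp add: xi_def lie_algebra_def)

lemma xi_zero: assumes "xi w = tzero" "proj_onto V w = w" shows "w = 0"
proof -
  have "SC.coords (xi w) = proj_onto V w" using SC.coords_coord_field[OF one_US] by (simp add: xi_def)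
  then show ?thesis using assms by (simp add: SC.coords_def tzero_def)
qed

text \<open>
  The moment map with values in \<open>V\<close> instead of the dual of the Lie algebra, by means of the inner product.
\<close>

definition nuhat :: "nat \<Rightarrow> 'm \<Rightarrow> 'b" where
  "nuhat a x = (\<Sum>b\<in>Basis. \<nu> a x (xi b) *\<^sub>R b)"

lemma nuhat_inner:
  assumes "a \<in> {1,2,3}" "x \<in> points M" shows "nuhat a x \<bullet> w = \<nu> a x (xi w)"
proof -
  have lin: "linear (\<lambda>w. \<nu> a x (xi w))"
    by (rule linearI) (simp_all add: xi_add xi_scale nu_add[OF assms xi_mem xi_mem] nu_scale[OF assms xi_mem])
  have "\<nu> a x (xi w) = \<nu> a x (xi (\<Sum>b\<in>Basis. (w \<bullet> b) *\<^sub>R b))" by (simp add: euclidean_representation)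
  also have "\<dots> = (\<Sum>b\<in>Basis. (w \<bullet> b) * \<nu> a x (xi b))"
    using linear_sum[OF lin, of "\<lambda>b. (w \<bullet> b) *\<^sub>R b" Basis] linear_scale[OF lin] by simp
  finally show ?thesis
    by (simp add: nuhat_def inner_sum_left inner_sum_right inner_commute mult.commute)
qed

lemma nuhat_proj:
  assumes "a \<in> {1,2,3}" "x \<in> points M" shows "proj_onto V (nuhat a x) = nuhat a x"
proof -
  have "proj_onto V (nuhat a x) \<bullet> w = nuhat a x \<bullet> w" for w
    using nuhat_inner[OF assms] xi_proj proj_onto_adjoint[OF SC.subspaceW] by simp
  then show ?thesis by (metis vector_eq_rdot)
qed

lemma nuhat_zero:
  assumes "x \<in> points M" shows "x \<in> P \<longleftrightarrow> (\<forall>a\<in>{1,2,3}. nuhat a x = 0)"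
proof
  assume "x \<in> P"
  then show "\<forall>a\<in>{1,2,3}. nuhat a x = 0" using P_nu xi_mem by (simp add: nuhat_def del: insert_iff)
next
  assume z: "\<forall>a\<in>{1,2,3}. nuhat a x = 0"
  have "\<nu> a x \<xi> = 0" if "a \<in> {1,2,3}" "\<xi> \<in> \<gg>" for a \<xi>
  proof -
    have "nuhat a x = 0" using z that(1) by blast
    then show ?thesis
      using nuhat_inner[OF that(1) assms, of "SC.coords \<xi>"] xi_surj[OF that(2)] by simp
  qed
  then show "x \<in> P" unfolding zero_level_def using assms by blast
qed

lemma nuhat_germ:
  assumes "a \<in> {1,2,3}" "x \<in> points M" shows "(\<lambda>y. nuhat a y \<bullet> w) \<in> germs M x"
  by (rule M.cong_germ[OF nu_germ[OF assms xi_mem[of w]], of "points M"])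
    (use assms in \<open>auto simp: nbhd_def nuhat_inner simp del: insert_iff\<close>)

lemma nuhat_tangent:
  assumes "a \<in> {1,2,3}" "x \<in> points M" "t \<in> tangent M x"
  shows "t (\<lambda>y. nuhat a y \<bullet> w) = t (\<lambda>y. \<nu> a y (xi w))"
  by (rule M.tangent_cong[OF assms(3) nu_germ[OF assms(1,2) xi_mem[of w]], of "points M"])
    (use assms in \<open>auto simp: nbhd_def nuhat_inner simp del: insert_iff\<close>)

lemma gen_xi_add: "x \<in> points M \<Longrightarrow> gen (tadd \<xi> \<eta>) x = tadd (gen \<xi> x) (gen \<eta> x)"
  by (auto simp: gen_eq tadd_def fun_eq_iff)

lemma gen_xi_scale: "x \<in> points M \<Longrightarrow> gen (tscale r \<xi>) x = tscale r (gen \<xi> x)"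
  by (auto simp: gen_eq tscale_def fun_eq_iff)

text \<open>
  The equations \<open>\<nu> = 0\<close> are solved along the directions \<open>I\<^sub>a \<xi>\<^sub>M\<close>. On these directions the derivative of
  \<open>(\<nu>\<^sub>1, \<nu>\<^sub>2, \<nu>\<^sub>3)\<close> is block diagonal by \<open>J_cross\<close> and its blocks are nondegenerate by transversality.
  A function vanishing on the zero level becomes zero after composition with the retraction \<open>R\<close>, and
  \<open>R\<close> has the identity as its derivative on the kernel of \<open>d\<nu>\<close>; so this kernel consists of tangent vectors of the zero level.
\<close>

lemma zero_level_retraction:
  fixes c :: "'m \<Rightarrow> 'a"
  assumes lc: "linear_chart M c \<kappa> U E W" and m: "m \<in> P" "m \<in> U"
  obtains X R where "open X" "c m \<in> X" "vsmooth_on X R" "R (c m) = c m"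
    "\<And>p. p \<in> X \<Longrightarrow> R p \<in> E" "\<And>p. p \<in> X \<Longrightarrow> \<kappa> (R p) \<in> P"
    "\<And>p. p \<in> X \<Longrightarrow> p \<in> E \<Longrightarrow> \<kappa> p \<in> P \<Longrightarrow> R p = p"
    "\<And>t. t \<in> tangent_nu m \<Longrightarrow> M.kills_on P m t"
proof -
  interpret C: linear_chart M c \<kappa> U E W by fact
  note mp = P_points[OF m(1)]
  define F where "F = (\<lambda>y. (nuhat 1 y, nuhat 2 y, nuhat 3 y))"
  have Fg: "(\<lambda>y. F y \<bullet> b) \<in> germs M x" if x: "x \<in> points M" for x b
  proof -
    have "(\<lambda>y. nuhat 1 y \<bullet> fst b + (nuhat 2 y \<bullet> fst (snd b) + nuhat 3 y \<bullet> snd (snd b))) \<in> germs M x"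
      by (rule M.add_germ[OF x nuhat_germ[OF _ x] M.add_germ[OF x nuhat_germ[OF _ x] nuhat_germ[OF _ x]]]) auto
    then show ?thesis by (simp add: F_def inner_prod_def)
  qed
  have \<kappa>m: "\<kappa> (c m) = m" using C.\<kappa>c[OF m(2)] .
  obtain VN where VN: "open VN" "c m \<in> VN" "VN \<subseteq> E" "vsmooth_on VN (F \<circ> \<kappa>)"
    by (rule C.vector_germ_smooth[OF C.cE[OF m(2)], of F], unfold \<kappa>m, rule Fg[OF mp], rule that)
  define N where "N = F \<circ> \<kappa>"
  define Pr where "Pr = (\<lambda>z :: 'b \<times> 'b \<times> 'b. (proj_onto V (fst z), proj_onto V (fst (snd z)), proj_onto V (snd (snd z))))"
  note linP = linear_proj_onto[OF SC.subspaceW]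
  define u where "u = (\<lambda>a w. J a m (gen (xi w) m))"
  have genT: "gen (xi w) m \<in> tangent_nu m" for w by (rule gen_tangent_nu[OF m(1) xi_mem])
  note genM = tangent_nuD(1)[OF genT]
  have uT: "u a w \<in> tangent M m" if "a \<in> {1,2,3}" for a w
    unfolding u_def by (rule J_tangent[OF that mp genM])
  have uadd: "u a (w + w') = tadd (u a w) (u a w')" if "a \<in> {1,2,3}" for a w w'
    unfolding u_def by (simp add: xi_add gen_xi_add[OF mp] J_add[OF that mp genM genM])
  have uscale: "u a (r *\<^sub>R w) = tscale r (u a w)" if "a \<in> {1,2,3}" for a r w
    unfolding u_def by (simp add: xi_scale gen_xi_scale[OF mp] J_scale[OF that mp genM])
  (* The displacement for z = (z1, z2, z3) is the sum of the vectors I_a (xi z_a)_M. *)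
  define L where "L = (\<lambda>z :: 'b \<times> 'b \<times> 'b. C.coords (u 1 (fst z)) + (C.coords (u 2 (fst (snd z))) + C.coords (u 3 (snd (snd z)))))"
  have linL: "linear L"
    by (rule linearI) (simp_all add: L_def uadd uscale C.coords_add C.coords_scale scaleR_add_right del: One_nat_def)
  have linPr: "linear Pr"
    by (rule linearI) (simp_all add: Pr_def linear_add[OF linP] linear_scale[OF linP])
  have inj: "v = 0" if v: "Pr v = v" and D: "frechet_derivative N (at (c m)) (L v) = 0" for v
  proof -
    obtain v1 v2 v3 where v123: "v = (v1, v2, v3)" by (cases v) auto
    define t where "t = tadd (u 1 v1) (tadd (u 2 v2) (u 3 v3))"
    have tT: "t \<in> tangent M m" unfolding t_def by (intro M.tadd_tangent mp uT) auto
    have Lv: "L v = C.coords t" by (simp add: L_def v123 t_def C.coords_add)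
    have tF: "t (\<lambda>y. F y \<bullet> b) = 0" for b
      using C.vector_germ_derivative[OF m(2) Fg[OF mp] VN(1,2,4) tT, of b] D by (simp add: N_def Lv)
    have tnu: "t (\<lambda>y. \<nu> a y \<eta>) = 0" if a: "a \<in> {1,2,3}" and \<eta>: "\<eta> \<in> \<gg>" for a \<eta>
    proof -
      let ?w = "SC.coords \<eta>"
      have "t (\<lambda>y. nuhat a y \<bullet> ?w) = 0"
        using a tF[of "(?w, 0, 0)"] tF[of "(0, ?w, 0)"] tF[of "(0, 0, ?w)"] by (auto simp: F_def)
      then show ?thesis using nuhat_tangent[OF a mp tT, of ?w] xi_surj[OF \<eta>] by simp
    qed
    have tsum: "t f = u 1 v1 f + (u 2 v2 f + u 3 v3 f)" for f by (simp add: t_def tadd_def)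
    have cross: "u b w (\<lambda>y. \<nu> a y \<eta>) = 0" if "a \<in> {1,2,3}" "b \<in> {1,2,3}" "a \<noteq> b" "\<eta> \<in> \<gg>" for a b w \<eta>
      unfolding u_def by (rule J_cross[OF mp genT that(4,1,2,3)])
    have diag: "u 1 v1 (\<lambda>y. \<nu> 1 y \<eta>) = 0" "u 2 v2 (\<lambda>y. \<nu> 2 y \<eta>) = 0" "u 3 v3 (\<lambda>y. \<nu> 3 y \<eta>) = 0"
      if "\<eta> \<in> \<gg>" for \<eta>
      using tnu[OF _ that, of 1] tnu[OF _ that, of 2] tnu[OF _ that, of 3] cross[OF _ _ _ that]
      by (simp_all add: tsum del: One_nat_def)
    have z: "w = 0" if "a \<in> {1,2,3}" "\<And>\<eta>. \<eta> \<in> \<gg> \<Longrightarrow> u a w (\<lambda>y. \<nu> a y \<eta>) = 0" "proj_onto V w = w" for a w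
      by (rule xi_zero[OF transversal[OF that(1) mp xi_mem] that(3)])
        (use that(2) in \<open>simp add: twisted_dnu_eq u_def\<close>)
    show ?thesis
      using z[of 1 v1] z[of 2 v2] z[of 3 v3] diag v by (simp add: v123 Pr_def zero_prod_def del: One_nat_def)
  qed
  have N0: "N p = 0 \<longleftrightarrow> \<kappa> p \<in> P" if "p \<in> E" for p
    using nuhat_zero[OF C.\<kappa>_points[OF that]] by (simp add: N_def F_def zero_prod_def)
  have PrPr: "Pr (Pr v) = Pr v" for v
    by (simp add: Pr_def proj_onto_id[OF SC.subspaceW] proj_onto_mem[OF SC.subspaceW])
  have PrN: "Pr (N p) = N p" if "p \<in> VN" for p
    using VN(3) C.\<kappa>_points that by (auto simp: N_def F_def Pr_def nuhat_proj)
  have Ncm: "N (c m) = 0" using N0[OF C.cE[OF m(2)]] \<kappa>m m(1) by simp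
  obtain X R where XR: "open X" "c m \<in> X" "vsmooth_on X R" "R (c m) = c m"
    "\<And>p. p \<in> X \<Longrightarrow> R p \<in> VN" "\<And>p. p \<in> X \<Longrightarrow> N (R p) = 0" "\<And>p. p \<in> X \<Longrightarrow> N p = 0 \<Longrightarrow> R p = p"
    "\<And>w. frechet_derivative N (at (c m)) w = 0 \<Longrightarrow> frechet_derivative R (at (c m)) w = w"
    by (rule submersion_retraction[OF VN(1) VN(4)[folded N_def] VN(2) Ncm linPr PrPr PrN linL inj],
        assumption, assumption, assumption, rule that)
  show ?thesis
  proof (rule that[OF XR(1-4)])
    show "R p \<in> E" if "p \<in> X" for p using XR(5)[OF that] VN(3) by blast
    then show "\<kappa> (R p) \<in> P" if "p \<in> X" for p using N0 XR(6) that by blast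
    show "R p = p" if "p \<in> X" "p \<in> E" "\<kappa> p \<in> P" for p using XR(7)[OF that(1)] N0 that by blast
    fix t assume t: "t \<in> tangent_nu m"
    note tT = tangent_nuD(1)[OF t]
    have "frechet_derivative N (at (c m)) (C.coords t) \<bullet> b = 0" for b
    proof -
      have g: "(\<lambda>y. nuhat a y \<bullet> w) \<in> germs M m" if "a \<in> {1,2,3}" for a w by (rule nuhat_germ[OF that mp])
      have z: "t (\<lambda>y. nuhat a y \<bullet> w) = 0" if "a \<in> {1,2,3}" for a w
        using nuhat_tangent[OF that mp tT] tangent_nuD(2)[OF t that xi_mem] by simp
      have "t (\<lambda>y. F y \<bullet> b) = t (\<lambda>y. nuhat 1 y \<bullet> fst b + (nuhat 2 y \<bullet> fst (snd b) + nuhat 3 y \<bullet> snd (snd b)))"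
        by (simp add: F_def inner_prod_def)
      also have "\<dots> = 0"
        using M.tangent_add[OF tT g M.add_germ[OF mp g g]] M.tangent_add[OF tT g g] z
        by (simp del: One_nat_def)
      finally show ?thesis
        using C.vector_germ_derivative[OF m(2) Fg[OF mp] VN(1,2,4) tT, of b] by (simp add: N_def)
    qed
    then have "frechet_derivative N (at (c m)) (C.coords t) = 0" by (metis inner_eq_zero_iff)
    then have DR: "frechet_derivative R (at (c m)) (C.coords t) = C.coords t" by (rule XR(8))
    show "M.kills_on P m t"
      unfolding M.kills_on_def
    proof (intro ballI impI, elim exE conjE)
      fix f T assume f: "f \<in> germs M m" and T: "nbhd M m T" and f0: "\<forall>y\<in>T \<inter> P. f y = 0"
      let ?D = "\<lambda>w. C.coord_field w m f"
      define X' where "X' = X \<inter> R -` {p \<in> E. \<kappa> p \<in> T}"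
      have "open X'" unfolding X'_def
        using continuous_open_preimage[OF vsmooth_on_continuous[OF XR(3)] XR(1) C.\<kappa>_cont] T by (simp add: nbhd_def)
      have "c m \<in> X'" using XR(2,4) C.cE[OF m(2)] T \<kappa>m by (simp add: X'_def nbhd_def)
      have "((\<lambda>p. (f \<circ> \<kappa>) (R p)) has_derivative (\<lambda>w. ?D (frechet_derivative R (at (c m)) w))) (at (c m))"
        by (rule has_derivative_compose[OF vsmooth_on_derivative[OF XR(3,2)]])
          (simp only: XR(4) C.germ_derivative[OF m(2) f])
      then have "((\<lambda>p. 0) has_derivative (\<lambda>w. ?D (frechet_derivative R (at (c m)) w))) (at (c m))"
      proof (rule has_derivative_transform_within_open[OF _ \<open>open X'\<close> \<open>c m \<in> X'\<close>])
        fix p assume p: "p \<in> X'"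
        then have "\<kappa> (R p) \<in> T" "\<kappa> (R p) \<in> P" using N0[OF \<open>p \<in> X \<Longrightarrow> R p \<in> E\<close>] XR(6) by (auto simp: X'_def)
        then show "(f \<circ> \<kappa>) (R p) = 0" using f0 by simp
      qed
      then have "(\<lambda>w. ?D (frechet_derivative R (at (c m)) w)) = (\<lambda>w. 0)"
        using has_derivative_unique has_derivative_const by blast
      then have "?D (frechet_derivative R (at (c m)) (C.coords t)) = 0" by metis
      then show "t f = 0" using DR C.tangent_eq_coord_field[OF m(2) tT] by metis
    qed
  qed
qed

lemma tangent_sub_P:
  assumes m: "m \<in> P" shows "tangent_sub M P m = tangent_nu m"
proof -
  note mp = P_points[OF m]
  obtain c \<kappa> U E where c: "m \<in> U" "linear_chart M c \<kappa> U E W"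
    by (rule manifold_linear_chart[OF manifoldM mp], rule that)
  have kills: "M.kills_on P m t" if "t \<in> tangent_nu m" for t
    by (rule zero_level_retraction[OF c(2) m c(1)]) (use that in blast)
  have "t \<in> tangent_nu m" if "t \<in> tangent M m" "M.kills_on P m t" for t
  proof -
    have "t (\<lambda>y. \<nu> a y \<xi>) = 0" if a: "a \<in> {1,2,3}" and \<xi>: "\<xi> \<in> \<gg>" for a \<xi>
    proof -
      have "nbhd M m (points M) \<and> (\<forall>y\<in>points M \<inter> P. \<nu> a y \<xi> = 0)"
        using mp P_nu[OF _ a \<xi>] by (simp add: nbhd_def)
      then have "\<exists>U. nbhd M m U \<and> (\<forall>y\<in>U \<inter> P. \<nu> a y \<xi> = 0)" by (rule exI)
      then show ?thesis
        by (rule \<open>M.kills_on P m t\<close>[unfolded M.kills_on_def, rule_format, OF nu_germ[OF a mp \<xi>]])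
    qed
    then show ?thesis unfolding tangent_nu_def using that(1) by blast
  qed
  then show ?thesis using M.tangent_sub_iff[OF mp m] kills tangent_nuD(1) by blast
qed

lemma horizontal_eq_hor:
  assumes "m \<in> P" shows "horizontal G S M J \<nu> m = hor m"
  unfolding horizontal_def hor_def tangent_sub_P[OF assms] twisted_dnu_eq by simp

section \<open>Separating the group from the identity\<close>

text \<open>
  For \<open>h\<close> outside \<open>K\<close>, freeness gives \<open>\<phi> h m \<noteq> m\<close>, and continuity provides a neighbourhood of \<open>h\<close> all of
  whose elements move points near \<open>m\<close> away from \<open>m\<close>. Compactness leaves finitely many of these neighbourhoods.
\<close>

lemma separating_nbhd:
  assumes m: "m \<in> P" and K: "openin (topo S) K" "\<one>\<^bsub>G\<^esub> \<in> K"
  obtains E1 where "nbhd M m E1" "\<And>k x. k \<in> carrier G \<Longrightarrow> x \<in> E1 \<Longrightarrow> \<phi> k x \<in> E1 \<Longrightarrow> k \<in> K"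
proof -
  note mp = P_points[OF m]
  have "\<forall>h\<in>carrier G - K. \<exists>q. openin (topo S) (fst q) \<and> h \<in> fst q \<and> nbhd M m (fst (snd q)) \<and>
      nbhd M m (snd (snd q)) \<and> (\<forall>k\<in>fst q. \<forall>x\<in>fst (snd q). \<phi> k x \<notin> snd (snd q))"
  proof
    fix h assume h: "h \<in> carrier G - K"
    have "h \<notin> stabilizer G \<phi> m" unfolding free[OF m] using h K(2) by auto
    then have "\<phi> h m \<noteq> m" using h by (simp add: stabilizer_def)
    moreover have "Hausdorff_space (topo M)" using manifoldM by (simp add: manifold_def)
    ultimately obtain A B where AB: "openin (topo M) A" "openin (topo M) B" "\<phi> h m \<in> A" "m \<in> B" "disjnt A B"
    proof -
      have "\<phi> h m \<in> points M" using act_closed[of h m] h mp by simp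
      then show ?thesis
        using that \<open>Hausdorff_space (topo M)\<close> \<open>\<phi> h m \<noteq> m\<close> mp unfolding Hausdorff_space_def by blast
    qed
    let ?Q = "{z \<in> topspace (prod_topology (topo S) (topo M)). (\<lambda>(h, x). \<phi> h x) z \<in> A}"
    have op: "openin (prod_topology (topo S) (topo M)) ?Q"
      by (rule openin_continuous_map_preimage[OF act_cont AB(1)])
    have mem: "(h, m) \<in> ?Q" using h mp AB(3) by (simp add: points_S)
    obtain C D where CD: "openin (topo S) C" "openin (topo M) D" "h \<in> C" "m \<in> D" "C \<times> D \<subseteq> ?Q"
      using op[unfolded openin_prod_topology_alt, rule_format, OF mem] by (elim exE conjE)
    have "\<forall>k\<in>C. \<forall>x\<in>D. \<phi> k x \<notin> B" using CD(5) AB(5) by (auto simp: disjnt_iff)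
    then show "\<exists>q. openin (topo S) (fst q) \<and> h \<in> fst q \<and> nbhd M m (fst (snd q)) \<and>
      nbhd M m (snd (snd q)) \<and> (\<forall>k\<in>fst q. \<forall>x\<in>fst (snd q). \<phi> k x \<notin> snd (snd q))"
      using CD AB by (intro exI[of _ "(C, D, B)"]) (auto simp: nbhd_def)
  qed
  from bchoice[OF this] obtain q where q: "\<forall>h\<in>carrier G - K. openin (topo S) (fst (q h)) \<and> h \<in> fst (q h) \<and>
      nbhd M m (fst (snd (q h))) \<and> nbhd M m (snd (snd (q h))) \<and>
      (\<forall>k\<in>fst (q h). \<forall>x\<in>fst (snd (q h)). \<phi> k x \<notin> snd (snd (q h)))" ..
  define C D B where "C = (\<lambda>h. fst (q h))" and "D = (\<lambda>h. fst (snd (q h)))" and "B = (\<lambda>h. snd (snd (q h)))"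
  have CDB: "\<And>h. h \<in> carrier G - K \<Longrightarrow> openin (topo S) (C h)"
    "\<And>h. h \<in> carrier G - K \<Longrightarrow> h \<in> C h" "\<And>h. h \<in> carrier G - K \<Longrightarrow> nbhd M m (D h)"
    "\<And>h. h \<in> carrier G - K \<Longrightarrow> nbhd M m (B h)"
    "\<And>h k x. h \<in> carrier G - K \<Longrightarrow> k \<in> C h \<Longrightarrow> x \<in> D h \<Longrightarrow> \<phi> k x \<notin> B h"
    using q by (auto simp: C_def D_def B_def)
  have "closedin (topo S) (carrier G - K)"
    using closedin_diff[OF closedin_topspace K(1)] points_S by metis
  then have "compactin (topo S) (carrier G - K)" by (rule closedin_compact_space[OF compactS])
  note cover = this[unfolded compactin_def, THEN conjunct2, rule_format]
  have "\<exists>F. finite F \<and> F \<subseteq> C ` (carrier G - K) \<and> carrier G - K \<subseteq> \<Union>F"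
    by (rule cover) (use CDB(1,2) in auto)
  then obtain F where F: "finite F" "F \<subseteq> C ` (carrier G - K)" "carrier G - K \<subseteq> \<Union>F" by blast
  obtain H where H: "H \<subseteq> carrier G - K" "finite H" "F = C ` H"
    using finite_subset_image[OF F(1,2)] by blast
  then have H: "finite H" "H \<subseteq> carrier G - K" "carrier G - K \<subseteq> \<Union> (C ` H)" using F(3) by auto
  define E1 where "E1 = (\<Inter>h\<in>H. D h \<inter> B h) \<inter> points M"
  have "openin (topo M) E1" unfolding E1_def
    by (rule openin_INT[OF H(1)]) (use CDB(3,4) H(2) in \<open>auto simp: nbhd_def\<close>)
  then have "nbhd M m E1" using CDB(3,4) H(2) mp by (auto simp: nbhd_def E1_def)
  moreover have "k \<in> K" if k: "k \<in> carrier G" and x: "x \<in> E1" "\<phi> k x \<in> E1" for k x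
  proof (rule ccontr)
    assume "k \<notin> K"
    then obtain h where "h \<in> H" "k \<in> C h" using k H(3) by blast
    then show False using CDB(5)[of h k x] H(2) x by (auto simp: E1_def)
  qed
  ultimately show ?thesis using that by blast
qed

end

section \<open>Slices\<close>

context reduction
begin

lemma act_open_coords:
  assumes lc: "linear_chart M c \<kappa> U E W" and T: "openin (topo M) T"
  shows "open {q. fst q \<in> ES \<and> snd q \<in> E \<and> \<phi> (\<kappa>S (fst q)) (\<kappa> (snd q)) \<in> T}"
proof -
  interpret C: linear_chart M c \<kappa> U E W by fact
  let ?D = "top_of_set (ES \<times> E)"
  have oD: "open (ES \<times> E)" by (rule open_Times[OF SC.openE C.openE])
  have f: "continuous_map ?D (top_of_set ES) fst" "continuous_map ?D (top_of_set E) snd"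
    by (auto intro!: continuous_intros)
  have "continuous_map ?D (prod_topology (topo S) (topo M)) (\<lambda>q. ((\<kappa>S \<circ> fst) q, (\<kappa> \<circ> snd) q))"
    by (intro continuous_map_pairedI continuous_map_compose[OF f(1) SC.continuous_map_\<kappa>]
        continuous_map_compose[OF f(2) C.continuous_map_\<kappa>])
  from continuous_map_compose[OF this act_cont]
  have "continuous_map ?D (topo M) (\<lambda>q. \<phi> (\<kappa>S (fst q)) (\<kappa> (snd q)))" by (simp add: o_def)
  from openin_continuous_map_preimage[OF this T]
  have "open {q \<in> ES \<times> E. \<phi> (\<kappa>S (fst q)) (\<kappa> (snd q)) \<in> T}" by (simp add: openin_open_eq[OF oD])
  moreover have "{q \<in> ES \<times> E. \<phi> (\<kappa>S (fst q)) (\<kappa> (snd q)) \<in> T} =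
      {q. fst q \<in> ES \<and> snd q \<in> E \<and> \<phi> (\<kappa>S (fst q)) (\<kappa> (snd q)) \<in> T}" by auto
  ultimately show ?thesis by simp
qed

text \<open>
  The map \<open>r\<close> moves points near \<open>m\<close> along their orbits into a slice through \<open>m\<close>. The equation that defines the
  slice has \<open>I\<^sub>1 d\<nu>\<^sub>1\<close> as its derivative at \<open>m\<close>. By transversality it can be solved for a group
  element \<open>g y\<close> near 1 with \<open>r y = \<phi> (g y) y\<close> in the slice.

  The map \<open>r\<close> is constant on the intersection of each orbit with the neighbourhood \<open>E1\<close>: if \<open>y\<close> and \<open>\<phi> k y\<close>
  are close to \<open>m\<close>, then \<open>k\<close> is close to 1 by \<open>separating_nbhd\<close>, so \<open>g y \<otimes> k\<inverse>\<close> is a small solution at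
  \<open>\<phi> k y\<close> and equals \<open>g (\<phi> k y)\<close> by uniqueness.
\<close>

lemma slice_exists:
  assumes m: "m \<in> P" and D: "nbhd M m D"
  obtains r E1 where "nbhd M m E1" "r m = m" "\<And>y. y \<in> E1 \<Longrightarrow> \<exists>k\<in>carrier G. r y = \<phi> k y"
    "\<And>y. y \<in> E1 \<Longrightarrow> r y \<in> D"
    "\<And>y f. y \<in> E1 \<Longrightarrow> f \<in> germs M (r y) \<Longrightarrow> (\<lambda>y. f (r y)) \<in> germs M y"
    "\<And>T. openin (topo M) T \<Longrightarrow> openin (topo M) {y \<in> E1. r y \<in> T}"
    "\<And>k y. k \<in> carrier G \<Longrightarrow> y \<in> E1 \<Longrightarrow> \<phi> k y \<in> E1 \<Longrightarrow> r (\<phi> k y) = r y"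
    "\<And>t. t \<in> tangent M m \<Longrightarrow> \<exists>\<xi>\<in>\<gg>. \<forall>f\<in>germs M m. t (\<lambda>y. f (r y)) = t f + gen \<xi> m f"
    "\<And>\<eta>. \<eta> \<in> \<gg> \<Longrightarrow> \<exists>Y\<in>germs M m. (\<forall>t\<in>tangent M m. t Y = twisted_dnu J \<nu> 1 m t \<eta>) \<and> (\<forall>y\<in>E1. Y (r y) = 0)"
proof -
  note mpt = P_points[OF m]
  obtain c \<kappa> U E where mU: "m \<in> U" and lc: "linear_chart M c \<kappa> U E W"
    by (rule manifold_linear_chart[OF manifoldM mpt], rule that)
  interpret C: linear_chart M c \<kappa> U E W by fact
  let ?P = "proj_onto V"
  note linP = linear_proj_onto[OF SC.subspaceW]
  define z0 where "z0 = cS \<one>\<^bsub>G\<^esub>"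
  have z0: "z0 \<in> ES" "\<kappa>S z0 = \<one>\<^bsub>G\<^esub>" "?P z0 = z0"
    using SC.cE[OF one_US] SC.\<kappa>c[OF one_US] proj_onto_id[OF SC.subspaceW SC.c_W[OF one_US]] by (auto simp: z0_def)
  have cm: "c m \<in> E" "\<kappa> (c m) = m" using C.cE[OF mU] C.\<kappa>c[OF mU] by auto
  define \<Phi> where "\<Phi> = (\<lambda>q. c (\<phi> (\<kappa>S (fst q)) (\<kappa> (snd q))))"
  have coordb: "(\<lambda>y. c y \<bullet> b) \<in> germs M (\<phi> (\<kappa>S z0) (\<kappa> (c m)))" for b
    using C.coord_germ[OF mU] by (simp add: z0 cm act_one[OF mpt])
  have "\<exists>Q. open Q \<and> (z0, c m) \<in> Q \<and> Q \<subseteq> ES \<times> E \<and> smooth_on Q (\<lambda>q. \<Phi> q \<bullet> b)" for b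
  proof -
    have g: "(\<lambda>(k, y). c (\<phi> k y) \<bullet> b) \<in> germs (smooth_product V W S M) (\<kappa>S z0, \<kappa> (c m))"
      by (rule act_germ[OF _ _ coordb, of b]) (simp_all add: z0 cm mpt)
    obtain Q where "open Q" "(z0, c m) \<in> Q" "Q \<subseteq> ES \<times> E"
      "smooth_on Q (\<lambda>(p, q). (\<lambda>(k, y). c (\<phi> k y) \<bullet> b) (\<kappa>S p, \<kappa> q))"
      by (rule product_germ_coords[OF chartS lc z0(1) cm(1) g], rule that)
    then show ?thesis by (intro exI[of _ Q]) (simp add: \<Phi>_def case_prod_unfold)
  qed
  then obtain Qb where Qb: "\<And>b. open (Qb b)" "\<And>b. (z0, c m) \<in> Qb b" "\<And>b. Qb b \<subseteq> ES \<times> E"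
    "\<And>b. smooth_on (Qb b) (\<lambda>q. \<Phi> q \<bullet> b)" by metis
  define Q where "Q = (\<Inter>b\<in>Basis. Qb b) \<inter> {q. fst q \<in> ES \<and> snd q \<in> E \<and> \<phi> (\<kappa>S (fst q)) (\<kappa> (snd q)) \<in> U}"
  have oQ: "open Q" unfolding Q_def
    by (intro open_Int open_INT finite_Basis ballI Qb act_open_coords[OF lc C.openU])
  have zQ: "(z0, c m) \<in> Q" using Qb(2) z0 cm act_one[OF mpt] mU by (simp add: Q_def)
  have QD: "fst q \<in> ES" "snd q \<in> E" "\<phi> (\<kappa>S (fst q)) (\<kappa> (snd q)) \<in> U" if "q \<in> Q" for q
    using that by (auto simp: Q_def)
  have \<Phi>: "vsmooth_on Q \<Phi>"
    unfolding vsmooth_on_def using Qb(4) by (auto simp: Q_def intro: smooth_on_subset)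
  (* The slice is the zero set of e (c y - c m). The differential of this function at m is
     I_1 d nu_1, so that the slice is tangent to the horizontal space. *)
  define e where "e = (\<lambda>w. \<Sum>b\<in>Basis. twisted_dnu J \<nu> 1 m (C.coord_field w m) (xi b) *\<^sub>R b)"
  have e_inner: "e w \<bullet> u = twisted_dnu J \<nu> 1 m (C.coord_field w m) (xi u)" for w u
  proof -
    have JT: "J 1 m (C.coord_field w m) \<in> tangent M m" by (rule J_tangent[OF _ mpt C.coord_field_tangent[OF mU]]) simp
    have t: "twisted_dnu J \<nu> 1 m (C.coord_field w m) (xi u) = - J 1 m (C.coord_field w m) (\<lambda>y. nuhat 1 y \<bullet> u)" for u
      using nuhat_tangent[OF _ mpt JT, of 1 u] by (simp add: twisted_dnu_eq)
    have "J 1 m (C.coord_field w m) (\<lambda>y. nuhat 1 y \<bullet> u) =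
        (\<Sum>b\<in>Basis. J 1 m (C.coord_field w m) (\<lambda>y. nuhat 1 y \<bullet> b) *\<^sub>R b) \<bullet> u"
      by (rule M.tangent_vector[OF mpt JT nuhat_germ[OF _ mpt]]) simp
    then show ?thesis unfolding e_def t by (simp add: inner_sum_left sum_negf del: One_nat_def)
  qed
  have e_lin: "linear e"
  proof (rule linearI)
    have cf: "C.coord_field w m \<in> tangent M m" for w by (rule C.coord_field_tangent[OF mU])
    have one: "1 \<in> {1, 2, 3::nat}" by simp
    have Ja: "J 1 m (C.coord_field (w + w') m) f = J 1 m (C.coord_field w m) f + J 1 m (C.coord_field w' m) f" for w w' f
      unfolding C.coord_field_add[OF mU] J_add[OF one mpt cf cf] by (simp add: tadd_def)
    have Js: "J 1 m (C.coord_field (r *\<^sub>R w) m) f = r * J 1 m (C.coord_field w m) f" for r w f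
      unfolding C.coord_field_scale[OF mU] J_scale[OF one mpt cf] by (simp add: tscale_def)
    show "e (w + w') = e w + e w'" for w w'
      by (simp add: e_def twisted_dnu_eq Ja scaleR_add_left sum.distrib scaleR_diff_left sum_subtractf
          sum_negf del: One_nat_def)
    show "e (r *\<^sub>R w) = r *\<^sub>R e w" for r w
      by (simp add: e_def twisted_dnu_eq Js scaleR_sum_right sum_negf del: One_nat_def)
  qed
  have eV: "?P (e w) = e w" for w
  proof -
    have "?P (e w) \<bullet> u = e w \<bullet> u" for u
      using e_inner xi_proj proj_onto_adjoint[OF SC.subspaceW] by simp
    then show ?thesis by (metis vector_eq_rdot)
  qed
  have e_coords: "e (C.coords t) \<bullet> u = twisted_dnu J \<nu> 1 m t (xi u)" if "t \<in> tangent M m" for t u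
    using e_inner C.tangent_eq_coord_field[OF mU that] by metis
  define F where "F = (\<lambda>q. e (\<Phi> q - c m) + (fst q - ?P (fst q)))"
  have linF: "linear (\<lambda>q :: 'b \<times> 'a. fst q - ?P (fst q))"
    using linP by (simp add: linear_iff algebra_simps)
  have F: "vsmooth_on Q F" unfolding F_def
    by (intro vsmooth_on_add vsmooth_on_linear_compose[OF _ e_lin] vsmooth_on_diff vsmooth_on_const \<Phi> oQ
        vsmooth_on_linear[OF oQ linF])
  have \<Phi>0: "\<Phi> (z0, c m) = c m" by (simp add: \<Phi>_def z0 cm act_one[OF mpt])
  have F0: "F (z0, c m) = 0" by (simp add: F_def \<Phi>0 linear_0[OF e_lin] z0(3))
  let ?D\<Phi> = "frechet_derivative \<Phi> (at (z0, c m))"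
  have D\<Phi>: "(\<Phi> has_derivative ?D\<Phi>) (at (z0, c m))" by (rule vsmooth_on_derivative[OF \<Phi> zQ])
  (* Derivatives in the direction of the group are given by the generated vector fields. *)
  have orb: "H (v, 0) = gen (xi v) m f"
    if f: "f \<in> germs M m" and H: "(h has_derivative H) (at (z0, c m))"
      and hf: "\<And>z. z \<in> T \<Longrightarrow> h (z, c m) = f (\<phi> (\<kappa>S z) m)" and T: "open T" "z0 \<in> T"
    for f h H T v
  proof -
    have g: "(\<lambda>k. f (\<phi> k m)) \<in> germs S \<one>\<^bsub>G\<^esub>" by (rule act_germ_fst[OF mpt f])
    have "((\<lambda>z. h (z, c m)) has_derivative (\<lambda>v. H (v, 0))) (at z0)"
      by (rule has_derivative_compose[OF has_derivative_Pair[OF has_derivative_ident has_derivative_const] H])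
    then have "((\<lambda>k. f (\<phi> k m)) \<circ> \<kappa>S has_derivative (\<lambda>v. H (v, 0))) (at z0)"
      by (rule has_derivative_transform_within_open[OF _ T]) (simp add: hf)
    from SC.coord_field_eqI[OF one_US g this[unfolded z0_def]]
    show ?thesis using f by (simp add: gen_eq[OF mpt] xi_def z0_def)
  qed
  have D\<Phi>v: "?D\<Phi> (v, 0) = C.coords (gen (xi v) m)" for v
  proof -
    have "?D\<Phi> (v, 0) \<bullet> b = C.coords (gen (xi v) m) \<bullet> b" for b
    proof -
      have "((\<lambda>q. \<Phi> q \<bullet> b) has_derivative (\<lambda>w. ?D\<Phi> w \<bullet> b)) (at (z0, c m))"
        by (rule derivative_eq_intros D\<Phi> | simp)+
      from orb[OF C.coord_germ[OF mU] this, of UNIV b v]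
      have "?D\<Phi> (v, 0) \<bullet> b = gen (xi v) m (\<lambda>y. c y \<bullet> b)" by (simp add: \<Phi>_def cm)
      then show ?thesis using C.tangent_inner[OF mU gen_tangent[OF mpt xi_mem]] by simp
    qed
    then show ?thesis by (metis vector_eq_rdot)
  qed
  have DF: "(F has_derivative (\<lambda>w. e (?D\<Phi> w) + (fst w - ?P (fst w)))) (at (z0, c m))"
    unfolding F_def
  proof (rule has_derivative_add)
    have "((\<lambda>q. \<Phi> q - c m) has_derivative ?D\<Phi>) (at (z0, c m))"
      using has_derivative_diff[OF D\<Phi> has_derivative_const] by simp
    then show "((\<lambda>q. e (\<Phi> q - c m)) has_derivative (\<lambda>w. e (?D\<Phi> w))) (at (z0, c m))"
      by (rule has_derivative_compose[OF _ bounded_linear_imp_has_derivative]) (use e_lin linear_linear in blast)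
    show "((\<lambda>q. fst q - ?P (fst q)) has_derivative (\<lambda>w. fst w - ?P (fst w))) (at (z0, c m))"
      by (rule bounded_linear_imp_has_derivative) (use linF linear_linear in blast)
  qed
  have inj: "v = 0" if "frechet_derivative F (at (z0, c m)) (v, 0) = 0" for v
  proof -
    have eq: "e (?D\<Phi> (v, 0)) + (v - ?P v) = 0"
      using that frechet_derivative_at[OF DF, symmetric] by simp
    then have "?P (e (?D\<Phi> (v, 0)) + (v - ?P v)) = 0" using linear_0[OF linP] by simp
    then have e0: "e (?D\<Phi> (v, 0)) = 0"
      by (simp add: linear_add[OF linP] linear_diff[OF linP] eV proj_onto_id[OF SC.subspaceW proj_onto_mem[OF SC.subspaceW]])
    then have "?P v = v" using eq by simp
    moreover have "xi v = tzero"
    proof (rule transversal[OF _ mpt xi_mem])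
      show "twisted_dnu J \<nu> 1 m (gen (xi v) m) \<eta> = 0" if "\<eta> \<in> \<gg>" for \<eta>
        using e_coords[OF gen_tangent[OF mpt xi_mem], of v "SC.coords \<eta>"] e0 xi_surj[OF that]
        by (simp add: D\<Phi>v)
    qed simp
    ultimately show ?thesis using xi_zero by blast
  qed
  obtain Z X \<eta> where IFT: "open Z" "open X" "z0 \<in> Z" "c m \<in> X" "Z \<times> X \<subseteq> Q" "vsmooth_on X \<eta>" "\<eta> ` X \<subseteq> Z"
    "\<And>z x. z \<in> Z \<Longrightarrow> x \<in> X \<Longrightarrow> F (z, x) = 0 \<longleftrightarrow> z = \<eta> x"
    by (rule smooth_implicit_function[OF oQ F zQ F0 inj], assumption, rule that)
  have \<eta>m: "\<eta> (c m) = z0" using IFT(8)[OF IFT(3,4)] F0 by simp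
  have \<eta>Q: "(\<eta> p, p) \<in> Q" if "p \<in> X" for p using IFT(5,7) that by blast
  have \<eta>cont: "continuous_on X (\<lambda>p. (\<eta> p, p))"
    by (intro continuous_intros vsmooth_on_continuous[OF IFT(6)])
  define E0 where "E0 = {y \<in> U. c y \<in> X}"
  define g where "g = (\<lambda>y. \<kappa>S (\<eta> (c y)))"
  define r where "r = (\<lambda>y. \<phi> (g y) y)"
  have oE0: "openin (topo M) E0" unfolding E0_def by (rule C.c_cont[OF IFT(2)])
  have mE0: "m \<in> E0" using mU IFT(4) by (simp add: E0_def)
  have gy: "g y \<in> carrier G" "r y \<in> U" "e (c (r y) - c m) = 0" if "y \<in> E0" for y
  proof -
    have y: "y \<in> U" "c y \<in> X" "\<kappa> (c y) = y" using that C.\<kappa>c by (auto simp: E0_def)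
    note q = \<eta>Q[OF y(2)]
    show "g y \<in> carrier G" using SC.\<kappa>_points[of "\<eta> (c y)"] QD(1)[OF q] by (simp add: g_def points_S)
    show "r y \<in> U" using QD(3)[OF q] y(3) by (simp add: r_def g_def)
    have "F (\<eta> (c y), c y) = 0" using IFT(7,8) y(2) by blast
    then have "?P (F (\<eta> (c y), c y)) = 0" using linear_0[OF linP] by simp
    then show "e (c (r y) - c m) = 0"
      by (simp add: F_def \<Phi>_def y(3) r_def g_def linear_add[OF linP] linear_diff[OF linP] eV
          proj_onto_id[OF SC.subspaceW proj_onto_mem[OF SC.subspaceW]])
  qed
  have gm: "g m = \<one>\<^bsub>G\<^esub>" by (simp add: g_def \<eta>m z0)
  have rm: "r m = m" by (simp add: r_def gm act_one[OF mpt])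
  have uniq: "g y = k" if y: "y \<in> E0" and k: "k \<in> US" "cS k \<in> Z" and ek: "e (c (\<phi> k y) - c m) = 0" for y k
  proof -
    have y': "c y \<in> X" "\<kappa> (c y) = y" using y C.\<kappa>c by (auto simp: E0_def)
    have "F (cS k, c y) = 0"
      using ek proj_onto_id[OF SC.subspaceW SC.c_W[OF k(1)]] by (simp add: F_def \<Phi>_def y' SC.\<kappa>c[OF k(1)])
    then have "cS k = \<eta> (c y)" using IFT(8)[OF k(2) y'(1)] by simp
    then show ?thesis using SC.\<kappa>c[OF k(1)] by (simp add: g_def)
  qed
  have g_open: "openin (topo M) {y \<in> E0. g y \<in> T}" if T: "openin (topo S) T" for T
  proof -
    have "open (X \<inter> \<eta> -` {z \<in> ES. \<kappa>S z \<in> T})"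
      by (rule continuous_open_preimage[OF vsmooth_on_continuous[OF IFT(6)] IFT(2) SC.\<kappa>_cont[OF T]])
    from C.c_cont[OF this] have "openin (topo M) {y \<in> U. c y \<in> X \<inter> \<eta> -` {z \<in> ES. \<kappa>S z \<in> T}}" .
    moreover have "{y \<in> U. c y \<in> X \<inter> \<eta> -` {z \<in> ES. \<kappa>S z \<in> T}} = {y \<in> E0. g y \<in> T}"
      using \<eta>Q QD(1) by (fastforce simp: E0_def g_def)
    ultimately show ?thesis by simp
  qed
  have r_open: "openin (topo M) {y \<in> E0. r y \<in> T}" if T: "openin (topo M) T" for T
  proof -
    have "open (X \<inter> (\<lambda>p. (\<eta> p, p)) -` {q. fst q \<in> ES \<and> snd q \<in> E \<and> \<phi> (\<kappa>S (fst q)) (\<kappa> (snd q)) \<in> T})"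
      by (rule continuous_open_preimage[OF \<eta>cont IFT(2) act_open_coords[OF lc T]])
    from C.c_cont[OF this]
    have "openin (topo M) {y \<in> U. c y \<in> X \<inter> (\<lambda>p. (\<eta> p, p)) -` {q. fst q \<in> ES \<and> snd q \<in> E \<and> \<phi> (\<kappa>S (fst q)) (\<kappa> (snd q)) \<in> T}}" .
    moreover have "{y \<in> U. c y \<in> X \<inter> (\<lambda>p. (\<eta> p, p)) -` {q. fst q \<in> ES \<and> snd q \<in> E \<and> \<phi> (\<kappa>S (fst q)) (\<kappa> (snd q)) \<in> T}}
        = {y \<in> E0. r y \<in> T}"
      using \<eta>Q QD(1,2) C.\<kappa>c by (fastforce simp: E0_def g_def r_def)
    ultimately show ?thesis by simp
  qed
  (* In coordinates, f \<circ> r is (z, p) \<mapsto> f (\<phi> (\<kappa>S z) (\<kappa> p)) with the solution \<eta> p substituted for z. *)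
  have fr: "\<exists>Q' T. open Q' \<and> (\<eta> (c y), c y) \<in> Q' \<and> Q' \<subseteq> ES \<times> E \<and> smooth_on Q' (\<lambda>q. f (\<phi> (\<kappa>S (fst q)) (\<kappa> (snd q)))) \<and>
      open T \<and> c y \<in> T \<and> T \<subseteq> X \<and> (\<forall>p\<in>T. (\<eta> p, p) \<in> Q') \<and>
      smooth_on T (\<lambda>p. f (\<phi> (\<kappa>S (\<eta> p)) (\<kappa> p)))"
    if y: "y \<in> E0" and f: "f \<in> germs M (r y)" for y f
  proof -
    have y': "y \<in> U" "c y \<in> X" "\<kappa> (c y) = y" using y C.\<kappa>c by (auto simp: E0_def)
    have fg: "f \<in> germs M (\<phi> (\<kappa>S (\<eta> (c y))) (\<kappa> (c y)))" using f by (simp add: y' r_def g_def)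
    have "\<kappa>S (\<eta> (c y)) \<in> carrier G" "\<kappa> (c y) \<in> points M" using gy(1)[OF y] C.U_points y' by (auto simp: g_def)
    note gp = act_germ[OF this fg]
    obtain Q' where Q': "open Q'" "(\<eta> (c y), c y) \<in> Q'" "Q' \<subseteq> ES \<times> E"
      "smooth_on Q' (\<lambda>(p, q). (\<lambda>(k, y). f (\<phi> k y)) (\<kappa>S p, \<kappa> q))"
      by (rule product_germ_coords[OF chartS lc QD(1)[OF \<eta>Q[OF y'(2)], simplified] QD(2)[OF \<eta>Q[OF y'(2)], simplified] gp], rule that)
    have sm: "smooth_on Q' (\<lambda>q. f (\<phi> (\<kappa>S (fst q)) (\<kappa> (snd q))))" using Q'(4) by (simp add: case_prod_unfold)
    define T where "T = X \<inter> (\<lambda>p. (\<eta> p, p)) -` Q'"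
    have oT: "open T" unfolding T_def by (rule continuous_open_preimage[OF \<eta>cont IFT(2) Q'(1)])
    have "vsmooth_on T (\<lambda>p. (\<eta> p, p))"
      by (rule vsmooth_on_Pair[OF vsmooth_on_subset[OF IFT(6)] vsmooth_on_linear[OF oT linear_id[unfolded id_def]]])
        (auto simp: T_def)
    then have "smooth_on T (\<lambda>p. f (\<phi> (\<kappa>S (fst (\<eta> p, p))) (\<kappa> (snd (\<eta> p, p)))))"
      by (rule smooth_on_compose[where F = "\<lambda>p. (\<eta> p, p)", OF oT _ sm, rotated]) (auto simp: T_def)
    then show ?thesis using Q' sm oT y'(2) by (intro exI[of _ Q'] exI[of _ T]) (auto simp: T_def)
  qed
  have r_smooth: "(\<lambda>y. f (r y)) \<in> germs M y" if y: "y \<in> E0" and f: "f \<in> germs M (r y)" for y f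
  proof -
    obtain T where T: "open T" "c y \<in> T" "smooth_on T (\<lambda>p. f (\<phi> (\<kappa>S (\<eta> p)) (\<kappa> p)))" using fr[OF y f] by blast
    have yU: "y \<in> U" using y by (simp add: E0_def)
    show ?thesis
      by (rule M.cong_germ[OF C.c_smooth[OF yU T] C.nbhd_U[OF yU]]) (simp add: r_def g_def C.\<kappa>c)
  qed
  have r_diff: "\<exists>\<xi>\<in>\<gg>. \<forall>f\<in>germs M m. t (\<lambda>y. f (r y)) = t f + gen \<xi> m f" if t: "t \<in> tangent M m" for t
  proof (intro bexI ballI)
    let ?D\<eta> = "frechet_derivative \<eta> (at (c m))"
    let ?w = "C.coords t"
    show "xi (?D\<eta> ?w) \<in> \<gg>" by (rule xi_mem)
    fix f assume f: "f \<in> germs M m"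
    then have f': "f \<in> germs M (r m)" by (simp add: rm)
    obtain Q' T where T: "open Q'" "(z0, c m) \<in> Q'" "Q' \<subseteq> ES \<times> E" "smooth_on Q' (\<lambda>q. f (\<phi> (\<kappa>S (fst q)) (\<kappa> (snd q))))"
      "open T" "c m \<in> T" "T \<subseteq> X" "\<forall>p\<in>T. (\<eta> p, p) \<in> Q'" "smooth_on T (\<lambda>p. f (\<phi> (\<kappa>S (\<eta> p)) (\<kappa> p)))"
      using fr[OF mE0 f'] unfolding \<eta>m by blast
    define h where "h = (\<lambda>q. f (\<phi> (\<kappa>S (fst q)) (\<kappa> (snd q))))"
    let ?H = "frechet_derivative h (at (z0, c m))"
    have H: "(h has_derivative ?H) (at (z0, c m))" unfolding h_def by (rule smooth_on_derivative[OF T(4,2)])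
    have Hlin: "linear ?H" using H has_derivative_linear by blast
    have D\<eta>: "(\<eta> has_derivative ?D\<eta>) (at (c m))" by (rule vsmooth_on_derivative[OF IFT(6,4)])
    have "((\<lambda>p. h (\<eta> p, p)) has_derivative (\<lambda>w. ?H (?D\<eta> w, w))) (at (c m))"
      by (rule has_derivative_compose[OF has_derivative_Pair[OF D\<eta> has_derivative_ident]]) (simp only: \<eta>m H)
    then have K: "((\<lambda>p. f (\<phi> (\<kappa>S (\<eta> p)) (\<kappa> p))) has_derivative (\<lambda>w. ?H (?D\<eta> w, w))) (at (c m))"
      by (simp add: h_def)
    have "t (\<lambda>y. f (r y)) = t (\<lambda>y. f (\<phi> (\<kappa>S (\<eta> (c y))) (\<kappa> (c y))))"
      by (rule M.tangent_cong[OF t C.c_smooth[OF mU T(5,6,9), unfolded o_def] C.nbhd_U[OF mU]])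
        (simp add: r_def g_def C.\<kappa>c)
    also have "\<dots> = ?H (?D\<eta> ?w, ?w)" by (rule C.tangent_coord_fun[OF mU t T(5,6,9) K])
    also have "(?D\<eta> ?w, ?w) = (?D\<eta> ?w, 0) + (0, ?w)" by simp
    also have "?H \<dots> = ?H (?D\<eta> ?w, 0) + ?H (0, ?w)" by (rule linear_add[OF Hlin])
    also have "?H (?D\<eta> ?w, 0) = gen (xi (?D\<eta> ?w)) m f"
      by (rule orb[OF f H _ open_UNIV UNIV_I]) (simp add: h_def cm)
    also have "?H (0, ?w) = t f"
    proof -
      have "((\<lambda>p. h (z0, p)) has_derivative (\<lambda>w. ?H (0, w))) (at (c m))"
        by (rule has_derivative_compose[OF has_derivative_Pair[OF has_derivative_const has_derivative_ident] H])
      then have "(f \<circ> \<kappa> has_derivative (\<lambda>w. ?H (0, w))) (at (c m))"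
        by (rule has_derivative_transform_within_open[OF _ C.openE cm(1)])
          (simp add: h_def z0 act_one C.\<kappa>_points)
      from C.tangent_derivative[OF mU t f this] show ?thesis by simp
    qed
    finally show "t (\<lambda>y. f (r y)) = t f + gen (xi (?D\<eta> ?w)) m f" by simp
  qed
  have r_tang: "\<exists>Y\<in>germs M m. (\<forall>t\<in>tangent M m. t Y = twisted_dnu J \<nu> 1 m t \<zeta>) \<and> (\<forall>y\<in>E0. Y (r y) = 0)"
    if \<zeta>: "\<zeta> \<in> \<gg>" for \<zeta>
  proof (intro bexI conjI ballI)
    let ?u = "SC.coords \<zeta>"
    let ?K = "\<lambda>p. e (p - c m) \<bullet> ?u"
    have vs: "vsmooth_on UNIV (\<lambda>p. e (p - c m))"
      by (intro vsmooth_on_linear_compose[OF _ e_lin] vsmooth_on_diff vsmooth_on_const open_UNIV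
          vsmooth_on_linear linear_id[unfolded id_def])
    note K = vsmooth_on_inner[OF open_UNIV vs]
    show "(\<lambda>y. ?K (c y)) \<in> germs M m" using C.c_smooth[OF mU open_UNIV UNIV_I K] by (simp add: o_def)
    fix t assume t: "t \<in> tangent M m"
    have "(?K has_derivative (\<lambda>w. e w \<bullet> ?u)) (at (c m))"
    proof -
      have "((\<lambda>p. e (p - c m)) has_derivative (\<lambda>w. e w)) (at (c m))"
        by (rule has_derivative_compose[OF _ bounded_linear_imp_has_derivative])
          (auto intro!: derivative_eq_intros simp: linear_linear e_lin)
      then show ?thesis by (rule has_derivative_inner_left)
    qed
    from C.tangent_coord_fun[OF mU t open_UNIV UNIV_I K this]
    show "t (\<lambda>y. ?K (c y)) = twisted_dnu J \<nu> 1 m t \<zeta>"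
      using e_coords[OF t] xi_surj[OF \<zeta>] by simp
  next
    fix y assume "y \<in> E0"
    then show "e (c (r y) - c m) \<bullet> SC.coords \<zeta> = 0" using gy(3) by simp
  qed
  (* The group elements to which the uniqueness statement applies. *)
  define Z' where "Z' = {k \<in> US. cS k \<in> Z}"
  have oZ': "openin (topo S) Z'" unfolding Z'_def by (rule SC.c_cont[OF IFT(1)])
  have oneZ': "\<one>\<^bsub>G\<^esub> \<in> Z'" using one_US IFT(3) by (simp add: Z'_def z0_def)
  have "\<exists>K E'. openin (topo S) K \<and> openin (topo M) E' \<and> \<one>\<^bsub>G\<^esub> \<in> K \<and> m \<in> E' \<and> E' \<subseteq> E0 \<and>
      (\<forall>k\<in>K. \<forall>y\<in>E'. g y \<otimes>\<^bsub>G\<^esub> inv\<^bsub>G\<^esub> k \<in> Z')"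
  proof -
    let ?T = "prod_topology (topo S) (subtopology (topo M) E0)"
    have tE0: "topspace (subtopology (topo M) E0) = E0" using openin_subset[OF oE0] by auto
    have "continuous_map (subtopology (topo M) E0) (topo S) g"
      unfolding continuous_map_def tE0
    proof (intro conjI allI impI)
      show "g \<in> E0 \<rightarrow> topspace (topo S)" using gy(1) by (simp add: points_S)
      fix T assume "openin (topo S) T"
      from g_open[OF this] show "openin (subtopology (topo M) E0) {y \<in> E0. g y \<in> T}"
        by (auto intro: openin_subset_topspace_eq simp: openin_open_subtopology[OF oE0])
    qed
    then have c1: "continuous_map ?T (topo S) (g \<circ> snd)"
      using continuous_map_compose[OF continuous_map_snd] by blast
    have "continuous_map (topo S) (topo S) (\<lambda>h. inv\<^bsub>G\<^esub> h)" using lie by (simp add: lie_group_def smooth_map_def)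
    then have c2: "continuous_map ?T (topo S) ((\<lambda>h. inv\<^bsub>G\<^esub> h) \<circ> fst)"
      using continuous_map_compose[OF continuous_map_fst] by blast
    have c3: "continuous_map (prod_topology (topo S) (topo S)) (topo S) (\<lambda>(h, k). h \<otimes>\<^bsub>G\<^esub> k)"
      using lie by (simp add: lie_group_def smooth_map_def smooth_product_def)
    have c4: "continuous_map ?T (topo S) (\<lambda>q. g (snd q) \<otimes>\<^bsub>G\<^esub> inv\<^bsub>G\<^esub> fst q)"
      using continuous_map_compose[OF continuous_map_pairedI[OF c1 c2] c3] by (simp add: o_def)
    let ?B = "{q \<in> topspace ?T. g (snd q) \<otimes>\<^bsub>G\<^esub> inv\<^bsub>G\<^esub> fst q \<in> Z'}"
    have op: "openin ?T ?B" by (rule openin_continuous_map_preimage[OF c4 oZ'])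
    have mem: "(\<one>\<^bsub>G\<^esub>, m) \<in> ?B" using mE0 tE0 oneZ' by (simp add: gm points_S)
    obtain K E' where KE: "openin (topo S) K" "openin (subtopology (topo M) E0) E'"
      "\<one>\<^bsub>G\<^esub> \<in> K" "m \<in> E'" "K \<times> E' \<subseteq> ?B"
      using op[unfolded openin_prod_topology_alt, rule_format, OF mem] by (elim exE conjE)
    have "openin (topo M) E'" "E' \<subseteq> E0" using KE(2) by (auto simp: openin_open_subtopology[OF oE0])
    then show ?thesis using KE by fastforce
  qed
  then obtain K E' where KE: "openin (topo S) K" "openin (topo M) E'" "\<one>\<^bsub>G\<^esub> \<in> K" "m \<in> E'" "E' \<subseteq> E0"
    "\<And>k y. k \<in> K \<Longrightarrow> y \<in> E' \<Longrightarrow> g y \<otimes>\<^bsub>G\<^esub> inv\<^bsub>G\<^esub> k \<in> Z'" by metis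
  obtain E2 where E2: "nbhd M m E2" "\<And>k x. k \<in> carrier G \<Longrightarrow> x \<in> E2 \<Longrightarrow> \<phi> k x \<in> E2 \<Longrightarrow> k \<in> K"
    by (rule separating_nbhd[OF m KE(1,3)], rule that)
  define E1 where "E1 = E' \<inter> (E2 \<inter> {y \<in> E0. r y \<in> D})"
  have oE1: "openin (topo M) E1" unfolding E1_def
    by (intro openin_Int KE(2) r_open) (use E2(1) D in \<open>auto simp: nbhd_def\<close>)
  have E10: "y \<in> E0" if "y \<in> E1" for y using that by (simp add: E1_def)
  show ?thesis
  proof (rule that[of E1 r])
    show "nbhd M m E1" using oE1 KE(4) E2(1) mE0 rm D by (simp add: nbhd_def E1_def)
    show "r m = m" by (rule rm)
    show "\<exists>k\<in>carrier G. r y = \<phi> k y" if "y \<in> E1" for y using gy(1)[OF E10[OF that]] by (auto simp: r_def)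
    show "r y \<in> D" if "y \<in> E1" for y using that by (simp add: E1_def)
    show "(\<lambda>y. f (r y)) \<in> germs M y" if "y \<in> E1" "f \<in> germs M (r y)" for y f
      by (rule r_smooth[OF E10[OF that(1)] that(2)])
    show "openin (topo M) {y \<in> E1. r y \<in> T}" if T: "openin (topo M) T" for T
    proof -
      have "{y \<in> E1. r y \<in> T} = E1 \<inter> {y \<in> E0. r y \<in> T}" using E10 by auto
      then show ?thesis using openin_Int[OF oE1 r_open[OF T]] by simp
    qed
    show "r (\<phi> k y) = r y" if k: "k \<in> carrier G" and y: "y \<in> E1" "\<phi> k y \<in> E1" for k y
    proof -
      have yp: "y \<in> points M" using openin_subset[OF oE1] y(1) by blast
      have kK: "k \<in> K" by (rule E2(2)[OF k, of y]) (use y in \<open>simp_all add: E1_def\<close>)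
      let ?k = "g y \<otimes>\<^bsub>G\<^esub> inv\<^bsub>G\<^esub> k"
      have z: "?k \<in> US" "cS ?k \<in> Z" using KE(6)[OF kK, of y] y(1) by (auto simp: E1_def Z'_def)
      have eq: "\<phi> ?k (\<phi> k y) = r y"
        using gy(1)[OF E10[OF y(1)]] k yp by (simp add: act_mult act_closed act_inv r_def)
      have "g (\<phi> k y) = ?k" by (rule uniq[OF E10[OF y(2)] z]) (simp add: eq gy(3)[OF E10[OF y(1)]])
      then show ?thesis using eq by (simp add: r_def)
    qed
    show "\<exists>\<xi>\<in>\<gg>. \<forall>f\<in>germs M m. t (\<lambda>y. f (r y)) = t f + gen \<xi> m f" if "t \<in> tangent M m" for t
      by (rule r_diff[OF that])
    show "\<exists>Y\<in>germs M m. (\<forall>t\<in>tangent M m. t Y = twisted_dnu J \<nu> 1 m t \<eta>) \<and> (\<forall>y\<in>E1. Y (r y) = 0)"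
      if "\<eta> \<in> \<gg>" for \<eta> using r_tang[OF that] E10 by blast
  qed
qed

end

section \<open>The reduced space\<close>

context reduction
begin

abbreviation "\<pi> \<equiv> orbit G \<phi>"
abbreviation "N \<equiv> reduced_space G S M \<phi> \<nu>"
abbreviation "PS \<equiv> smooth_subspace M P"
abbreviation "dproj \<equiv> d_proj G S M \<phi> \<nu>"

sublocale PS: germ_space PS by (rule germ_space_subspace[OF M.germ_space_axioms])
sublocale N: germ_space N unfolding reduced_space_def by (rule germ_space_quotient[OF PS.germ_space_axioms])

lemma points_PS: "points PS = P"
  using P_points by auto

lemma points_N: "points N = \<pi> ` P"
  by (simp add: reduced_space_def points_PS del: points_subspace)

lemma orbit_act: 
  assumes "k \<in> carrier G" "x \<in> points M" shows "\<pi> (\<phi> k x) = \<pi> x"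
proof (intro equalityI subsetI)
  fix y assume "y \<in> \<pi> (\<phi> k x)"
  then obtain h where h: "h \<in> carrier G" "y = \<phi> h (\<phi> k x)" by (auto simp: orbit_def)
  then have "y = \<phi> (h \<otimes>\<^bsub>G\<^esub> k) x" using act_mult assms by simp
  then show "y \<in> \<pi> x" using h assms by (auto simp: orbit_def)
next
  fix y assume "y \<in> \<pi> x"
  then obtain h where h: "h \<in> carrier G" "y = \<phi> h x" by (auto simp: orbit_def)
  then have "y = \<phi> (h \<otimes>\<^bsub>G\<^esub> inv\<^bsub>G\<^esub> k) (\<phi> k x)"
    using assms by (simp add: act_mult act_closed act_inv)
  then show "y \<in> \<pi> (\<phi> k x)" using h assms by (auto simp: orbit_def)
qed

lemma orbit_eqD:
  assumes "\<pi> x = \<pi> y" "y \<in> points M" obtains k where "k \<in> carrier G" "y = \<phi> k x"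
proof -
  have "\<phi> \<one>\<^bsub>G\<^esub> y \<in> \<pi> y" using G.one_closed unfolding orbit_def by blast
  then have "y \<in> \<pi> x" using assms act_one by simp
  then show ?thesis using that by (auto simp: orbit_def)
qed

text \<open>
  Smoothness near one point of an orbit suffices, because the action carries it to the other points.
\<close>

lemma N_germI:
  assumes x0: "x0 \<in> P" and F: "F \<in> germs M x0" and T: "nbhd M x0 T" and eq: "\<And>y. y \<in> T \<Longrightarrow> y \<in> P \<Longrightarrow> f (\<pi> y) = F y"
  shows "f \<in> germs N (\<pi> x0)"
  unfolding reduced_space_def germs_quotient points_PS
proof (intro ballI impI)
  fix x assume x: "x \<in> P" "\<pi> x = \<pi> x0"
  obtain k where k: "k \<in> carrier G" "x0 = \<phi> k x" using orbit_eqD[OF x(2) P_points[OF x0]] .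
  note xp = P_points[OF x(1)]
  have Fk: "(\<lambda>y. F (\<phi> k y)) \<in> germs M x" using act_germ_snd[OF k(1) xp] F k(2) by simp
  have nb: "nbhd M x {y \<in> points M. \<phi> k y \<in> T}" using act_openin[OF k(1)] T xp k(2) by (simp add: nbhd_def)
  have e: "\<forall>y\<in>{y \<in> points M. \<phi> k y \<in> T} \<inter> P. (f \<circ> \<pi>) y = F (\<phi> k y)"
  proof
    fix y assume y: "y \<in> {y \<in> points M. \<phi> k y \<in> T} \<inter> P"
    then have "f (\<pi> (\<phi> k y)) = F (\<phi> k y)" using eq P_invariant[OF _ k(1)] by blast
    then show "(f \<circ> \<pi>) y = F (\<phi> k y)" using orbit_act[OF k(1)] y by simp
  qed
  from nb e have "\<exists>U. nbhd M x U \<and> (\<forall>y\<in>U \<inter> P. (f \<circ> \<pi>) y = F (\<phi> k y))"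
    by (intro exI conjI)
  then show "f \<circ> \<pi> \<in> germs PS x" unfolding germs_subspace by (rule bexI[OF _ Fk])
qed

lemma N_germD:
  assumes "x \<in> P" "f \<in> germs N (\<pi> x)"
  obtains F T where "F \<in> germs M x" "nbhd M x T" "\<And>y. y \<in> T \<Longrightarrow> y \<in> P \<Longrightarrow> f (\<pi> y) = F y"
proof -
  have "f \<circ> \<pi> \<in> germs PS x"
    using assms unfolding reduced_space_def germs_quotient points_PS by blast
  then obtain F T where "F \<in> germs M x" "nbhd M x T" "\<forall>y\<in>T \<inter> P. (f \<circ> \<pi>) y = F y"
    unfolding germs_subspace by blast
  then show ?thesis using that by simp
qed

lemma openin_N:
  assumes "V' \<subseteq> \<pi> ` P" "openin (topo M) T" "\<And>x. x \<in> P \<Longrightarrow> \<pi> x \<in> V' \<longleftrightarrow> x \<in> T"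
  shows "openin (topo N) V'"
proof -
  have "{x \<in> P. \<pi> x \<in> V'} = T \<inter> P" using assms(3) by auto
  then have "openin (topo PS) {x \<in> P. \<pi> x \<in> V'}"
    using assms(2) by (auto simp: smooth_subspace_def openin_subtopology)
  then show ?thesis unfolding reduced_space_def openin_quotient points_PS using assms(1) by blast
qed

section \<open>The differential of the projection\<close>

text \<open>
  The value on a function \<open>h\<close> of the reduced space can be read off from any smooth function on \<open>M\<close> that
  extends \<open>h \<circ> \<pi>\<close>.
\<close>

lemma dproj_apply:
  assumes x: "x \<in> P" and t: "t \<in> tangent_nu x" and h: "h \<in> germs N (\<pi> x)"
    and F: "F \<in> germs M x" "nbhd M x T" "\<And>y. y \<in> T \<Longrightarrow> y \<in> P \<Longrightarrow> h (\<pi> y) = F y"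
  shows "dproj x t h = t F"
  using M.tangent_sub_extension[OF P_points[OF x] x t[folded tangent_sub_P[OF x]] F(1,2), of "h \<circ> \<pi>"] F(3) h
  by (simp add: d_proj_def Let_def differential_def)

lemma dproj_tangent:
  assumes x: "x \<in> P" and t: "t \<in> tangent_nu x" shows "dproj x t \<in> tangent N (\<pi> x)"
proof -
  have "t \<in> tangent_incl M P x ` tangent PS x"
    using t tangent_sub_P[OF x] by (simp add: tangent_sub_def)
  then have "the_inv_into (tangent PS x) (tangent_incl M P x) t \<in> tangent PS x"
    using the_inv_into_into[OF M.inj_on_tangent_incl[OF P_points[OF x] x]] by blast
  moreover have "h \<circ> \<pi> \<in> germs PS x" if "h \<in> germs N (\<pi> x)" for h
    using that x unfolding reduced_space_def germs_quotient points_PS by blast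
  ultimately show ?thesis
    unfolding d_proj_def Let_def
    by (intro differential_tangent[of PS N \<pi>] PS.germ_space_axioms N.germ_space_axioms)
      (use x in \<open>auto simp: points_N\<close>)
qed

lemma dproj_eqI:
  assumes x: "x \<in> P" and t: "t \<in> tangent_nu x" and v: "v \<in> tangent N (\<pi> x)"
    and eq: "\<And>h F T. h \<in> germs N (\<pi> x) \<Longrightarrow> F \<in> germs M x \<Longrightarrow> nbhd M x T \<Longrightarrow>
      (\<And>y. y \<in> T \<Longrightarrow> y \<in> P \<Longrightarrow> h (\<pi> y) = F y) \<Longrightarrow> t F = v h"
  shows "dproj x t = v"
proof
  fix h
  show "dproj x t h = v h"
  proof (cases "h \<in> germs N (\<pi> x)")
    case True
    obtain F T where F: "F \<in> germs M x" "nbhd M x T" "\<And>y. y \<in> T \<Longrightarrow> y \<in> P \<Longrightarrow> h (\<pi> y) = F y"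
      by (rule N_germD[OF x True], rule that)
    show ?thesis using dproj_apply[OF x t True F] eq[OF True F] by simp
  next
    case False
    then show ?thesis using N.tangent_outside[OF v] N.tangent_outside[OF dproj_tangent[OF x t]] by simp
  qed
qed

section \<open>Local sections of the projection\<close>

text \<open>
  A smooth section of the projection over an open set, as a map into \<open>M\<close>. Smoothness is
  expressed by pulling back germs of \<open>M\<close>.
\<close>

definition local_section :: "'m set set \<Rightarrow> ('m set \<Rightarrow> 'm) \<Rightarrow> bool" where
  "local_section UN' s \<longleftrightarrow> openin (topo N) UN' \<and> (\<forall>n\<in>UN'. s n \<in> P \<and> \<pi> (s n) = n) \<and>
     (\<forall>n\<in>UN'. \<forall>f\<in>germs M (s n). (\<lambda>n. f (s n)) \<in> germs N n) \<and>
     (\<forall>T. openin (topo M) T \<longrightarrow> openin (topo N) {n \<in> UN'. s n \<in> T})"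

lemma local_sectionD:
  assumes "local_section UN' s"
  shows "openin (topo N) UN'" "n \<in> UN' \<Longrightarrow> s n \<in> P" "n \<in> UN' \<Longrightarrow> \<pi> (s n) = n"
    "n \<in> UN' \<Longrightarrow> f \<in> germs M (s n) \<Longrightarrow> (\<lambda>n. f (s n)) \<in> germs N n"
    "openin (topo M) T \<Longrightarrow> openin (topo N) {n \<in> UN'. s n \<in> T}"
  using assms unfolding local_section_def by blast+

text \<open>
  The section takes values in the zero level, so \<open>\<nu>\<close> vanishes along it, and it is a right inverse of the projection.
\<close>

lemma section_differential:
  assumes s: "local_section UN' s" and n: "n \<in> UN'" and v: "v \<in> tangent N n"
  shows "differential N M s n v \<in> tangent_nu (s n)" "dproj (s n) (differential N M s n v) = v"
proof -
  note sD = local_sectionD[OF s]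
  note sp = P_points[OF sD(2)[OF n]]
  have nb: "nbhd N n UN'" using sD(1) n by (simp add: nbhd_def)
  let ?t = "differential N M s n v"
  have app: "?t f = v (\<lambda>n. f (s n))" if "f \<in> germs M (s n)" for f
    using that by (simp add: differential_def o_def)
  have T: "?t \<in> tangent M (s n)"
    by (rule differential_tangent[of N M s, OF N.germ_space_axioms M.germ_space_axioms sp _ v])
      (use sD(4)[OF n] in \<open>simp add: o_def\<close>)
  have "?t (\<lambda>y. \<nu> a y \<xi>) = 0" if a: "a \<in> {1,2,3}" and \<xi>: "\<xi> \<in> \<gg>" for a \<xi>
    unfolding app[OF nu_germ[OF a sp \<xi>]]
    by (rule N.tangent_cong_const[OF v nb]) (rule P_nu[OF sD(2) a \<xi>])
  with T show tn: "?t \<in> tangent_nu (s n)" unfolding tangent_nu_def by blast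
  show "dproj (s n) ?t = v"
  proof (rule dproj_eqI[OF sD(2)[OF n] tn])
    show "v \<in> tangent N (\<pi> (s n))" using v sD(3)[OF n] by simp
    fix h F T assume h: "h \<in> germs N (\<pi> (s n))" and F: "F \<in> germs M (s n)" and T: "nbhd M (s n) T"
      and eq: "\<And>y. y \<in> T \<Longrightarrow> y \<in> P \<Longrightarrow> h (\<pi> y) = F y"
    have h': "h \<in> germs N n" using h sD(3)[OF n] by simp
    have nT: "nbhd N n {n \<in> UN'. s n \<in> T}" using sD(5) T n by (simp add: nbhd_def)
    have "v (\<lambda>n. F (s n)) = v h"
    proof (rule N.tangent_cong[OF v h' nT])
      fix y assume "y \<in> {n \<in> UN'. s n \<in> T}"
      then show "F (s y) = h y" using eq[of "s y"] sD(2,3) by simp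
    qed
    then show "?t F = v h" using app[OF F] by simp
  qed
qed

text \<open>
  The map \<open>r\<close> of \<open>slice_exists\<close> is constant on orbits and hence descends to a section. Its differential at
  \<open>\<pi> m\<close> is tangent to the slice, thus horizontal. As \<open>r\<close> is \<open>s \<circ> \<pi>\<close> on the zero level, two tangent vectors
  with the same projection have the same image under \<open>dr\<close>, which is the identity up to vertical vectors;
  so they differ by a vertical vector.
\<close>

lemma reduced_slice:
  assumes m: "m \<in> P" and D: "nbhd M m D"
  obtains s UN' where "local_section UN' s" "\<pi> m \<in> UN'" "s (\<pi> m) = m" "\<And>n. n \<in> UN' \<Longrightarrow> s n \<in> D"
    "\<And>v. v \<in> tangent N (\<pi> m) \<Longrightarrow> differential N M s (\<pi> m) v \<in> hor m"
    "\<And>t t'. t \<in> tangent_nu m \<Longrightarrow> t' \<in> tangent_nu m \<Longrightarrow> dproj m t = dproj m t' \<Longrightarrow>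
      \<exists>\<xi>\<in>\<gg>. t' = tadd t (gen \<xi> m)"
proof -
  note mp = P_points[OF m]
  obtain r E1 where E1: "nbhd M m E1" and rm: "r m = m" and rorb: "\<And>y. y \<in> E1 \<Longrightarrow> \<exists>k\<in>carrier G. r y = \<phi> k y"
    and rD: "\<And>y. y \<in> E1 \<Longrightarrow> r y \<in> D"
    and rsm: "\<And>y f. y \<in> E1 \<Longrightarrow> f \<in> germs M (r y) \<Longrightarrow> (\<lambda>y. f (r y)) \<in> germs M y"
    and rc: "\<And>T. openin (topo M) T \<Longrightarrow> openin (topo M) {y \<in> E1. r y \<in> T}"
    and rinv: "\<And>k y. k \<in> carrier G \<Longrightarrow> y \<in> E1 \<Longrightarrow> \<phi> k y \<in> E1 \<Longrightarrow> r (\<phi> k y) = r y"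
    and rdiff: "\<And>t. t \<in> tangent M m \<Longrightarrow> \<exists>\<xi>\<in>\<gg>. \<forall>f\<in>germs M m. t (\<lambda>y. f (r y)) = t f + gen \<xi> m f"
    and rtang: "\<And>\<eta>. \<eta> \<in> \<gg> \<Longrightarrow> \<exists>Y\<in>germs M m. (\<forall>t\<in>tangent M m. t Y = twisted_dnu J \<nu> 1 m t \<eta>) \<and> (\<forall>y\<in>E1. Y (r y) = 0)"
    by (rule slice_exists[OF m D], rule that)
  define UN' where "UN' = \<pi> ` (E1 \<inter> P)"
  (* Any representative x of the orbit n serves, because r takes the same value on all of them. *)
  define s where "s = (\<lambda>n. r (SOME x. x \<in> E1 \<and> x \<in> P \<and> \<pi> x = n))"
  have sr: "s (\<pi> x) = r x" if x: "x \<in> E1" "x \<in> P" for x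
  proof -
    have "\<exists>y. y \<in> E1 \<and> y \<in> P \<and> \<pi> y = \<pi> x" using x by blast
    from someI_ex[OF this] obtain y where y: "y = (SOME y. y \<in> E1 \<and> y \<in> P \<and> \<pi> y = \<pi> x)"
      "y \<in> E1" "y \<in> P" "\<pi> y = \<pi> x" by blast
    obtain k where k: "k \<in> carrier G" "y = \<phi> k x" using orbit_eqD[OF y(4)[symmetric] P_points[OF y(3)]] .
    have "s (\<pi> x) = r y" by (simp add: s_def y(1))
    also have "\<dots> = r x" using rinv[OF k(1) x(1)] y(2) k(2) by simp
    finally show ?thesis .
  qed
  have rP: "r x \<in> P" "\<pi> (r x) = \<pi> x" if "x \<in> E1" "x \<in> P" for x
    using rorb[OF that(1)] P_invariant[OF that(2)] orbit_act[OF _ P_points[OF that(2)]] by auto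
  have so: "openin (topo N) {n \<in> UN'. s n \<in> T}" if T: "openin (topo M) T" for T
  proof (rule openin_N)
    let ?T = "\<Union>k\<in>carrier G. {x \<in> points M. \<phi> k x \<in> {y \<in> E1. r y \<in> T}}"
    show "openin (topo M) ?T" by (rule openin_Union) (use act_openin[OF _ rc[OF T]] in blast)
    show "{n \<in> UN'. s n \<in> T} \<subseteq> \<pi> ` P" by (auto simp: UN'_def)
    fix x assume x: "x \<in> P"
    show "\<pi> x \<in> {n \<in> UN'. s n \<in> T} \<longleftrightarrow> x \<in> ?T"
    proof
      assume "\<pi> x \<in> {n \<in> UN'. s n \<in> T}"
      then obtain y where y: "y \<in> E1" "y \<in> P" "\<pi> x = \<pi> y" "s (\<pi> x) \<in> T" by (auto simp: UN'_def)
      then obtain k where k: "k \<in> carrier G" "y = \<phi> k x" using orbit_eqD[OF y(3) P_points[OF y(2)]] by blast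
      have "r y \<in> T" using sr[OF y(1,2)] y(3,4) by simp
      then show "x \<in> ?T" using k y P_points[OF x] by auto
    next
      assume "x \<in> ?T"
      then obtain k where k: "k \<in> carrier G" "\<phi> k x \<in> E1" "r (\<phi> k x) \<in> T" by blast
      have y: "\<phi> k x \<in> P" "\<pi> (\<phi> k x) = \<pi> x" using P_invariant[OF x k(1)] orbit_act[OF k(1) P_points[OF x]] by auto
      then show "\<pi> x \<in> {n \<in> UN'. s n \<in> T}" using sr[OF k(2) y(1)] k by (auto simp: UN'_def)
    qed
  qed
  have rp: "r x \<in> points M" if "x \<in> E1" "x \<in> P" for x using P_points rP that by blast
  have "openin (topo N) {n \<in> UN'. s n \<in> points M}" by (rule so) simp
  moreover have "{n \<in> UN'. s n \<in> points M} = UN'" using sr rp by (auto simp: UN'_def)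
  ultimately have oUN: "openin (topo N) UN'" by simp
  have sg: "(\<lambda>n. f (s n)) \<in> germs N n" if n: "n \<in> UN'" and f: "f \<in> germs M (s n)" for n f
  proof -
    obtain x where x: "x \<in> E1" "x \<in> P" "n = \<pi> x" using n by (auto simp: UN'_def)
    have nb: "nbhd M x E1" using E1 x by (simp add: nbhd_def)
    have fr: "(\<lambda>y. f (r y)) \<in> germs M x" using rsm[OF x(1)] f x(3) sr[OF x(1,2)] by simp
    show ?thesis unfolding x(3) by (rule N_germI[OF x(2) fr nb]) (simp add: sr)
  qed
  have ls: "local_section UN' s"
    unfolding local_section_def
  proof (intro conjI ballI allI impI)
    fix n assume n: "n \<in> UN'"
    then obtain x where x: "x \<in> E1" "x \<in> P" "n = \<pi> x" by (auto simp: UN'_def)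
    show "s n \<in> P" "\<pi> (s n) = n" using rP[OF x(1,2)] sr[OF x(1,2)] x(3) by auto
  qed (use oUN sg so in auto)
  have mE1: "m \<in> E1" using E1 by (simp add: nbhd_def)
  have sm: "s (\<pi> m) = m" using sr[OF mE1 m] rm by simp
  have mUN: "\<pi> m \<in> UN'" using mE1 m by (auto simp: UN'_def)
  show ?thesis
  proof (rule that[OF ls mUN sm])
    show "s n \<in> D" if "n \<in> UN'" for n using that sr rD by (auto simp: UN'_def)
    show "differential N M s (\<pi> m) v \<in> hor m" if v: "v \<in> tangent N (\<pi> m)" for v
    proof -
      let ?t = "differential N M s (\<pi> m) v"
      have tn: "?t \<in> tangent_nu m" using section_differential(1)[OF ls mUN v] sm by simp
      note tM = tangent_nuD(1)[OF tn]
      have J1: "J 1 m ?t (\<lambda>y. \<nu> 1 y \<eta>) = 0" if \<eta>: "\<eta> \<in> \<gg>" for \<eta>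
      proof -
        obtain Y where Y: "Y \<in> germs M m" "\<forall>t\<in>tangent M m. t Y = twisted_dnu J \<nu> 1 m t \<eta>" "\<forall>y\<in>E1. Y (r y) = 0"
          using rtang[OF \<eta>] by blast
        have "?t Y = v (\<lambda>n. Y (s n))" using Y(1) sm by (simp add: differential_def o_def)
        also have "\<dots> = 0"
          by (rule N.tangent_cong_const[OF v, of UN']) (use oUN mUN sr Y(3) in \<open>auto simp: nbhd_def UN'_def\<close>)
        finally show ?thesis using bspec[OF Y(2) tM] by (simp add: twisted_dnu_eq)
      qed
      have "J a m ?t (\<lambda>y. \<nu> a y \<eta>) = 0" if "a \<in> {1,2,3}" "\<eta> \<in> \<gg>" for a \<eta>
        using that(1) J1[OF that(2)] cauchy_riemann[OF mp tM that(2)] by auto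
      then show ?thesis using tn unfolding hor_def by blast
    qed
    fix t t' assume t: "t \<in> tangent_nu m" and t': "t' \<in> tangent_nu m" and eq: "dproj m t = dproj m t'"
    have val: "dproj m t (\<lambda>n. f (s n)) = t (\<lambda>y. f (r y))" if f: "f \<in> germs M m" and t: "t \<in> tangent_nu m" for f t
    proof (rule dproj_apply[OF m t _ _ E1])
      show "(\<lambda>n. f (s n)) \<in> germs N (\<pi> m)" by (rule sg[OF mUN]) (simp add: sm f)
      show "(\<lambda>y. f (r y)) \<in> germs M m" by (rule rsm[OF mE1]) (simp add: rm f)
    qed (simp add: sr)
    obtain \<xi> where \<xi>: "\<xi> \<in> \<gg>" "\<And>f. f \<in> germs M m \<Longrightarrow> t (\<lambda>y. f (r y)) = t f + gen \<xi> m f"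
      using rdiff[OF tangent_nuD(1)[OF t]] by blast
    obtain \<xi>' where \<xi>': "\<xi>' \<in> \<gg>" "\<And>f. f \<in> germs M m \<Longrightarrow> t' (\<lambda>y. f (r y)) = t' f + gen \<xi>' m f"
      using rdiff[OF tangent_nuD(1)[OF t']] by blast
    let ?\<zeta> = "tadd \<xi> (tscale (- 1) \<xi>')"
    have "?\<zeta> \<in> \<gg>" using \<xi>(1) \<xi>'(1) SC.tadd_tangent SC.tscale_tangent one_points by (simp add: lie_algebra_def)
    moreover have "t' = tadd t (gen ?\<zeta> m)"
    proof
      fix f
      show "t' f = tadd t (gen ?\<zeta> m) f"
      proof (cases "f \<in> germs M m")
        case True
        have "t f + gen \<xi> m f = t' f + gen \<xi>' m f"
          using val[OF True t] val[OF True t'] eq \<xi>(2)[OF True] \<xi>'(2)[OF True] by simp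
        then show ?thesis
          unfolding gen_xi_add[OF mp] gen_xi_scale[OF mp] by (simp add: tadd_def tscale_def)
      next
        case False
        then show ?thesis
          using M.tangent_outside[OF tangent_nuD(1)[OF t]] M.tangent_outside[OF tangent_nuD(1)[OF t']]
          by (simp add: tadd_def gen_eq[OF mp])
      qed
    qed
    ultimately show "\<exists>\<xi>\<in>\<gg>. t' = tadd t (gen \<xi> m)" by blast
  qed
qed

lemma kernel_dproj:
  assumes m: "m \<in> P" and "t \<in> tangent_nu m" "t' \<in> tangent_nu m" "dproj m t = dproj m t'"
  shows "\<exists>\<xi>\<in>\<gg>. t' = tadd t (gen \<xi> m)"
proof -
  have nb: "nbhd M m (points M)" using P_points[OF m] by (simp add: nbhd_def)
  show ?thesis by (rule reduced_slice[OF m nb]) (use assms(2-) in blast)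
qed

lemma hor_tangent_nu: "t \<in> hor x \<Longrightarrow> t \<in> tangent_nu x"
  by (simp add: hor_def)

text \<open>
  The difference of two lifts is vertical and horizontal, hence zero by transversality.
\<close>

lemma horizontal_lift_unique:
  assumes m: "m \<in> P" and u: "u \<in> hor m" and u': "u' \<in> hor m" and eq: "dproj m u = dproj m u'"
  shows "u' = u"
proof -
  note mp = P_points[OF m]
  note un = hor_tangent_nu[OF u]
  obtain \<xi> where \<xi>: "\<xi> \<in> \<gg>" "u' = tadd u (gen \<xi> m)"
    using kernel_dproj[OF m un hor_tangent_nu[OF u'] eq] by blast
  have one: "1 \<in> {1, 2, 3::nat}" by simp
  have "\<xi> = tzero"
  proof (rule transversal[OF one mp \<xi>(1)])
    fix \<eta> assume \<eta>: "\<eta> \<in> \<gg>"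
    have "J 1 m u' (\<lambda>y. \<nu> 1 y \<eta>) = 0" "J 1 m u (\<lambda>y. \<nu> 1 y \<eta>) = 0"
      using u u' \<eta> one unfolding hor_def by blast+
    moreover have "J 1 m u' = tadd (J 1 m u) (J 1 m (gen \<xi> m))"
      unfolding \<xi>(2) by (rule J_add[OF one mp tangent_nuD(1)[OF un] gen_tangent[OF mp \<xi>(1)]])
    ultimately show "twisted_dnu J \<nu> 1 m (gen \<xi> m) \<eta> = 0" by (simp add: twisted_dnu_eq tadd_def)
  qed
  then show ?thesis by (simp add: \<xi>(2) tadd_def gen_eq[OF mp] tzero_def fun_eq_iff)
qed

abbreviation "lift \<equiv> horizontal_lift G S M J \<phi> \<nu>"

lemma lift_eqI:
  assumes m: "m \<in> P" and u: "u \<in> hor m" and "dproj m u = v"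
  shows "lift m v = u"
  unfolding horizontal_lift_def horizontal_eq_hor[OF m]
proof (rule the_equality)
  show "u \<in> hor m \<and> dproj m u = v" using assms by simp
  show "u' = u" if "u' \<in> hor m \<and> dproj m u' = v" for u'
    using horizontal_lift_unique[OF m u, of u'] that assms(3) by simp
qed

lemma lift_hor:
  assumes m: "m \<in> P" and v: "v \<in> tangent N (\<pi> m)"
  shows "lift m v \<in> hor m" "dproj m (lift m v) = v"
proof -
  have nb: "nbhd M m (points M)" using P_points[OF m] by (simp add: nbhd_def)
  have "\<exists>u\<in>hor m. dproj m u = v"
  proof (rule reduced_slice[OF m nb])
    fix s UN' assume s: "local_section UN' s" "\<pi> m \<in> UN'" "s (\<pi> m) = m"
      and hor: "\<And>v. v \<in> tangent N (\<pi> m) \<Longrightarrow> differential N M s (\<pi> m) v \<in> hor m"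
    from hor[OF v] show ?thesis
      by (rule bexI[rotated]) (use section_differential(2)[OF s(1,2) v] s(3) in simp)
  qed
  then obtain u where "u \<in> hor m" "dproj m u = v" by blast
  then show "lift m v \<in> hor m" "dproj m (lift m v) = v" using lift_eqI[OF m] by auto
qed

text \<open>Composing the coordinates of \<open>M\<close> with a local section, and the retraction onto the zero
  level with the projection, exhibits the reduced space as a Euclidean retract.\<close>

lemma reduced_retract:
  assumes m: "m \<in> P"
  obtains c :: "'m \<Rightarrow> 'a" and \<kappa> U E s UN' \<kappa>N EN where "linear_chart M c \<kappa> U E W" "m \<in> U"
    "local_section UN' s" "\<pi> m \<in> UN'" "s (\<pi> m) = m" "\<And>n. n \<in> UN' \<Longrightarrow> s n \<in> U"
    "\<And>v. v \<in> tangent N (\<pi> m) \<Longrightarrow> differential N M s (\<pi> m) v \<in> hor m"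
    "euclidean_retract N (\<lambda>n. c (s n)) \<kappa>N UN' EN"
proof -
  note mp = P_points[OF m]
  obtain c \<kappa> U E where mU: "m \<in> U" and lc: "linear_chart M c \<kappa> U E W"
    by (rule manifold_linear_chart[OF manifoldM mp], rule that)
  interpret C: linear_chart M c \<kappa> U E W by fact
  obtain X R where XR: "open X" "c m \<in> X" "vsmooth_on X R"
    "\<And>p. p \<in> X \<Longrightarrow> R p \<in> E" "\<And>p. p \<in> X \<Longrightarrow> \<kappa> (R p) \<in> P"
    "\<And>p. p \<in> X \<Longrightarrow> p \<in> E \<Longrightarrow> \<kappa> p \<in> P \<Longrightarrow> R p = p"
    by (rule zero_level_retraction[OF lc m mU], rule that)
  define D where "D = {y \<in> U. c y \<in> X}"
  have D: "nbhd M m D" unfolding D_def by (rule C.nbhd_c[OF mU XR(1,2)])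
  obtain s UN' where ls: "local_section UN' s" and mUN: "\<pi> m \<in> UN'" and sm: "s (\<pi> m) = m"
    and sD: "\<And>n. n \<in> UN' \<Longrightarrow> s n \<in> D"
    and sh: "\<And>v. v \<in> tangent N (\<pi> m) \<Longrightarrow> differential N M s (\<pi> m) v \<in> hor m"
    by (rule reduced_slice[OF m D], rule that)
  note sL = local_sectionD[OF ls]
  have sU: "s n \<in> U" "c (s n) \<in> X" if "n \<in> UN'" for n using sD[OF that] by (auto simp: D_def)
  have "euclidean_retract N (\<lambda>n. c (s n)) (\<lambda>p. \<pi> (\<kappa> (R p))) UN' X"
  proof
    show "openin (topo N) UN'" by (rule sL(1))
    show "open X" by (rule XR(1))
    show "c (s n) \<in> X" if "n \<in> UN'" for n by (rule sU(2)[OF that])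
    show "\<pi> (\<kappa> (R (c (s n)))) = n" if n: "n \<in> UN'" for n
    proof -
      have "\<kappa> (c (s n)) = s n" by (rule C.\<kappa>c[OF sU(1)[OF n]])
      then have "R (c (s n)) = c (s n)" using XR(6)[OF sU(2)[OF n] C.cE[OF sU(1)[OF n]]] sL(2)[OF n] by simp
      then show ?thesis using C.\<kappa>c[OF sU(1)[OF n]] sL(3)[OF n] by simp
    qed
    show "\<pi> (\<kappa> (R p)) \<in> points N" if "p \<in> X" for p using XR(5)[OF that] by (simp add: points_N)
    show "openin (topo N) {n \<in> UN'. c (s n) \<in> T}" if T: "open T" for T
    proof -
      have "{n \<in> UN'. c (s n) \<in> T} = {n \<in> UN'. s n \<in> {y \<in> U. c y \<in> T}}" using sU(1) by auto
      then show ?thesis using sL(5)[OF C.c_cont[OF T]] by simp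
    qed
    show "F \<circ> (\<lambda>n. c (s n)) \<in> germs N n" if "n \<in> UN'" "open T" "c (s n) \<in> T" "smooth_on T F" for n T F
      using sL(4)[OF that(1) C.c_smooth[OF sU(1)[OF that(1)] that(2,3,4)]] by (simp add: o_def)
    show "\<exists>T. open T \<and> p \<in> T \<and> smooth_on T (f \<circ> (\<lambda>p. \<pi> (\<kappa> (R p))))"
      if p: "p \<in> X" and f: "f \<in> germs N (\<pi> (\<kappa> (R p)))" for p f
    proof -
      obtain F T where F: "F \<in> germs M (\<kappa> (R p))" "nbhd M (\<kappa> (R p)) T" "\<And>y. y \<in> T \<Longrightarrow> y \<in> P \<Longrightarrow> f (\<pi> y) = F y"
        by (rule N_germD[OF XR(5)[OF p] f], rule that)
      obtain T1 where T1: "open T1" "R p \<in> T1" "smooth_on T1 (F \<circ> \<kappa>)"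
        using C.\<kappa>_smooth[OF XR(4)[OF p] F(1)] by blast
      define T2 where "T2 = X \<inter> R -` (T1 \<inter> {q \<in> E. \<kappa> q \<in> T})"
      have oT2: "open T2" unfolding T2_def
        by (rule continuous_open_preimage[OF vsmooth_on_continuous[OF XR(3)] XR(1)])
          (use T1(1) C.\<kappa>_cont F(2) in \<open>auto simp: nbhd_def intro: open_Int\<close>)
      have "smooth_on T2 (\<lambda>q. (F \<circ> \<kappa>) (R q))"
        by (rule smooth_on_compose[where F = R, OF oT2 _ T1(3) vsmooth_on_subset[OF XR(3)]]) (auto simp: T2_def)
      moreover have "(f \<circ> (\<lambda>p. \<pi> (\<kappa> (R p)))) q = (F \<circ> \<kappa>) (R q)" if "q \<in> T2" for q
        using that XR(5) F(3) by (simp add: T2_def)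
      ultimately have "smooth_on T2 (f \<circ> (\<lambda>p. \<pi> (\<kappa> (R p))))"
        using smooth_on_cong[OF oT2, of "f \<circ> (\<lambda>p. \<pi> (\<kappa> (R p)))" "\<lambda>q. (F \<circ> \<kappa>) (R q)"] by blast
      moreover have "p \<in> T2" using p T1(2) XR(4)[OF p] F(2) by (simp add: T2_def nbhd_def)
      ultimately show ?thesis using oT2 by blast
    qed
  qed
  from that[OF lc mU ls mUN sm sU(1) sh this] show ?thesis .
qed

end

section \<open>Reduction of the potential\<close>

context reduction
begin

abbreviation "I \<equiv> reduced_hypercomplex G S M J \<phi> \<nu>"
abbreviation "fib \<equiv> fibre_point G S M \<phi> \<nu>"

lemma fibre_point_mem:
  assumes "n \<in> points N" shows "fib n \<in> P" "\<pi> (fib n) = n"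
proof -
  have "\<exists>m. m \<in> P \<and> \<pi> m = n" using assms by (auto simp: points_N)
  from someI_ex[OF this, folded fibre_point_def] show "fib n \<in> P" "\<pi> (fib n) = n" by auto
qed

lemma reduced_lift:
  assumes n: "n \<in> points N" and v: "v \<in> tangent N n"
  shows "lift (fib n) v \<in> hor (fib n)" "dproj (fib n) (lift (fib n) v) = v"
  using lift_hor[OF fibre_point_mem(1)[OF n], of v] v fibre_point_mem(2)[OF n] by simp_all

lemma reduced_J:
  assumes n: "n \<in> points N" and v: "v \<in> tangent N n" and a: "a \<in> {1,2,3}"
  shows "I a n v = dproj (fib n) (J a (fib n) (lift (fib n) v))"
    "I a n v \<in> tangent N n" "lift (fib n) (I a n v) = J a (fib n) (lift (fib n) v)"
proof -
  note m = fibre_point_mem[OF n]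
  have h: "J a (fib n) (lift (fib n) v) \<in> hor (fib n)"
    by (rule J_hor[OF P_points[OF m(1)] reduced_lift(1)[OF n v] a])
  show eq: "I a n v = dproj (fib n) (J a (fib n) (lift (fib n) v))"
    by (simp add: reduced_hypercomplex_def Let_def)
  show "I a n v \<in> tangent N n"
    using dproj_tangent[OF m(1) hor_tangent_nu[OF h]] m(2) eq by simp
  show "lift (fib n) (I a n v) = J a (fib n) (lift (fib n) v)"
    by (rule lift_eqI[OF m(1) h eq[symmetric]])
qed

end

locale potential_reduction = reduction W M J V G S \<phi> \<nu> cS \<kappa>S US ES
  for W :: "'a::euclidean_space set" and M :: "'m smooth_space" and J :: "nat \<Rightarrow> 'm endo"
    and V :: "'b::euclidean_space set" and G :: "('g, 'x) monoid_scheme" and S :: "'g smooth_space"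
    and \<phi> :: "'g \<Rightarrow> 'm \<Rightarrow> 'm" and \<nu> :: "nat \<Rightarrow> 'm \<Rightarrow> 'g tvec \<Rightarrow> real"
    and cS :: "'g \<Rightarrow> 'b" and \<kappa>S :: "'b \<Rightarrow> 'g" and US :: "'g set" and ES :: "'b set" +
  fixes \<rho> :: "'m \<Rightarrow> real"
  assumes smooth_\<rho>: "smooth_fun M \<rho>"
    and invariant_\<rho>: "\<And>h m. h \<in> carrier G \<Longrightarrow> m \<in> points M \<Longrightarrow> \<rho> (\<phi> h m) = \<rho> m"
    and vertical_\<rho>: "\<And>m \<xi> a. m \<in> P \<Longrightarrow> \<xi> \<in> \<gg> \<Longrightarrow> a \<in> {1,2,3} \<Longrightarrow> twisted_d0 (J a) \<rho> m (gen \<xi> m) = 0"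
begin

text \<open>
  By invariance of \<open>\<rho>\<close> the choice of the point in the fibre is immaterial, see \<open>\<rho>N_orbit\<close>.
\<close>

definition "\<rho>N n = \<rho> (fib n)"

lemma \<rho>N_orbit: assumes x: "x \<in> P" shows "\<rho>N (\<pi> x) = \<rho> x"
proof -
  have n: "\<pi> x \<in> points N" using x by (simp add: points_N)
  obtain k where "k \<in> carrier G" "x = \<phi> k (fib (\<pi> x))"
    using orbit_eqD[OF fibre_point_mem(2)[OF n] P_points[OF x]] .
  then show ?thesis using invariant_\<rho> P_points[OF fibre_point_mem(1)[OF n]] by (metis \<rho>N_def)
qed

lemma \<rho>_germ: "x \<in> points M \<Longrightarrow> \<rho> \<in> germs M x"
  using smooth_\<rho> by (simp add: smooth_fun_def)

lemma \<rho>N_germ: assumes "n \<in> points N" shows "\<rho>N \<in> germs N n"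
proof -
  obtain x where x: "x \<in> P" "n = \<pi> x" using assms by (auto simp: points_N)
  note xp = P_points[OF x(1)]
  show ?thesis unfolding x(2)
    by (rule N_germI[OF x(1) \<rho>_germ[OF xp], of "points M"]) (use xp \<rho>N_orbit in \<open>auto simp: nbhd_def\<close>)
qed

lemma smooth_\<rho>N: "smooth_fun N \<rho>N"
  by (simp add: smooth_fun_def \<rho>N_germ)

lemma dproj_\<rho>N:
  assumes x: "x \<in> P" and t: "t \<in> tangent_nu x" shows "dproj x t \<rho>N = t \<rho>"
proof -
  note xp = P_points[OF x]
  have "\<pi> x \<in> points N" using x by (simp add: points_N)
  from dproj_apply[OF x t \<rho>N_germ[OF this] \<rho>_germ[OF xp], of "points M"]
  show ?thesis using xp \<rho>N_orbit by (simp add: nbhd_def)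
qed

lemma twisted_eq: "twisted_d0 K f x t = - K x t f"
  by (simp add: twisted_d0_def act1_def d0_def)

lemma act1_twisted_eq: "act1 K (twisted_d0 L f) x t = L x (K x t) f"
  by (simp add: act1_def twisted_eq)

text \<open>
  The form \<open>I\<^sub>a d\<rho>\<close> on the zero level is the pull-back of the corresponding form on the reduced space:
  both agree on horizontal vectors, and the form on the zero level vanishes on the orbits.
\<close>

lemma reduced_form_pullback:
  assumes x: "x \<in> P" and t: "t \<in> tangent_nu x" and a: "a \<in> {1,2,3}"
  shows "twisted_d0 (I a) \<rho>N (\<pi> x) (dproj x t) = twisted_d0 (J a) \<rho> x t"
proof -
  let ?n = "\<pi> x" let ?m = "fib ?n" let ?B = "dproj x t"
  have n: "?n \<in> points N" using x by (simp add: points_N)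
  note m = fibre_point_mem[OF n]
  note xp = P_points[OF x] and mp = P_points[OF m(1)]
  have B: "?B \<in> tangent N ?n" by (rule dproj_tangent[OF x t])
  let ?u = "lift ?m ?B"
  note u = reduced_lift[OF n B]
  note un = hor_tangent_nu[OF u(1)]
  note uM = tangent_nuD(1)[OF un]
  have Ju: "J a ?m ?u \<in> hor ?m" by (rule J_hor[OF mp u(1) a])
  obtain k where k: "k \<in> carrier G" "x = \<phi> k ?m" by (rule orbit_eqD[OF m(2) xp], rule that)
  let ?t' = "differential M M (\<phi> k) ?m ?u"
  have app: "differential M M (\<phi> k) ?m s f = s (\<lambda>y. f (\<phi> k y))" if "f \<in> germs M x" for s f
    using that k(2) by (simp add: differential_def o_def)
  have t'M: "?t' \<in> tangent M x" using act_tangent[OF k(1) mp uM] k(2) by simp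
  have nbm: "nbhd M ?m (points M)" using mp by (simp add: nbhd_def)
  have "?t' (\<lambda>y. \<nu> b y \<xi>) = 0" if b: "b \<in> {1,2,3}" and \<xi>: "\<xi> \<in> \<gg>" for b \<xi>
  proof -
    let ?\<eta> = "Ad G S (inv\<^bsub>G\<^esub> k) \<xi>"
    have \<eta>: "?\<eta> \<in> \<gg>" by (rule Ad_closed[OF G.inv_closed[OF k(1)] \<xi>])
    have "?t' (\<lambda>y. \<nu> b y \<xi>) = ?u (\<lambda>y. \<nu> b (\<phi> k y) \<xi>)" by (rule app[OF nu_germ[OF b xp \<xi>]])
    also have "\<dots> = ?u (\<lambda>y. \<nu> b y ?\<eta>)"
      by (rule M.tangent_cong[OF uM nu_germ[OF b mp \<eta>] nbm]) (rule nu_equivariant[OF b k(1) _ \<xi>])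
    also have "\<dots> = 0" by (rule tangent_nuD(2)[OF un b \<eta>])
    finally show ?thesis .
  qed
  with t'M have t'n: "?t' \<in> tangent_nu x" unfolding tangent_nu_def by blast
  have "dproj x ?t' = ?B"
  proof (rule dproj_eqI[OF x t'n B])
    fix h F T assume h: "h \<in> germs N ?n" and F: "F \<in> germs M x" and T: "nbhd M x T"
      and eq: "\<And>y. y \<in> T \<Longrightarrow> y \<in> P \<Longrightarrow> h (\<pi> y) = F y"
    have Fk: "(\<lambda>y. F (\<phi> k y)) \<in> germs M ?m" using act_germ_snd[OF k(1) mp] F k(2) by simp
    have nb: "nbhd M ?m {y \<in> points M. \<phi> k y \<in> T}"
      using act_openin[OF k(1)] T mp k(2) by (simp add: nbhd_def)
    have "h \<in> germs N (\<pi> ?m)" using h m(2) by simp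
    then have "dproj ?m ?u h = ?u (\<lambda>y. F (\<phi> k y))"
    proof (rule dproj_apply[OF m(1) un _ Fk nb])
      fix y assume y: "y \<in> {y \<in> points M. \<phi> k y \<in> T}" "y \<in> P"
      then have "h (\<pi> (\<phi> k y)) = F (\<phi> k y)" using eq P_invariant[OF y(2) k(1)] by blast
      then show "h (\<pi> y) = F (\<phi> k y)" using orbit_act[OF k(1)] y(1) by simp
    qed
    then show "?t' F = ?B h" using u(2) app[OF F] by simp
  qed
  then obtain \<xi> where \<xi>: "\<xi> \<in> \<gg>" "t = tadd ?t' (gen \<xi> x)"
    using kernel_dproj[OF x t'n t] by auto
  have "J a x t = J a x (tadd ?t' (gen \<xi> x))" by (rule arg_cong[OF \<xi>(2)])
  also have "\<dots> = tadd (J a x ?t') (J a x (gen \<xi> x))"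
    by (rule J_add[OF a xp t'M gen_tangent[OF xp \<xi>(1)]])
  finally have "J a x t \<rho> = J a x ?t' \<rho>"
    using vertical_\<rho>[OF x \<xi>(1) a] by (simp add: twisted_eq tadd_def)
  also have "J a x ?t' = differential M M (\<phi> k) ?m (J a ?m ?u)"
    using equivariantJ[OF k(1) mp uM a] k(2) by simp
  also have "\<dots> \<rho> = J a ?m ?u (\<lambda>y. \<rho> (\<phi> k y))" by (rule app[OF \<rho>_germ[OF xp]])
  also have "\<dots> = J a ?m ?u \<rho>"
    by (rule M.tangent_cong[OF J_tangent[OF a mp uM] \<rho>_germ[OF mp] nbm]) (rule invariant_\<rho>[OF k(1)])
  also have "\<dots> = dproj ?m (J a ?m ?u) \<rho>N" using dproj_\<rho>N[OF m(1) hor_tangent_nu[OF Ju]] by simp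
  also have "\<dots> = I a ?n ?B \<rho>N" by (simp add: reduced_J(1)[OF n B a])
  finally show ?thesis by (simp add: twisted_eq)
qed

text \<open>
  Near \<open>\<pi> m\<close> the form on the reduced space is the pull-back along a local section \<open>s\<close> of
  \<open>\<Sum>\<^sub>b co\<^sub>b dc\<^sub>b\<close>, that is \<open>\<Sum>\<^sub>b (co\<^sub>b \<circ> s) d(c\<^sub>b \<circ> s)\<close>, and \<open>d1_eq\<close> evaluates both exterior derivatives to
  the same expression. Besides \<open>I\<^sub>a d\<rho>\<close> itself, \<open>\<gamma>\<close> may be \<open>I\<^sub>b (I\<^sub>c d\<rho>)\<close>, which agrees with it on tangent
  vectors; both forms occur in the potential equation.
\<close>

lemma d1_reduced:
  assumes m: "m \<in> P" and a: "a \<in> {1,2,3}" and v: "v \<in> tangent N (\<pi> m)" and w: "w \<in> tangent N (\<pi> m)"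
    and \<gamma>: "\<And>y t. y \<in> points M \<Longrightarrow> t \<in> tangent M y \<Longrightarrow> \<gamma> y t = twisted_d0 (J a) \<rho> y t"
    and \<delta>: "\<And>n t. n \<in> points N \<Longrightarrow> t \<in> tangent N n \<Longrightarrow> \<delta> n t = twisted_d0 (I a) \<rho>N n t"
  shows "d1 N \<delta> (\<pi> m) v w = d1 M \<gamma> m (lift m v) (lift m w)"
proof -
  note mp = P_points[OF m]
  obtain c :: "'m \<Rightarrow> 'a" and \<kappa> U E s UN' \<kappa>N EN where lc: "linear_chart M c \<kappa> U E W" and mU: "m \<in> U"
    and ls: "local_section UN' s" and mUN: "\<pi> m \<in> UN'" and sm: "s (\<pi> m) = m" and sU: "\<And>n. n \<in> UN' \<Longrightarrow> s n \<in> U"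
    and sh: "\<And>v. v \<in> tangent N (\<pi> m) \<Longrightarrow> differential N M s (\<pi> m) v \<in> hor m"
    and er: "euclidean_retract N (\<lambda>n. c (s n)) \<kappa>N UN' EN"
    by (rule reduced_retract[OF m], rule that)
  interpret C: linear_chart M c \<kappa> U E W by fact
  interpret R: euclidean_retract N "\<lambda>n. c (s n)" \<kappa>N UN' EN by fact
  note sL = local_sectionD[OF ls]
  let ?\<alpha> = "twisted_d0 (J a) \<rho>"
  define co where "co = (\<lambda>b y. ?\<alpha> y (C.coord_field b y))"
  have form: "?\<alpha> y t = (\<Sum>b\<in>Basis. co b y * t (\<lambda>y. c y \<bullet> b))" if y: "y \<in> U" and t: "t \<in> tangent M y" for y t
    unfolding co_def
  proof (rule C.form_eq_coords[OF y t])
    note yp = C.U_points[OF y]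
    show "?\<alpha> y (tadd u v) = ?\<alpha> y u + ?\<alpha> y v" if "u \<in> tangent M y" "v \<in> tangent M y" for u v
      unfolding twisted_eq J_add[OF a yp that] by (simp add: tadd_def)
    show "?\<alpha> y (tscale r v) = r * ?\<alpha> y v" if "v \<in> tangent M y" for r v
      unfolding twisted_eq J_scale[OF a yp that] by (simp add: tscale_def)
  qed
  have cog: "co b \<in> germs M y" if y: "y \<in> U" for b y
  proof -
    have "vfield_near M y (\<lambda>y. J a y (C.coord_field b y))"
      by (rule J_vfield[OF a C.U_points[OF y] C.coord_field_vfield[OF y]])
    then have "(\<lambda>z. J a z (C.coord_field b z) \<rho>) \<in> germs M y"
      using \<rho>_germ[OF C.U_points[OF y]] unfolding vfield_near_def nbhd_def by blast
    from M.scale_germ[OF C.U_points[OF y] this, of "- 1"] show ?thesis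
      by (simp add: co_def twisted_eq)
  qed
  let ?dv = "differential N M s (\<pi> m) v" let ?dw = "differential N M s (\<pi> m) w"
  have lv: "lift m v = ?dv" "lift m w = ?dw"
    using lift_eqI[OF m sh] section_differential(2)[OF ls mUN] v w sm by simp_all
  have dT: "?dv \<in> tangent M m" "?dw \<in> tangent M m" using sh v w hor_tangent_nu tangent_nuD(1) by blast+
  have app: "differential N M s n u f = u (\<lambda>n. f (s n))" if "f \<in> germs M (s n)" for n u f
    using that by (simp add: differential_def o_def)
  have 1: "d1 M \<gamma> m ?dv ?dw = (\<Sum>b\<in>Basis. ?dv (co b) * ?dw (\<lambda>y. c y \<bullet> b) - ?dw (co b) * ?dv (\<lambda>y. c y \<bullet> b))"
    by (rule C.d1_eq[OF mU dT finite_Basis cog[OF mU] C.coord_germ[OF mU] C.nbhd_U[OF mU]])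
      (use \<gamma> form C.U_points in simp)
  have 2: "d1 N \<delta> (\<pi> m) v w = (\<Sum>b\<in>Basis. v (\<lambda>n. co b (s n)) * w (\<lambda>n. c (s n) \<bullet> b) -
      w (\<lambda>n. co b (s n)) * v (\<lambda>n. c (s n) \<bullet> b))"
  proof (rule R.d1_eq[OF mUN v w finite_Basis _ R.coord_germ[OF mUN] R.nbhd_U[OF mUN]])
    show "(\<lambda>n. co b (s n)) \<in> germs N (\<pi> m)" for b by (rule sL(4)[OF mUN]) (simp add: sm cog mU)
    fix n u assume n: "n \<in> UN'" and u: "u \<in> tangent N n"
    let ?t = "differential N M s n u"
    note t = section_differential[OF ls n u]
    have "\<delta> n u = twisted_d0 (I a) \<rho>N (\<pi> (s n)) (dproj (s n) ?t)"
      using \<delta>[OF R.U_points[OF n] u] sL(3)[OF n] t(2) by simp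
    also have "\<dots> = ?\<alpha> (s n) ?t" by (rule reduced_form_pullback[OF sL(2)[OF n] t(1) a])
    also have "\<dots> = (\<Sum>b\<in>Basis. co b (s n) * ?t (\<lambda>y. c y \<bullet> b))"
      by (rule form[OF sU[OF n] tangent_nuD(1)[OF t(1)]])
    also have "\<dots> = (\<Sum>b\<in>Basis. co b (s n) * u (\<lambda>n. c (s n) \<bullet> b))"
      using app[OF C.coord_germ[OF sU[OF n]]] by simp
    finally show "\<delta> n u = (\<Sum>b\<in>Basis. co b (s n) * u (\<lambda>n. c (s n) \<bullet> b))" .
  qed
  have "co b \<in> germs M (s (\<pi> m))" "(\<lambda>y. c y \<bullet> b) \<in> germs M (s (\<pi> m))" for b
    using cog[OF mU] C.coord_germ[OF mU] sm by simp_all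
  note ap = app[OF this(1)] app[OF this(2)]
  show ?thesis unfolding lv 1 2 ap ..
qed

text \<open>
  The second identity reduces to the first one, since \<open>I\<^sub>b (I\<^sub>c d\<rho>) = I\<^sub>a d\<rho>\<close> on tangent vectors.
\<close>

lemma d1_twisted_reduced:
  assumes abc: "(a, b, c) \<in> {(1,2,3), (2,3,1), (3,1,2)}"
    and n: "n \<in> points N" and v: "v \<in> tangent N n" and w: "w \<in> tangent N n"
  shows "d1 N (twisted_d0 (I a) \<rho>N) n v w = d1 M (twisted_d0 (J a) \<rho>) (fib n) (lift (fib n) v) (lift (fib n) w)"
    "twisted_d1 N (I b) (twisted_d0 (I c) \<rho>N) n v w =
      twisted_d1 M (J b) (twisted_d0 (J c) \<rho>) (fib n) (lift (fib n) v) (lift (fib n) w)"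
proof -
  note m = fibre_point_mem[OF n]
  have a: "a \<in> {1,2,3}" and b: "b \<in> {1,2,3}" and c: "c \<in> {1,2,3}" using abc by auto
  have JJ: "J c y (J b y t) = tscale (- 1) (J a y t)" if "y \<in> points M" "t \<in> tangent M y" for y t
    using abc J_J(3,5,7)[OF that] by auto
  have v': "v \<in> tangent N (\<pi> (fib n))" "w \<in> tangent N (\<pi> (fib n))" using v w m(2) by simp_all
  show "d1 N (twisted_d0 (I a) \<rho>N) n v w = d1 M (twisted_d0 (J a) \<rho>) (fib n) (lift (fib n) v) (lift (fib n) w)"
    using d1_reduced[OF m(1) a v', of "twisted_d0 (J a) \<rho>" "twisted_d0 (I a) \<rho>N"] m(2) by simp
  have Iv: "I b n v \<in> tangent N (\<pi> (fib n))" "I b n w \<in> tangent N (\<pi> (fib n))"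
    using reduced_J(2)[OF n _ b] v w m(2) by simp_all
  have "d1 N (act1 (I b) (twisted_d0 (I c) \<rho>N)) (\<pi> (fib n)) (I b n v) (I b n w) =
      d1 M (act1 (J b) (twisted_d0 (J c) \<rho>)) (fib n) (lift (fib n) (I b n v)) (lift (fib n) (I b n w))"
  proof (rule d1_reduced[OF m(1) a Iv])
    show "act1 (J b) (twisted_d0 (J c) \<rho>) y t = twisted_d0 (J a) \<rho> y t" if "y \<in> points M" "t \<in> tangent M y" for y t
      using JJ[OF that] by (simp add: act1_twisted_eq twisted_eq tscale_def)
    fix n' t assume n': "n' \<in> points N" and t: "t \<in> tangent N n'"
    let ?m = "fib n'" let ?u = "lift ?m t"
    note m' = fibre_point_mem(1)[OF n']
    note u = reduced_lift(1)[OF n' t]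
    note uM = tangent_nuD(1)[OF hor_tangent_nu[OF u]]
    have ev: "I k n' z \<rho>N = J k ?m (lift ?m z) \<rho>" if "k \<in> {1,2,3}" "z \<in> tangent N n'" for k z
      using reduced_J(1)[OF n' that(2,1)]
        dproj_\<rho>N[OF m' hor_tangent_nu[OF J_hor[OF P_points[OF m'] reduced_lift(1)[OF n' that(2)] that(1)]]] by simp
    have "I c n' (I b n' t) \<rho>N = J c ?m (J b ?m ?u) \<rho>"
      using ev[OF c reduced_J(2)[OF n' t b]] reduced_J(3)[OF n' t b] by simp
    also have "\<dots> = - I a n' t \<rho>N" using JJ[OF P_points[OF m'] uM] ev[OF a t] by (simp add: tscale_def)
    finally show "act1 (I b) (twisted_d0 (I c) \<rho>N) n' t = twisted_d0 (I a) \<rho>N n' t"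
      by (simp add: act1_twisted_eq twisted_eq)
  qed
  then show "twisted_d1 N (I b) (twisted_d0 (I c) \<rho>N) n v w =
      twisted_d1 M (J b) (twisted_d0 (J c) \<rho>) (fib n) (lift (fib n) v) (lift (fib n) w)"
    using m(2) reduced_J(3)[OF n v b] reduced_J(3)[OF n w b] by (simp add: twisted_d1_def act2_def)
qed

lemma reduced_potential:
  assumes pot: "HKT_potential M J g \<rho>"
  shows "HKT_potential N I (reduced_metric G S M J g \<phi> \<nu>) \<rho>N"
  unfolding HKT_potential_def
proof (intro conjI smooth_\<rho>N ballI, clarify)
  fix a b c n v w
  assume abc: "(a, b, c) \<in> {(1::nat, 2::nat, 3::nat), (2, 3, 1), (3, 1, 2)}"
    and n: "n \<in> points N" and v: "v \<in> tangent N n" and w: "w \<in> tangent N n"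
  let ?m = "fib n" let ?v = "lift ?m v" let ?w = "lift ?m w"
  have a: "a \<in> {1,2,3}" using abc by auto
  have mp: "?m \<in> points M" by (rule P_points[OF fibre_point_mem(1)[OF n]])
  have vT: "?v \<in> tangent M ?m" "?w \<in> tangent M ?m"
    using tangent_nuD(1)[OF hor_tangent_nu[OF reduced_lift(1)[OF n v]]]
      tangent_nuD(1)[OF hor_tangent_nu[OF reduced_lift(1)[OF n w]]] by auto
  have "kaehler_form (I a) (reduced_metric G S M J g \<phi> \<nu>) n v w = kaehler_form (J a) g ?m ?v ?w"
    by (simp add: kaehler_form_def reduced_metric_def Let_def reduced_J(3)[OF n v a])
  moreover have "2 * kaehler_form (J a) g ?m ?v ?w = d1 M (twisted_d0 (J a) \<rho>) ?m ?v ?w +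
      twisted_d1 M (J b) (twisted_d0 (J c) \<rho>) ?m ?v ?w"
    using pot abc mp vT unfolding HKT_potential_def by fast
  ultimately show "2 * kaehler_form (I a) (reduced_metric G S M J g \<phi> \<nu>) n v w =
      d1 N (twisted_d0 (I a) \<rho>N) n v w + twisted_d1 N (I b) (twisted_d0 (I c) \<rho>N) n v w"
    using d1_twisted_reduced[OF abc n v w] by simp
qed

end

theorem theorem5:
  fixes W :: "'a::euclidean_space set" and M :: "'m smooth_space"
    and J :: "nat \<Rightarrow> 'm endo" and g :: "'m form2" and \<rho> :: "'m \<Rightarrow> real"
    and V :: "'b::euclidean_space set" and G :: "('g, 'x) monoid_scheme" and S :: "'g smooth_space"
    and \<phi> :: "'g \<Rightarrow> 'm \<Rightarrow> 'm" and \<nu> :: "nat \<Rightarrow> 'm \<Rightarrow> 'g tvec \<Rightarrow> real"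
  defines "P \<equiv> zero_level G S M \<nu>"
  assumes "HKT_manifold W M J g"
    and "HKT_potential M J g \<rho>"
    and "lie_group V G S" and "compact_space (topo S)"
    and "smooth_action V W G S M \<phi>"
    and "\<forall>h\<in>carrier G. hypercomplex_isometry M J g (\<phi> h)"
    and "\<forall>h\<in>carrier G. \<forall>m\<in>points M. \<rho> (\<phi> h m) = \<rho> m"
    and "moment_map G S M J \<phi> \<nu>"
    and "P \<noteq> {}"
    and "\<forall>m\<in>P. stabilizer G \<phi> m = {\<one>\<^bsub>G\<^esub>}"
    and "\<forall>m\<in>P. \<forall>\<xi>\<in>lie_algebra G S. \<forall>a\<in>{1,2,3}.
           twisted_d0 (J a) \<rho> m (generated_field G S M \<phi> \<xi> m) = 0"
  shows "\<exists>\<rho>N. (\<forall>x\<in>P. \<rho>N (orbit G \<phi> x) = \<rho> x) \<and>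
           HKT_potential (reduced_space G S M \<phi> \<nu>) (reduced_hypercomplex G S M J \<phi> \<nu>)
             (reduced_metric G S M J g \<phi> \<nu>) \<rho>N"
proof -
  have man: "manifold W M" and hyp: "hypercomplex M J" using assms(2) by (auto simp: HKT_manifold_def)
  have manS: "manifold V S" and ptS: "points S = carrier G" and grp: "group G"
    using assms(4) by (auto simp: lie_group_def)
  have one: "\<one>\<^bsub>G\<^esub> \<in> points S" using ptS group.is_monoid[OF grp] monoid.one_closed by metis
  obtain cS \<kappa>S US ES where cS: "\<one>\<^bsub>G\<^esub> \<in> US" "linear_chart S cS \<kappa>S US ES V"
    by (rule manifold_linear_chart[OF manS one], rule that)
  have eq: "differential M M (\<phi> h) m (J a m v) = J a (\<phi> h m) (differential M M (\<phi> h) m v)"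
    if "h \<in> carrier G" "m \<in> points M" "v \<in> tangent M m" "a \<in> {1,2,3}" for h m v a
    using assms(7) that unfolding hypercomplex_isometry_def by blast
  interpret potential_reduction W M J V G S \<phi> \<nu> cS \<kappa>S US ES \<rho>
  proof (intro potential_reduction.intro reduction.intro potential_reduction_axioms.intro)
    show "stabilizer G \<phi> m = {\<one>\<^bsub>G\<^esub>}" if "m \<in> zero_level G S M \<nu>" for m
      using assms(11) that unfolding P_def by blast
    show "smooth_fun M \<rho>" using assms(3) by (simp add: HKT_potential_def)
    show "\<rho> (\<phi> h m) = \<rho> m" if "h \<in> carrier G" "m \<in> points M" for h m using assms(8) that by blast
    show "twisted_d0 (J a) \<rho> m (generated_field G S M \<phi> \<xi> m) = 0"
      if "m \<in> zero_level G S M \<nu>" "\<xi> \<in> lie_algebra G S" "a \<in> {1,2,3}" for m \<xi> a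
      using assms(12) that unfolding P_def by blast
  qed (fact man hyp assms(4-6,9) eq cS)+
  show ?thesis
    unfolding P_def
    by (rule exI[of _ \<rho>N], intro conjI ballI reduced_potential[OF assms(3)] \<rho>N_orbit)
qed

end
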